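(* Let $0<p<\infty$. Suppose that $\alpha$ and $\beta$ are positive numbers such that the averaging projection $\mathcal{Q}_{\alpha,\beta}$ is bounded on $\boldsymbol{S}_p$. Then $p\ge1$ and $$-p<\max\{\alpha,\beta\}(p-2)<p.$$
   Context: $\mathbb{R}_+=(0,\infty)$. $\boldsymbol{S}_p$ ($0<p<\infty$) is the Schatten--von Neumann class of operators $T$ on $L^2(\mathbb{R}_+)$ with $\|T\|_{\boldsymbol{S}_p}=\big(\sum_{j\ge0}s_j(T)^p\big)^{1/p}<\infty$, where $s_j(T)$ are the singular values (for $p<1$ this is a quasinorm). $\boldsymbol{S}_2$ is the Hilbert--Schmidt class, identified with $L^2(\mathbb{R}_+^2)$ via $k\mapsto\mathfrak{I}_k$, $(\mathfrak{I}_kf)(x)=\int_{\mathbb{R}_+}k(x,y)f(y)\,dy$. For $\alpha,\beta>0$ and a function $\varphi$ on $(0,\infty)$, the distorted Hankel operator $\mathfrak{G}^{\alpha,\beta}_\varphi$ is the integral operator on $L^2(\mathbb{R}_+)$ with kernel $\varphi(x^\alpha+y^\beta)$: $(\mathfrak{G}^{\alpha,\beta}_\varphi f)(x)=\int_{\mathbb{R}_+}\varphi(x^\alpha+y^\beta)f(y)\,dy$. The averaging projection $\mathcal{Q}_{\alpha,\beta}$ is the orthogonal projection on the Hilbert space $\boldsymbol{S}_2$ onto the subspace of operators in $\boldsymbol{S}_2$ of the form $\mathfrak{G}^{\alpha,\beta}_\varphi$; equivalently, on kernels, it is the orthogonal projection of $L^2(\mathbb{R}_+^2)$ onto the subspace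 of functions that are constant on the sets $\{(x,y)\in\mathbb{R}_+^2:\ x^\alpha+y^\beta=c\}$, $c>0$. For $p\le2$ (so $\boldsymbol{S}_p\subset\boldsymbol{S}_2$), "$\mathcal{Q}_{\alpha,\beta}$ is bounded on $\boldsymbol{S}_p$" means that $\mathcal{Q}_{\alpha,\beta}$ maps $\boldsymbol{S}_p$ boundedly into $\boldsymbol{S}_p$. For $p>2$ it means that $\mathcal{Q}_{\alpha,\beta}$ extends from $\boldsymbol{S}_p\cap\boldsymbol{S}_2$ to a bounded operator on $\boldsymbol{S}_p$. *)

theory Defs
  imports "HOL-Analysis.Analysis"
begin

section \<open>Square-integrable functions\<close>

definition sq_integrable :: "'a measure \<Rightarrow> ('a \<Rightarrow> complex) \<Rightarrow> bool" where
  "sq_integrable M f \<longleftrightarrow> f \<in> borel_measurable M \<and> integrable M (\<lambda>x. (cmod (f x))\<^sup>2)"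

lemma sq_integrable_measurable [measurable_dest]: "sq_integrable M f \<Longrightarrow> f \<in> borel_measurable M"
  by (simp add: sq_integrable_def)

lemma sq_integrable_integrable: "sq_integrable M f \<Longrightarrow> integrable M (\<lambda>x. (cmod (f x))\<^sup>2)"
  by (simp add: sq_integrable_def)

lemma sq_integrable_zero: "sq_integrable M (\<lambda>_. 0)"
  by (simp add: sq_integrable_def)

lemma sq_integrable_mult: "sq_integrable M f \<Longrightarrow> sq_integrable M (\<lambda>x. c * f x)"
  by (auto simp: sq_integrable_def norm_mult power_mult_distrib)

lemma sq_integrable_norm: "sq_integrable M f \<Longrightarrow> sq_integrable M (\<lambda>x. of_real (cmod (f x)))"
  by (auto simp: sq_integrable_def)

lemma sq_integrable_cnj: "sq_integrable M f \<Longrightarrow> sq_integrable M (\<lambda>x. cnj (f x))"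
  by (auto simp: sq_integrable_def intro: measurable_compose[OF _ borel_measurable_continuous_onI[OF continuous_on_cnj[OF continuous_on_id]]])

lemma sq_integrable_add:
  assumes "sq_integrable M f" "sq_integrable M g"
  shows "sq_integrable M (\<lambda>x. f x + g x)"
proof -
  have [measurable]: "f \<in> borel_measurable M" "g \<in> borel_measurable M"
    using assms by (auto simp: sq_integrable_def)
  have "integrable M (\<lambda>x. (cmod (f x + g x))\<^sup>2)"
  proof (rule Bochner_Integration.integrable_bound)
    show "integrable M (\<lambda>x. 2 * (cmod (f x))\<^sup>2 + 2 * (cmod (g x))\<^sup>2)"
      using assms by (auto simp: sq_integrable_def)
    have "(cmod (f x + g x))\<^sup>2 \<le> 2 * (cmod (f x))\<^sup>2 + 2 * (cmod (g x))\<^sup>2" for x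
    proof -
      have "(cmod (f x + g x))\<^sup>2 \<le> (cmod (f x) + cmod (g x))\<^sup>2"
        by (intro power_mono norm_triangle_ineq) auto
      also have "\<dots> \<le> 2 * (cmod (f x))\<^sup>2 + 2 * (cmod (g x))\<^sup>2"
        using sum_squares_bound[of "cmod (f x)" "cmod (g x)"]
        by (simp add: power2_sum)
      finally show ?thesis .
    qed
    then show "AE x in M. norm ((cmod (f x + g x))\<^sup>2)
        \<le> norm (2 * (cmod (f x))\<^sup>2 + 2 * (cmod (g x))\<^sup>2)"
      by (auto intro!: AE_I2)
  qed auto
  then show ?thesis by (auto simp: sq_integrable_def)
qed

lemma sq_integrable_prod:
  assumes "sq_integrable M f" "sq_integrable M g"
  shows "integrable M (\<lambda>x. f x * g x)"
proof -
  have [measurable]: "f \<in> borel_measurable M" "g \<in> borel_measurable M"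
    using assms by (auto simp: sq_integrable_def)
  show ?thesis
  proof (rule Bochner_Integration.integrable_bound)
    show "integrable M (\<lambda>x. (cmod (f x))\<^sup>2 + (cmod (g x))\<^sup>2)"
      using assms by (auto simp: sq_integrable_def)
    have "cmod (f x) * cmod (g x) \<le> (cmod (f x))\<^sup>2 + (cmod (g x))\<^sup>2" for x
      using sum_squares_bound[of "cmod (f x)" "cmod (g x)"]
        mult_nonneg_nonneg[of "cmod (f x)" "cmod (g x)"] norm_ge_zero[of "f x"] norm_ge_zero[of "g x"]
      by linarith
    then show "AE x in M. norm (f x * g x) \<le> norm ((cmod (f x))\<^sup>2 + (cmod (g x))\<^sup>2)"
      by (auto intro!: AE_I2 simp: norm_mult)
  qed auto
qed

section \<open>The Hilbert space \<open>L\<^sup>2(0, \<infinity>)\<close>\<close>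

abbreviation lborel_pos :: "real measure" where
  "lborel_pos \<equiv> restrict_space lborel {0<..}"

quotient_type l2 = "real \<Rightarrow> complex" / partial:
  "\<lambda>f g. sq_integrable lborel_pos f \<and> sq_integrable lborel_pos g \<and> (AE x in lborel_pos. f x = g x)"
  by (intro part_equivpI exI[of _ "\<lambda>_. 0"] sympI transpI)
    (auto simp: sq_integrable_zero elim: AE_mp)

lemma sq_integrable_rep_l2: "sq_integrable lborel_pos (rep_l2 f)"
  using Quotient3_rep_reflp[OF Quotient3_l2] by blast

lemma AE_rep_abs_l2:
  "sq_integrable lborel_pos f \<Longrightarrow> AE x in lborel_pos. rep_l2 (abs_l2 f) x = f x"
  using Quotient3_rep_abs[OF Quotient3_l2, of f] by blast

instantiation l2 :: real_inner
begin

lift_definition zero_l2 :: l2 is "\<lambda>_. 0"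
  by (simp add: sq_integrable_zero)

lift_definition plus_l2 :: "l2 \<Rightarrow> l2 \<Rightarrow> l2" is "\<lambda>f g x. f x + g x"
  by (auto intro: sq_integrable_add)

lift_definition scaleR_l2 :: "real \<Rightarrow> l2 \<Rightarrow> l2" is "\<lambda>c f x. of_real c * f x"
  by (auto intro: sq_integrable_mult)

lift_definition uminus_l2 :: "l2 \<Rightarrow> l2" is "\<lambda>f x. - f x"
  using sq_integrable_mult[of lborel_pos _ "-1"] by auto

definition minus_l2 :: "l2 \<Rightarrow> l2 \<Rightarrow> l2" where "minus_l2 f g = f + - g"

lift_definition inner_l2 :: "l2 \<Rightarrow> l2 \<Rightarrow> real" is "\<lambda>f g. Re (LINT x|lborel_pos. f x * cnj (g x))"
proof -
  fix f f' g g' :: "real \<Rightarrow> complex"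
  assume a: "sq_integrable lborel_pos f \<and> sq_integrable lborel_pos f' \<and> (AE x in lborel_pos. f x = f' x)"
    "sq_integrable lborel_pos g \<and> sq_integrable lborel_pos g' \<and> (AE x in lborel_pos. g x = g' x)"
  have "(LINT x|lborel_pos. f x * cnj (g x)) = (LINT x|lborel_pos. f' x * cnj (g' x))"
    by (intro integral_cong_AE)
      (use a in \<open>auto intro!: borel_measurable_times
         dest: sq_integrable_cnj sq_integrable_measurable\<close>)
  then show "Re (LINT x|lborel_pos. f x * cnj (g x)) = Re (LINT x|lborel_pos. f' x * cnj (g' x))"
    by simp
qed

definition norm_l2 :: "l2 \<Rightarrow> real" where "norm_l2 f = sqrt (inner f f)"

definition sgn_l2 :: "l2 \<Rightarrow> l2" where "sgn_l2 f = inverse (norm f) *\<^sub>R f"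

definition dist_l2 :: "l2 \<Rightarrow> l2 \<Rightarrow> real" where "dist_l2 f g = norm (f - g)"

definition uniformity_l2 :: "(l2 \<times> l2) filter" where
  "uniformity_l2 = (INF e\<in>{0<..}. principal {(x, y). dist x y < e})"

definition open_l2 :: "l2 set \<Rightarrow> bool" where
  "open_l2 U \<longleftrightarrow> (\<forall>x\<in>U. eventually (\<lambda>(x', y). x' = x \<longrightarrow> y \<in> U) uniformity)"

instance
proof
  fix f g h :: l2 and a b :: real
  show "f + g + h = f + (g + h)"
    by transfer (auto simp: add.assoc intro!: sq_integrable_add)
  show "f + g = g + f"
    by transfer (auto simp: add.commute intro!: sq_integrable_add)
  show "0 + f = f" by transfer auto
  show "- f + f = 0" by transfer (auto simp: sq_integrable_zero)
  show "f - g = f + - g" by (simp add: minus_l2_def)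
  show "a *\<^sub>R (f + g) = a *\<^sub>R f + a *\<^sub>R g"
    by transfer (auto simp: distrib_left intro!: sq_integrable_add sq_integrable_mult)
  show "(a + b) *\<^sub>R f = a *\<^sub>R f + b *\<^sub>R f"
    by transfer
      (auto simp: distrib_right intro!: sq_integrable_add sq_integrable_mult
        intro: sq_integrable_mult[of _ _ "of_real a + of_real b"])
  show "a *\<^sub>R b *\<^sub>R f = (a * b) *\<^sub>R f"
    by transfer (auto simp: mult.assoc intro!: sq_integrable_mult)
  show "1 *\<^sub>R f = f" by transfer auto
  show "dist f g = norm (f - g)" by (simp add: dist_l2_def)
  show "sgn f = inverse (norm f) *\<^sub>R f" by (simp add: sgn_l2_def)
  show "uniformity = (INF e\<in>{0<..}. principal {(x::l2, y). dist x y < e})"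
    by (simp add: uniformity_l2_def)
  show "open U \<longleftrightarrow> (\<forall>x\<in>U. \<forall>\<^sub>F (x', y) in uniformity. x' = x \<longrightarrow> y \<in> U)" for U :: "l2 set"
    by (simp add: open_l2_def)
  show "inner f g = inner g f"
  proof transfer
    fix f g :: "real \<Rightarrow> complex"
    have "(LINT x|lborel_pos. g x * cnj (f x)) = (LINT x|lborel_pos. cnj (f x * cnj (g x)))"
      by (simp add: mult.commute)
    also have "\<dots> = cnj (LINT x|lborel_pos. f x * cnj (g x))"
      by (rule Bochner_Integration.integral_cnj)
    finally show "Re (LINT x|lborel_pos. f x * cnj (g x)) = Re (LINT x|lborel_pos. g x * cnj (f x))"
      by simp
  qed
  show "inner (f + g) h = inner f h + inner g h"
  proof transfer
    fix f g h :: "real \<Rightarrow> complex"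
    assume "sq_integrable lborel_pos f \<and> sq_integrable lborel_pos f \<and> (AE x in lborel_pos. f x = f x)"
      "sq_integrable lborel_pos g \<and> sq_integrable lborel_pos g \<and> (AE x in lborel_pos. g x = g x)"
      "sq_integrable lborel_pos h \<and> sq_integrable lborel_pos h \<and> (AE x in lborel_pos. h x = h x)"
    then have "integrable lborel_pos (\<lambda>x. f x * cnj (h x))" "integrable lborel_pos (\<lambda>x. g x * cnj (h x))"
      by (auto intro!: sq_integrable_prod sq_integrable_cnj)
    then show "Re (LINT x|lborel_pos. (f x + g x) * cnj (h x)) =
        Re (LINT x|lborel_pos. f x * cnj (h x)) + Re (LINT x|lborel_pos. g x * cnj (h x))"
      by (simp add: distrib_right)
  qed
  show "inner (a *\<^sub>R f) g = a * inner f g"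
    by transfer (simp add: mult.assoc)
  have self: "Re (LINT x|lborel_pos. f x * cnj (f x)) = (LINT x|lborel_pos. (cmod (f x))\<^sup>2)"
    for f :: "real \<Rightarrow> complex"
    by (simp only: complex_norm_square[symmetric]) (simp flip: of_real_power)
  show "0 \<le> inner f f"
    by transfer (simp only: self, simp)
  show "inner f f = 0 \<longleftrightarrow> f = 0"
  proof transfer
    fix f :: "real \<Rightarrow> complex"
    assume f: "sq_integrable lborel_pos f \<and> sq_integrable lborel_pos f \<and> (AE x in lborel_pos. f x = f x)"
    have "(LINT x|lborel_pos. (cmod (f x))\<^sup>2) = 0 \<longleftrightarrow> (AE x in lborel_pos. (cmod (f x))\<^sup>2 = 0)"
      by (rule integral_nonneg_eq_0_iff_AE) (use f in \<open>auto simp: sq_integrable_def\<close>)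
    then show "(Re (LINT x|lborel_pos. f x * cnj (f x)) = 0) =
        (sq_integrable lborel_pos f \<and> sq_integrable lborel_pos (\<lambda>_. 0) \<and> (AE x in lborel_pos. f x = 0))"
      using f by (simp only: self) (simp add: sq_integrable_zero)
  qed
  show "norm f = sqrt (inner f f)" by (simp add: norm_l2_def)
qed

end

lift_definition cscale :: "complex \<Rightarrow> l2 \<Rightarrow> l2" is "\<lambda>c f x. c * f x"
  by (auto intro: sq_integrable_mult)

interpretation l2: vector_space cscale
proof
  fix a b :: complex and f g :: l2
  show "cscale a (f + g) = cscale a f + cscale a g"
    by transfer (auto simp: distrib_left intro!: sq_integrable_add sq_integrable_mult)
  show "cscale (a + b) f = cscale a f + cscale b f"
    by transfer
      (auto simp: distrib_right intro!: sq_integrable_add sq_integrable_mult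
        intro: sq_integrable_mult[of _ _ "a + b"])
  show "cscale a (cscale b f) = cscale (a * b) f"
    by transfer (auto simp: mult.assoc intro!: sq_integrable_mult)
  show "cscale 1 f = f" by transfer auto
qed

lemma norm_l2_eq: "norm f = sqrt (LINT x|lborel_pos. (cmod (rep_l2 f x))\<^sup>2)"
proof -
  have "inner f f = Re (LINT x|lborel_pos. rep_l2 f x * cnj (rep_l2 f x))"
    by (simp add: inner_l2.rep_eq)
  also have "\<dots> = (LINT x|lborel_pos. (cmod (rep_l2 f x))\<^sup>2)"
    by (simp only: complex_norm_square[symmetric]) (simp flip: of_real_power)
  finally show ?thesis by (simp add: norm_eq_sqrt_inner)
qed

lemma cscale_scaleR: "cscale c (a *\<^sub>R f) = a *\<^sub>R cscale c f"
  by transfer (auto simp: mult.left_commute intro!: sq_integrable_mult)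

lemma norm_cscale: "norm (cscale c f) = cmod c * norm f"
proof -
  have "inner (cscale c f) (cscale c f) = (cmod c)\<^sup>2 * inner f f"
  proof transfer
    fix c :: complex and f :: "real \<Rightarrow> complex"
    have "(LINT x|lborel_pos. c * f x * cnj (c * f x))
        = (LINT x|lborel_pos. of_real ((cmod c)\<^sup>2) * (f x * cnj (f x)))"
      by (simp only: complex_norm_square complex_cnj_mult mult_ac)
    also have "\<dots> = of_real ((cmod c)\<^sup>2) * (LINT x|lborel_pos. f x * cnj (f x))"
      by (rule integral_mult_right_zero)
    finally show "Re (LINT x|lborel_pos. c * f x * cnj (c * f x))
        = (cmod c)\<^sup>2 * Re (LINT x|lborel_pos. f x * cnj (f x))"
      by (simp only: Re_complex_of_real times_complex.sel Im_complex_of_real mult_zero_left diff_zero)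
  qed
  then show ?thesis by (simp add: norm_eq_sqrt_inner real_sqrt_mult)
qed

lemma bounded_linear_cscale: "bounded_linear (cscale c)"
  by (rule bounded_linear_intro[where K = "cmod c"])
    (auto simp: l2.scale_right_distrib cscale_scaleR norm_cscale)

section \<open>Operators on \<open>L\<^sup>2(0, \<infinity>)\<close> and the Schatten classes\<close>

definition cscale_op :: "complex \<Rightarrow> (l2 \<Rightarrow>\<^sub>L l2) \<Rightarrow> (l2 \<Rightarrow>\<^sub>L l2)" where
  "cscale_op c T = Blinfun (cscale c) o\<^sub>L T"

lemma cscale_op_apply [simp]:
  "blinfun_apply (cscale_op c T) f = cscale c (blinfun_apply T f)"
  by (simp add: cscale_op_def bounded_linear_Blinfun_apply[OF bounded_linear_cscale])

text \<open>\<^typ>\<open>l2 \<Rightarrow>\<^sub>L l2\<close> contains all real-linear operators; the complex-linear ones are singled out.\<close>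

definition l2_ops :: "(l2 \<Rightarrow>\<^sub>L l2) set" where
  "l2_ops = {T. \<forall>c f. blinfun_apply T (cscale c f) = cscale c (blinfun_apply T f)}"

definition rank_le :: "nat \<Rightarrow> (l2 \<Rightarrow>\<^sub>L l2) \<Rightarrow> bool" where
  "rank_le j R \<longleftrightarrow> (\<exists>B. finite B \<and> card B \<le> j \<and> range (blinfun_apply R) \<subseteq> l2.span B)"

text \<open>The singular values are the approximation numbers.\<close>

definition singular_value :: "(l2 \<Rightarrow>\<^sub>L l2) \<Rightarrow> nat \<Rightarrow> real" where
  "singular_value T j = (INF R \<in> {R \<in> l2_ops. rank_le j R}. norm (T - R))"

definition schatten :: "real \<Rightarrow> (l2 \<Rightarrow>\<^sub>L l2) set" where
  "schatten p = {T \<in> l2_ops. summable (\<lambda>j. singular_value T j powr p)}"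

definition schatten_norm :: "real \<Rightarrow> (l2 \<Rightarrow>\<^sub>L l2) \<Rightarrow> real" where
  "schatten_norm p T = (\<Sum>j. singular_value T j powr p) powr (1 / p)"

definition schatten_bounded_linear :: "real \<Rightarrow> ((l2 \<Rightarrow>\<^sub>L l2) \<Rightarrow> (l2 \<Rightarrow>\<^sub>L l2)) \<Rightarrow> bool" where
  "schatten_bounded_linear p \<Phi> \<longleftrightarrow>
     (\<forall>S\<in>schatten p. \<forall>T\<in>schatten p. \<Phi> (S + T) = \<Phi> S + \<Phi> T) \<and>
     (\<forall>c. \<forall>T\<in>schatten p. \<Phi> (cscale_op c T) = cscale_op c (\<Phi> T)) \<and>
     (\<exists>C. \<forall>T\<in>schatten p. \<Phi> T \<in> schatten p \<and> schatten_norm p (\<Phi> T) \<le> C * schatten_norm p T)"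

text \<open>For \<open>p \<le> 2\<close> the map \<open>Q\<close>, given on the Hilbert--Schmidt class, is already defined on the
  Schatten class; for \<open>p > 2\<close> it has to be extended.\<close>

definition bounded_on_schatten :: "real \<Rightarrow> ((l2 \<Rightarrow>\<^sub>L l2) \<Rightarrow> (l2 \<Rightarrow>\<^sub>L l2)) \<Rightarrow> bool" where
  "bounded_on_schatten p Q \<longleftrightarrow>
     (if p \<le> 2
      then \<exists>C. \<forall>T\<in>schatten p. Q T \<in> schatten p \<and> schatten_norm p (Q T) \<le> C * schatten_norm p T
      else \<exists>\<Phi>. schatten_bounded_linear p \<Phi> \<and> (\<forall>T\<in>schatten p \<inter> schatten 2. \<Phi> T = Q T))"

section \<open>Integral operators\<close>

abbreviation lborel_pos2 :: "(real \<times> real) measure" where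
  "lborel_pos2 \<equiv> lborel_pos \<Otimes>\<^sub>M lborel_pos"

definition kernel_apply :: "(real \<times> real \<Rightarrow> complex) \<Rightarrow> (real \<Rightarrow> complex) \<Rightarrow> real \<Rightarrow> complex" where
  "kernel_apply k f x = (LINT y|lborel_pos. k (x, y) * f y)"

definition integral_operator :: "(real \<times> real \<Rightarrow> complex) \<Rightarrow> (l2 \<Rightarrow>\<^sub>L l2)" where
  "integral_operator k = Blinfun (\<lambda>f. abs_l2 (kernel_apply k (rep_l2 f)))"

interpretation lborel_pos: sigma_finite_measure lborel_pos
  by (rule sigma_finite_measure_restrict_space) (auto intro: lborel.sigma_finite_measure_axioms)

interpretation lborel_pos2: pair_sigma_finite lborel_pos lborel_pos ..

lemma Cauchy_Schwarz_l2:
  assumes f: "sq_integrable lborel_pos f" and g: "sq_integrable lborel_pos g"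
  shows "(cmod (LINT x|lborel_pos. f x * g x))\<^sup>2
    \<le> (LINT x|lborel_pos. (cmod (f x))\<^sup>2) * (LINT x|lborel_pos. (cmod (g x))\<^sup>2)"
proof -
  define F where "F = abs_l2 (\<lambda>x. of_real (cmod (f x)))"
  define G where "G = abs_l2 (\<lambda>x. of_real (cmod (g x)))"
  note sq = sq_integrable_norm[OF f] sq_integrable_norm[OF g]
  have [measurable]: "f \<in> borel_measurable lborel_pos" "g \<in> borel_measurable lborel_pos"
    using f g by (auto simp: sq_integrable_def)
  have inner: "inner (abs_l2 u) (abs_l2 v) = Re (LINT x|lborel_pos. u x * cnj (v x))"
    if "sq_integrable lborel_pos u" "sq_integrable lborel_pos v" for u v
    using that by (intro inner_l2.abs_eq) auto
  have FG: "inner F G = (LINT x|lborel_pos. cmod (f x) * cmod (g x))"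
    unfolding F_def G_def by (subst inner[OF sq]) (simp flip: of_real_mult)
  have FF: "inner F F = (LINT x|lborel_pos. (cmod (f x))\<^sup>2)"
    unfolding F_def by (subst inner[OF sq(1) sq(1)]) (simp add: power2_eq_square flip: of_real_mult)
  have GG: "inner G G = (LINT x|lborel_pos. (cmod (g x))\<^sup>2)"
    unfolding G_def by (subst inner[OF sq(2) sq(2)]) (simp add: power2_eq_square flip: of_real_mult)
  have "cmod (LINT x|lborel_pos. f x * g x) \<le> inner F G"
    unfolding FG norm_mult[symmetric] by (rule integral_norm_bound)
  then have "(cmod (LINT x|lborel_pos. f x * g x))\<^sup>2 \<le> (inner F G)\<^sup>2"
    by (rule power_mono) auto
  also have "\<dots> \<le> inner F F * inner G G" by (rule Cauchy_Schwarz_ineq)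
  finally show ?thesis unfolding FF GG .
qed

lemma AE_sq_integrable_section:
  assumes k: "sq_integrable lborel_pos2 k"
  shows "AE x in lborel_pos. sq_integrable lborel_pos (\<lambda>y. k (x, y))"
proof -
  have [measurable]: "k \<in> borel_measurable lborel_pos2" using k by (simp add: sq_integrable_def)
  show ?thesis
    using lborel_pos2.AE_integrable_fst'[OF sq_integrable_integrable[OF k]] AE_space
    by eventually_elim (simp add: sq_integrable_def)
qed

lemma kernel_apply_bound:
  assumes k: "sq_integrable lborel_pos2 k" and f: "sq_integrable lborel_pos f"
  shows "sq_integrable lborel_pos (kernel_apply k f)"
    and "(LINT x|lborel_pos. (cmod (kernel_apply k f x))\<^sup>2)
      \<le> (LINT z|lborel_pos2. (cmod (k z))\<^sup>2) * (LINT x|lborel_pos. (cmod (f x))\<^sup>2)"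
proof -
  have [measurable]: "k \<in> borel_measurable lborel_pos2" "f \<in> borel_measurable lborel_pos"
    using k f by (auto simp: sq_integrable_def)
  have meas [measurable]: "kernel_apply k f \<in> borel_measurable lborel_pos"
    unfolding kernel_apply_def by measurable
  let ?N = "\<lambda>x. (LINT y|lborel_pos. (cmod (k (x, y)))\<^sup>2)"
  let ?F = "LINT x|lborel_pos. (cmod (f x))\<^sup>2"
  have N: "integrable lborel_pos ?N"
    using lborel_pos2.integrable_fst'[OF sq_integrable_integrable[OF k]] .
  have le: "AE x in lborel_pos. (cmod (kernel_apply k f x))\<^sup>2 \<le> ?N x * ?F"
    using AE_sq_integrable_section[OF k]
    by eventually_elim (auto simp: kernel_apply_def intro!: Cauchy_Schwarz_l2 f)
  have int: "integrable lborel_pos (\<lambda>x. (cmod (kernel_apply k f x))\<^sup>2)"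
    by (rule Bochner_Integration.integrable_bound[OF integrable_mult_left[OF N, of ?F]])
      (use le in \<open>auto elim!: eventually_mono intro: order_trans[OF _ abs_ge_self]\<close>)
  then show "sq_integrable lborel_pos (kernel_apply k f)"
    by (simp add: sq_integrable_def)
  have "(LINT x|lborel_pos. (cmod (kernel_apply k f x))\<^sup>2) \<le> (LINT x|lborel_pos. ?N x * ?F)"
    by (rule integral_mono_AE[OF int integrable_mult_left[OF N] le])
  also have "\<dots> = (LINT z|lborel_pos2. (cmod (k z))\<^sup>2) * ?F"
    using lborel_pos2.integral_fst'[OF sq_integrable_integrable[OF k]] by simp
  finally show "(LINT x|lborel_pos. (cmod (kernel_apply k f x))\<^sup>2)
      \<le> (LINT z|lborel_pos2. (cmod (k z))\<^sup>2) * ?F" .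
qed

lemma kernel_apply_cong:
  assumes "AE y in lborel_pos. f y = g y" "x > 0" "k \<in> borel_measurable lborel_pos2"
    "f \<in> borel_measurable lborel_pos" "g \<in> borel_measurable lborel_pos"
  shows "kernel_apply k f x = kernel_apply k g x"
proof -
  have [measurable]: "(\<lambda>y. k (x, y)) \<in> borel_measurable lborel_pos"
    using assms(2,3) by (auto intro!: measurable_Pair2[of k lborel_pos lborel_pos] simp: space_restrict_space)
  note assms(4,5)[measurable]
  show ?thesis unfolding kernel_apply_def
    by (intro integral_cong_AE) (use assms(1) in auto)
qed

lemma abs_l2_eqI:
  assumes "sq_integrable lborel_pos f" "sq_integrable lborel_pos g" "AE x in lborel_pos. f x = g x"
  shows "abs_l2 f = abs_l2 g"
  using assms Quotient3_rel_abs[OF Quotient3_l2] by blast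

lemma bounded_linear_kernel_apply:
  assumes k: "sq_integrable lborel_pos2 k"
  shows "bounded_linear (\<lambda>f. abs_l2 (kernel_apply k (rep_l2 f)))"
proof (rule bounded_linear_intro[where K = "sqrt (LINT z|lborel_pos2. (cmod (k z))\<^sup>2)"])
  fix f g :: l2 and r :: real
  note sq = kernel_apply_bound(1)[OF k sq_integrable_rep_l2]
  have [measurable]: "k \<in> borel_measurable lborel_pos2" using k by (simp add: sq_integrable_def)
  have sec: "AE x in lborel_pos. x > 0 \<and> sq_integrable lborel_pos (\<lambda>y. k (x, y))"
    using AE_sq_integrable_section[OF k] AE_space
    by eventually_elim (auto simp: space_restrict_space)
  have rep: "AE y in lborel_pos. rep_l2 (f + g) y = rep_l2 f y + rep_l2 g y"
    unfolding plus_l2_def map_fun_def o_def id_def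
    by (rule AE_rep_abs_l2) (intro sq_integrable_add sq_integrable_rep_l2)
  have "AE x in lborel_pos. kernel_apply k (rep_l2 (f + g)) x
      = kernel_apply k (rep_l2 f) x + kernel_apply k (rep_l2 g) x"
    using sec
  proof eventually_elim
    case (elim x)
    have "kernel_apply k (rep_l2 (f + g)) x = kernel_apply k (\<lambda>y. rep_l2 f y + rep_l2 g y) x"
      by (rule kernel_apply_cong[OF rep])
        (use elim in \<open>auto intro!: sq_integrable_measurable sq_integrable_add sq_integrable_rep_l2\<close>)
    also have "\<dots> = kernel_apply k (rep_l2 f) x + kernel_apply k (rep_l2 g) x"
      unfolding kernel_apply_def distrib_left
      by (rule Bochner_Integration.integral_add)
        (use elim in \<open>auto intro!: sq_integrable_prod sq_integrable_rep_l2\<close>)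
    finally show ?case .
  qed
  then have "abs_l2 (kernel_apply k (rep_l2 (f + g)))
      = abs_l2 (\<lambda>x. kernel_apply k (rep_l2 f) x + kernel_apply k (rep_l2 g) x)"
    by (intro abs_l2_eqI sq sq_integrable_add)
  also have "\<dots> = abs_l2 (kernel_apply k (rep_l2 f)) + abs_l2 (kernel_apply k (rep_l2 g))"
    by (rule plus_l2.abs_eq[symmetric]) (use sq in auto)
  finally show "abs_l2 (kernel_apply k (rep_l2 (f + g)))
      = abs_l2 (kernel_apply k (rep_l2 f)) + abs_l2 (kernel_apply k (rep_l2 g))" .
  have rep: "AE y in lborel_pos. rep_l2 (r *\<^sub>R f) y = of_real r * rep_l2 f y"
    unfolding scaleR_l2_def map_fun_def o_def id_def
    by (rule AE_rep_abs_l2) (intro sq_integrable_mult sq_integrable_rep_l2)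
  have "AE x in lborel_pos. kernel_apply k (rep_l2 (r *\<^sub>R f)) x
      = of_real r * kernel_apply k (rep_l2 f) x"
    using sec
  proof eventually_elim
    case (elim x)
    have "kernel_apply k (rep_l2 (r *\<^sub>R f)) x = kernel_apply k (\<lambda>y. of_real r * rep_l2 f y) x"
      by (rule kernel_apply_cong[OF rep])
        (use elim in \<open>auto intro!: sq_integrable_measurable sq_integrable_mult sq_integrable_rep_l2\<close>)
    also have "\<dots> = of_real r * kernel_apply k (rep_l2 f) x"
      by (simp add: kernel_apply_def mult.left_commute)
    finally show ?case .
  qed
  then have "abs_l2 (kernel_apply k (rep_l2 (r *\<^sub>R f)))
      = abs_l2 (\<lambda>x. of_real r * kernel_apply k (rep_l2 f) x)"
    by (intro abs_l2_eqI sq sq_integrable_mult)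
  also have "\<dots> = r *\<^sub>R abs_l2 (kernel_apply k (rep_l2 f))"
    by (rule scaleR_l2.abs_eq[symmetric]) (use sq in auto)
  finally show "abs_l2 (kernel_apply k (rep_l2 (r *\<^sub>R f))) = r *\<^sub>R abs_l2 (kernel_apply k (rep_l2 f))" .
  have "(LINT x|lborel_pos. (cmod (rep_l2 (abs_l2 (kernel_apply k (rep_l2 f))) x))\<^sup>2)
      = (LINT x|lborel_pos. (cmod (kernel_apply k (rep_l2 f) x))\<^sup>2)"
    using AE_rep_abs_l2[OF sq, of f] sq[of f] sq_integrable_rep_l2
    by (intro integral_cong_AE) (auto simp: sq_integrable_def)
  then show "norm (abs_l2 (kernel_apply k (rep_l2 f)))
      \<le> norm f * sqrt (LINT z|lborel_pos2. (cmod (k z))\<^sup>2)"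
    using kernel_apply_bound(2)[OF k sq_integrable_rep_l2[of f]]
    by (simp add: norm_l2_eq mult.commute flip: real_sqrt_mult)
qed

lemma integral_operator_apply:
  assumes "sq_integrable lborel_pos2 k"
  shows "AE x in lborel_pos. rep_l2 (blinfun_apply (integral_operator k) f) x
    = (LINT y|lborel_pos. k (x, y) * rep_l2 f y)"
  using AE_rep_abs_l2[OF kernel_apply_bound(1)[OF assms sq_integrable_rep_l2]]
  by (simp add: integral_operator_def bounded_linear_Blinfun_apply[OF bounded_linear_kernel_apply[OF assms]]
      kernel_apply_def)

section \<open>Distorted Hankel operators and the averaging projection\<close>

definition hankel_kernel :: "real \<Rightarrow> real \<Rightarrow> (real \<Rightarrow> complex) \<Rightarrow> real \<times> real \<Rightarrow> complex" where
  "hankel_kernel \<alpha> \<beta> \<phi> = (\<lambda>(x, y). \<phi> (x powr \<alpha> + y powr \<beta>))"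

definition distorted_hankel :: "real \<Rightarrow> real \<Rightarrow> (real \<Rightarrow> complex) \<Rightarrow> (l2 \<Rightarrow>\<^sub>L l2)" where
  "distorted_hankel \<alpha> \<beta> \<phi> = integral_operator (hankel_kernel \<alpha> \<beta> \<phi>)"

text \<open>The Hilbert--Schmidt class is identified with \<open>L\<^sup>2((0, \<infinity>)\<^sup>2)\<close> through
  \<^const>\<open>integral_operator\<close>; its inner product is that of the kernels. \<open>Q\<close> is the orthogonal
  projection when it sends the operator with kernel \<open>k\<close> to some Hilbert--Schmidt
  \<^term>\<open>distorted_hankel \<alpha> \<beta> \<phi>\<close> with \<^term>\<open>k - hankel_kernel \<alpha> \<beta> \<phi>\<close> orthogonal to the kernels of
  all such operators. Square integrability of the kernel forces \<open>\<phi>\<close> to be measurable on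
  \<open>(0, \<infinity>)\<close>. The values of \<open>Q\<close> off the Hilbert--Schmidt class are irrelevant.\<close>

definition is_averaging_projection ::
    "real \<Rightarrow> real \<Rightarrow> ((l2 \<Rightarrow>\<^sub>L l2) \<Rightarrow> (l2 \<Rightarrow>\<^sub>L l2)) \<Rightarrow> bool" where
  "is_averaging_projection \<alpha> \<beta> Q \<longleftrightarrow>
     (\<forall>k. sq_integrable lborel_pos2 k \<longrightarrow>
       (\<exists>\<phi>. sq_integrable lborel_pos2 (hankel_kernel \<alpha> \<beta> \<phi>) \<and>
            Q (integral_operator k) = distorted_hankel \<alpha> \<beta> \<phi> \<and>
            (\<forall>\<psi>. sq_integrable lborel_pos2 (hankel_kernel \<alpha> \<beta> \<psi>) \<longrightarrow>
              (LINT z|lborel_pos2.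
                 (k z - hankel_kernel \<alpha> \<beta> \<phi> z) * cnj (hankel_kernel \<alpha> \<beta> \<psi> z)) = 0)))"

end

theory Submission
  imports Defs
begin

text \<open>Write \<open>u = x\<^sup>\<alpha>\<close> and \<open>v = y\<^sup>\<beta>\<close>. The projection averages a kernel over the lines \<open>u + v = t\<close>, and the
proof watches what it does to rank one kernels \<open>f(x) g(y)\<close>: these have norm \<open>\<parallel>f\<parallel> \<parallel>g\<parallel>\<close> in every
Schatten class, but their averages need not be small.

Let \<open>f\<close> be the indicator of \<open>u < 1\<close> and \<open>g\<close> the normalised indicator of \<open>T < v < T + 1\<close> for a large
\<open>T\<close>. The symbol of the average is a bump of bounded width on the levels \<open>T < t < T + 2\<close>, whose height
is found by comparing areas (\<open>symbol_lower_bound\<close>). Choose a number of boxes proportional to \<open>T\<close> along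
the line \<open>u + v = T\<close>, of bounded size in \<open>(u, v)\<close> and so far apart that the box formed by the \<open>u\<close>-side
of one and the \<open>v\<close>-side of another misses the bump. Between the normalised indicators of the sides of
the boxes the averaged operator is a diagonal matrix with entries at least of order \<open>T\<^bsup>-\<tau>\<^esup>\<close>, where
\<open>\<tau> = (1 + 1/\<alpha>)/2\<close> (\<open>scale_diagonal_hankel\<close>); hence of the order of \<open>T\<close> many singular values are of
the order \<open>T\<^bsup>-\<tau>\<^esup>\<close> at least.

For one \<open>T\<close> this yields only the weak form of the inequality. The strict form comes from adding the
functions \<open>g\<close> of \<open>N\<close> dyadic values of \<open>T\<close> with the same \<open>f\<close>: the norm of the rank one operator grows
like the square root of \<open>N\<close>, whereas for \<open>p \<tau> \<le> 1\<close> every scale contributes a fixed amount to the sum of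
the \<open>p\<close>-th powers of the singular values of the average. So \<open>N\<close> is at most a constant times
\<open>N\<^bsup>p/2\<^esup>\<close>, which is absurd if \<open>p < 2\<close> (\<open>scale_test_exponent_less_2\<close>). Thus \<open>p \<tau> > 1\<close>, that is
\<open>\<alpha> (2 - p) < p\<close>.

For \<open>p > 2\<close> the argument is dual, the projection being self-adjoint: the same matrix entries are paired
with a diagonal operator built on the boxes. Its Schatten norm is the \<open>p\<close>-norm of its weights, and its
average is tested against the rank one kernel above (\<open>scale_test_exponent_greater_2\<close>); the outcome is
\<open>\<alpha> (p - 2) < p\<close>. Exchanging \<open>x\<close> and \<open>y\<close> gives both inequalities for \<open>\<beta>\<close>, hence for the maximum.

Finally, if both factors live near \<open>T/2\<close> in the variables \<open>u\<close> and \<open>v\<close>, the diagonal entries are at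
least of order \<open>1/T\<close> whatever \<open>\<alpha>\<close> and \<open>\<beta>\<close> are. The sum of their \<open>p\<close>-th powers is then at least of order
\<open>T\<^bsup>1 - p\<^esup>\<close>, and this must stay bounded, so \<open>p \<ge> 1\<close> (\<open>bounded_exponent_ge_1\<close>).\<close>

section \<open>The complex inner product\<close>

text \<open>The inner product of the type \<^typ>\<open>l2\<close> is the real part of this form. Rank and orthonormality
refer to complex scalars, so the whole form is needed.\<close>

definition cip :: "l2 \<Rightarrow> l2 \<Rightarrow> complex" where
  "cip f g = (LINT x|lborel_pos. rep_l2 f x * cnj (rep_l2 g x))"

lemma inner_eq_Re_cip: "inner f g = Re (cip f g)"
  by (simp add: cip_def inner_l2.rep_eq)

lemma cip_abs:
  assumes f: "sq_integrable lborel_pos f" and g: "sq_integrable lborel_pos g"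
  shows "cip (abs_l2 f) (abs_l2 g) = (LINT x|lborel_pos. f x * cnj (g x))"
  unfolding cip_def
proof (rule integral_cong_AE)
  show "AE x in lborel_pos. rep_l2 (abs_l2 f) x * cnj (rep_l2 (abs_l2 g) x) = f x * cnj (g x)"
    using AE_rep_abs_l2[OF f] AE_rep_abs_l2[OF g] by eventually_elim simp
qed (use f g in \<open>auto intro!: borel_measurable_times
       dest: sq_integrable_cnj sq_integrable_measurable
       intro: sq_integrable_measurable sq_integrable_cnj sq_integrable_rep_l2\<close>)

lemma abs_rep_l2 [simp]: "abs_l2 (rep_l2 f) = f"
  using Quotient3_abs_rep[OF Quotient3_l2] .

lemma cscale_abs:
  "sq_integrable lborel_pos f \<Longrightarrow> cscale c (abs_l2 f) = abs_l2 (\<lambda>x. c * f x)"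
  by (rule cscale.abs_eq) auto

lemma cip_cscale: "cip (cscale a f) (cscale b g) = a * cnj b * cip f g"
proof -
  have "cip (cscale a (abs_l2 (rep_l2 f))) (cscale b (abs_l2 (rep_l2 g))) =
    (LINT x|lborel_pos. a * cnj b * (rep_l2 f x * cnj (rep_l2 g x)))"
    by (simp only: cscale_abs sq_integrable_rep_l2 cip_abs sq_integrable_mult)
       (simp add: mult_ac)
  then show ?thesis by (simp add: cip_def)
qed

lemma cip_self: "cip f f = of_real ((norm f)\<^sup>2)"
proof -
  have "(norm f)\<^sup>2 = (LINT x|lborel_pos. (cmod (rep_l2 f x))\<^sup>2)"
    by (simp add: norm_l2_eq)
  then show ?thesis unfolding cip_def complex_norm_square[symmetric]
    by (simp flip: of_real_power)
qed

definition orthonormal_on :: "'i set \<Rightarrow> ('i \<Rightarrow> l2) \<Rightarrow> bool" where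
  "orthonormal_on I e \<longleftrightarrow> (\<forall>i\<in>I. \<forall>j\<in>I. cip (e i) (e j) = of_bool (i = j))"

lemma orthonormal_on_subset: "orthonormal_on I e \<Longrightarrow> J \<subseteq> I \<Longrightarrow> orthonormal_on J e"
  by (simp add: orthonormal_on_def subset_iff)

lemma Re_Im_squares: "Re a * Re a + Im a * Im a = (cmod a)\<^sup>2"
  unfolding cmod_power2 by (simp add: power2_eq_square)

lemma norm_orthonormal_sum:
  assumes "finite I" "orthonormal_on I e"
  shows "(norm (\<Sum>i\<in>I. cscale (a i) (e i)))\<^sup>2 = (\<Sum>i\<in>I. (cmod (a i))\<^sup>2)"
proof -
  have "(norm (\<Sum>i\<in>I. cscale (a i) (e i)))\<^sup>2 =
    (\<Sum>i\<in>I. \<Sum>j\<in>I. inner (cscale (a i) (e i)) (cscale (a j) (e j)))"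
    unfolding power2_norm_eq_inner inner_sum_left inner_sum_right by (rule sum.swap)
  also have "\<dots> = (\<Sum>i\<in>I. \<Sum>j\<in>I. if i = j then (cmod (a i))\<^sup>2 else 0)"
  proof (intro sum.cong refl)
    fix i j assume "i \<in> I" "j \<in> I"
    then show "inner (cscale (a i) (e i)) (cscale (a j) (e j)) = (if i = j then (cmod (a i))\<^sup>2 else 0)"
      using assms(2) by (simp add: inner_eq_Re_cip cip_cscale orthonormal_on_def Re_Im_squares)
  qed
  also have "\<dots> = (\<Sum>i\<in>I. (cmod (a i))\<^sup>2)"
    using assms(1) by simp
  finally show ?thesis .
qed

lemma Bessel:
  assumes "finite I" "orthonormal_on I e"
  shows "(\<Sum>i\<in>I. (cmod (cip f (e i)))\<^sup>2) \<le> (norm f)\<^sup>2"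
proof -
  define S where "S = (\<Sum>i\<in>I. (cmod (cip f (e i)))\<^sup>2)"
  define y where "y = (\<Sum>i\<in>I. cscale (cip f (e i)) (e i))"
  have ny: "(norm y)\<^sup>2 = S" unfolding y_def S_def by (rule norm_orthonormal_sum[OF assms])
  have "inner f (cscale (cip f (e i)) (e i)) = (cmod (cip f (e i)))\<^sup>2" for i
  proof -
    have "cip f (cscale (cip f (e i)) (e i)) = cip f (e i) * cnj (cip f (e i))"
      using cip_cscale[of 1 f] by simp
    then show ?thesis by (simp add: inner_eq_Re_cip flip: complex_norm_square)
  qed
  then have "inner f y = S"
    unfolding y_def inner_sum_right S_def by simp
  then have "(norm (f - y))\<^sup>2 = (norm f)\<^sup>2 - S"
    using ny by (simp add: power2_norm_eq_inner inner_diff_left inner_diff_right inner_commute)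
  then show ?thesis using zero_le_power2[of "norm (f - y)"] by (simp add: S_def)
qed

section \<open>Singular values\<close>

lemma l2_ops_zero: "0 \<in> l2_ops" by (simp add: l2_ops_def)

lemma l2_ops_sum:
  assumes "T \<in> l2_ops"
  shows "T (\<Sum>i\<in>I. cscale (a i) (e i)) = (\<Sum>i\<in>I. cscale (a i) (T (e i)))"
  using assms by (simp add: blinfun.sum_right l2_ops_def)

lemma singular_value_le:
  assumes "R \<in> l2_ops" "rank_le j R"
  shows "singular_value T j \<le> norm (T - R)"
  unfolding singular_value_def
  by (rule cINF_lower) (use assms in \<open>auto intro!: bdd_belowI2[of _ 0]\<close>)

lemma rank_le_zero: "rank_le j 0"
  unfolding rank_le_def by (rule exI[of _ "{}"]) auto

lemma singular_value_nonneg: "0 \<le> singular_value T j"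
  unfolding singular_value_def
  by (rule cINF_greatest) (use l2_ops_zero rank_le_zero in auto)

lemma norm_le_singular_value_0: "norm T \<le> singular_value T 0"
  unfolding singular_value_def
proof (rule cINF_greatest)
  show "{R \<in> l2_ops. rank_le 0 R} \<noteq> {}" using l2_ops_zero rank_le_zero by auto
  fix R assume "R \<in> {R \<in> l2_ops. rank_le 0 R}"
  then have "range (blinfun_apply R) \<subseteq> {0}" by (auto simp: rank_le_def)
  then have "blinfun_apply R f = 0" for f by blast
  then have "R = 0" by (intro blinfun_eqI) simp
  then show "norm T \<le> norm (T - R)" by simp
qed

text \<open>If \<open>R\<close> has rank at most \<open>j\<close>, the images of more than \<open>j\<close> vectors \<open>e i\<close> are linearly dependent, so \<open>R\<close>
annihilates some \<open>x \<noteq> 0\<close> in their span, where \<open>T - R\<close> acts like \<open>T\<close>. Pairing \<open>T x\<close> with the vector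
that has the same coordinates with respect to \<open>h\<close> isolates the diagonal entries.\<close>

lemma singular_value_ge:
  assumes T: "T \<in> l2_ops" and I: "finite I" "j < card I"
    and e: "orthonormal_on I e" and h: "orthonormal_on I h"
    and off: "\<And>i l. i \<in> I \<Longrightarrow> l \<in> I \<Longrightarrow> i \<noteq> l \<Longrightarrow> cip (T (e i)) (h l) = 0"
    and diag: "\<And>i. i \<in> I \<Longrightarrow> d \<le> Re (cip (T (e i)) (h i))"
  shows "d \<le> singular_value T j"
  unfolding singular_value_def
proof (rule cINF_greatest)
  show "{R \<in> l2_ops. rank_le j R} \<noteq> {}" using l2_ops_zero rank_le_zero by auto
  fix R assume "R \<in> {R \<in> l2_ops. rank_le j R}"
  then obtain B where R: "R \<in> l2_ops" and B: "finite B" "card B \<le> j" "range (blinfun_apply R) \<subseteq> l2.span B"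
    by (auto simp: rank_le_def)
  obtain a k where a: "(\<Sum>i\<in>I. cscale (a i) (R (e i))) = 0" and k: "k \<in> I" "a k \<noteq> 0"
  \<comment> \<open>Two equal images are a dependency of the family that the image set does not see.\<close>
  proof (cases "inj_on (\<lambda>i. R (e i)) I")
    case False
    then obtain i l where il: "i \<in> I" "l \<in> I" "i \<noteq> l" "R (e i) = R (e l)" by (auto simp: inj_on_def)
    define a :: "_ \<Rightarrow> complex" where "a x = (if x = i then 1 else if x = l then -1 else 0)" for x
    have "(\<Sum>x\<in>I. cscale (a x) (R (e x))) = (\<Sum>x\<in>{i,l}. cscale (a x) (R (e x)))"
      by (rule sum.mono_neutral_right) (use il I in \<open>auto simp: a_def\<close>)
    also have "\<dots> = 0" using il by (simp add: a_def)
    finally show ?thesis using that[of a i] il by (simp add: a_def)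
  next
    case True
    have "l2.dependent ((\<lambda>i. R (e i)) ` I)"
    proof (rule ccontr)
      assume "\<not> ?thesis"
      then have "card ((\<lambda>i. R (e i)) ` I) \<le> card B"
        using l2.independent_span_bound[OF B(1), of "(\<lambda>i. R (e i)) ` I"] B(3) by auto
      then show False using B(2) I True by (simp add: card_image)
    qed
    then obtain u v where uv: "v \<in> (\<lambda>i. R (e i)) ` I" "u v \<noteq> 0"
        "(\<Sum>v\<in>(\<lambda>i. R (e i)) ` I. cscale (u v) v) = 0"
      using l2.dependent_finite[of "(\<lambda>i. R (e i)) ` I"] I by auto
    from uv(3) have "(\<Sum>i\<in>I. cscale (u (R (e i))) (R (e i))) = 0"
      by (subst (asm) sum.reindex[OF True]) simp
    with uv show ?thesis by (auto intro: that[of "\<lambda>i. u (R (e i))"])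
  qed
  define S where "S = (\<Sum>i\<in>I. (cmod (a i))\<^sup>2)"
  have S: "S > 0" unfolding S_def
    by (rule sum_pos2[OF I(1) k(1)]) (use k in auto)
  define x where "x = (\<Sum>i\<in>I. cscale (a i) (e i))"
  define w where "w = (\<Sum>i\<in>I. cscale (a i) (h i))"
  have nx: "norm x = sqrt S" and nw: "norm w = sqrt S"
    using norm_orthonormal_sum[OF I(1) e, of a] norm_orthonormal_sum[OF I(1) h, of a]
    by (simp_all add: x_def w_def S_def flip: real_sqrt_unique)
  have "R x = 0" unfolding x_def by (simp only: l2_ops_sum[OF R] a)
  have "inner (T x) w = (\<Sum>i\<in>I. \<Sum>l\<in>I. inner (cscale (a i) (T (e i))) (cscale (a l) (h l)))"
    unfolding x_def w_def l2_ops_sum[OF T] inner_sum_left inner_sum_right by (rule sum.swap)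
  also have "\<dots> = (\<Sum>i\<in>I. \<Sum>l\<in>I. if i = l then (cmod (a i))\<^sup>2 * Re (cip (T (e i)) (h i)) else 0)"
    by (intro sum.cong refl) (auto simp: inner_eq_Re_cip cip_cscale off Re_Im_squares)
  also have "\<dots> = (\<Sum>i\<in>I. (cmod (a i))\<^sup>2 * Re (cip (T (e i)) (h i)))"
    using I(1) by simp
  also have "\<dots> \<ge> (\<Sum>i\<in>I. (cmod (a i))\<^sup>2 * d)"
    by (intro sum_mono mult_left_mono diag) auto
  finally have "S * d \<le> inner (T x) w" by (simp add: S_def sum_distrib_right)
  also have "\<dots> = inner ((T - R) x) w" using \<open>R x = 0\<close> by (simp add: blinfun.diff_left)
  also have "\<dots> \<le> norm ((T - R) x) * norm w" by (rule norm_cauchy_schwarz)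
  also have "\<dots> \<le> (norm (T - R) * norm x) * norm w"
    by (intro mult_right_mono norm_blinfun) auto
  also have "\<dots> = S * norm (T - R)" using S by (simp add: nx nw)
  finally show "d \<le> norm (T - R)" using S by simp
qed

text \<open>The first singular value is the operator norm.\<close>

lemma schatten_norm_ge_norm:
  assumes "T \<in> schatten p" "0 < p"
  shows "norm T \<le> schatten_norm p T"
proof -
  have "singular_value T 0 powr p \<le> (\<Sum>j. singular_value T j powr p)"
    using sum_le_suminf[of "\<lambda>j. singular_value T j powr p" "{0}"] assms by (auto simp: schatten_def)
  then have "(singular_value T 0 powr p) powr (1/p) \<le> schatten_norm p T"
    unfolding schatten_norm_def by (intro powr_mono2) (use assms in auto)
  then show ?thesis
    using norm_le_singular_value_0[of T] assms singular_value_nonneg[of T 0]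
    by (simp add: powr_powr)
qed

lemma sum_singular_value_powr_le:
  assumes "T \<in> schatten p" "0 < p"
  shows "(\<Sum>j<M. singular_value T j powr p) \<le> schatten_norm p T powr p"
proof -
  have "(\<Sum>j<M. singular_value T j powr p) \<le> (\<Sum>j. singular_value T j powr p)"
    by (rule sum_le_suminf) (use assms in \<open>auto simp: schatten_def\<close>)
  also have "\<dots> = schatten_norm p T powr p"
    using assms by (simp add: schatten_norm_def powr_powr suminf_nonneg schatten_def)
  finally show ?thesis .
qed

section \<open>Integral operators and rank one kernels\<close>

lemma integral_operator_eq:
  assumes "sq_integrable lborel_pos2 k"
  shows "integral_operator k f = abs_l2 (kernel_apply k (rep_l2 f))"
  by (simp add: integral_operator_def bounded_linear_Blinfun_apply[OF bounded_linear_kernel_apply[OF assms]])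

lemma kernel_apply_cong_AE:
  assumes k: "sq_integrable lborel_pos2 k" and f: "sq_integrable lborel_pos f" "sq_integrable lborel_pos g"
    and "AE x in lborel_pos. f x = g x"
  shows "abs_l2 (kernel_apply k f) = abs_l2 (kernel_apply k g)"
proof (intro abs_l2_eqI kernel_apply_bound(1) k f)
  show "AE x in lborel_pos. kernel_apply k f x = kernel_apply k g x"
    using AE_space by eventually_elim
      (rule kernel_apply_cong[OF assms(4)],
        use k f in \<open>auto simp: space_restrict_space sq_integrable_def\<close>)
qed

lemma integral_operator_abs:
  assumes "sq_integrable lborel_pos2 k" "sq_integrable lborel_pos f"
  shows "integral_operator k (abs_l2 f) = abs_l2 (kernel_apply k f)"
  unfolding integral_operator_eq[OF assms(1)]
  by (rule kernel_apply_cong_AE) (use assms AE_rep_abs_l2 sq_integrable_rep_l2 in auto)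

lemma integral_operator_in_l2_ops:
  assumes k: "sq_integrable lborel_pos2 k"
  shows "integral_operator k \<in> l2_ops"
proof -
  have "integral_operator k (cscale c f) = cscale c (integral_operator k f)" for c f
  proof -
    have "integral_operator k (cscale c (abs_l2 (rep_l2 f))) = abs_l2 (kernel_apply k (\<lambda>x. c * rep_l2 f x))"
      by (simp only: cscale_abs sq_integrable_rep_l2 integral_operator_abs k sq_integrable_mult)
    also have "kernel_apply k (\<lambda>x. c * rep_l2 f x) = (\<lambda>x. c * kernel_apply k (rep_l2 f) x)"
      by (simp add: kernel_apply_def fun_eq_iff mult.left_commute)
    also have "abs_l2 \<dots> = cscale c (integral_operator k f)"
      by (simp only: cscale_abs kernel_apply_bound k sq_integrable_rep_l2 integral_operator_eq)
    finally show ?thesis by simp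
  qed
  then show ?thesis by (simp add: l2_ops_def)
qed

definition tensor :: "(real \<Rightarrow> complex) \<Rightarrow> (real \<Rightarrow> complex) \<Rightarrow> real \<times> real \<Rightarrow> complex" where
  "tensor f g = (\<lambda>(x, y). f x * g y)"

lemma integrable_tensor_real:
  fixes f g :: "real \<Rightarrow> real"
  assumes "integrable lborel_pos f" "integrable lborel_pos g"
  shows "integrable lborel_pos2 (\<lambda>z. f (fst z) * g (snd z))"
proof (rule lborel_pos2.Fubini_integrable)
  have [measurable]: "f \<in> borel_measurable lborel_pos" "g \<in> borel_measurable lborel_pos"
    using assms by auto
  show "(\<lambda>z. f (fst z) * g (snd z)) \<in> borel_measurable lborel_pos2" by measurable
  show "integrable lborel_pos (\<lambda>x. LINT y|lborel_pos. norm (f (fst (x, y)) * g (snd (x, y))))"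
    using assms by (simp add: abs_mult)
  show "AE x in lborel_pos. integrable lborel_pos (\<lambda>y. f (fst (x, y)) * g (snd (x, y)))"
    using assms by simp
qed

lemma sq_integrable_tensor:
  assumes "sq_integrable lborel_pos f" "sq_integrable lborel_pos g"
  shows "sq_integrable lborel_pos2 (tensor f g)"
proof -
  have [measurable]: "f \<in> borel_measurable lborel_pos" "g \<in> borel_measurable lborel_pos"
    using assms by (auto simp: sq_integrable_def)
  have "tensor f g \<in> borel_measurable lborel_pos2" unfolding tensor_def by measurable
  moreover have "integrable lborel_pos2 (\<lambda>z. (cmod (tensor f g z))\<^sup>2)"
    using integrable_tensor_real[OF assms[THEN sq_integrable_integrable]]
    by (simp add: tensor_def case_prod_beta norm_mult power_mult_distrib)
  ultimately show ?thesis by (simp add: sq_integrable_def)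
qed

lemma cip_integral_operator:
  assumes k: "sq_integrable lborel_pos2 k"
    and f: "sq_integrable lborel_pos f" and g: "sq_integrable lborel_pos g"
  shows "cip (integral_operator k (abs_l2 f)) (abs_l2 g) =
    (LINT z|lborel_pos2. k z * tensor (\<lambda>x. cnj (g x)) f z)"
proof -
  have i: "integrable lborel_pos2 (\<lambda>z. k z * tensor (\<lambda>x. cnj (g x)) f z)"
    by (intro sq_integrable_prod k sq_integrable_tensor sq_integrable_cnj f g)
  have "cip (integral_operator k (abs_l2 f)) (abs_l2 g) =
      (LINT x|lborel_pos. kernel_apply k f x * cnj (g x))"
    unfolding integral_operator_abs[OF k f]
    by (intro cip_abs kernel_apply_bound k f g)
  also have "\<dots> = (LINT x|lborel_pos. LINT y|lborel_pos. k (x, y) * tensor (\<lambda>x. cnj (g x)) f (x, y))"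
    unfolding kernel_apply_def tensor_def integral_mult_left_zero[symmetric] by (simp add: mult_ac)
  also have "\<dots> = (LINT z|lborel_pos2. k z * tensor (\<lambda>x. cnj (g x)) f z)"
    by (rule lborel_pos2.integral_fst'[OF i])
  finally show ?thesis .
qed

text \<open>The conjugate in the second factor turns the coefficient into an inner product; this is the form in
which diagonal operators are written as kernels later.\<close>

lemma integral_operator_tensor:
  assumes "sq_integrable lborel_pos f" "sq_integrable lborel_pos g"
  shows "integral_operator (tensor f (\<lambda>y. cnj (g y))) u = cscale (cip u (abs_l2 g)) (abs_l2 f)"
proof -
  have "integral_operator (tensor f (\<lambda>y. cnj (g y))) (abs_l2 (rep_l2 u)) =
     abs_l2 (kernel_apply (tensor f (\<lambda>y. cnj (g y))) (rep_l2 u))"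
    by (intro integral_operator_abs sq_integrable_tensor sq_integrable_cnj sq_integrable_rep_l2 assms)
  also have "kernel_apply (tensor f (\<lambda>y. cnj (g y))) (rep_l2 u) = (\<lambda>x. cip (abs_l2 (rep_l2 u)) (abs_l2 g) * f x)"
    unfolding cip_abs[OF sq_integrable_rep_l2 assms(2)]
    by (simp add: kernel_apply_def tensor_def fun_eq_iff mult_ac)
  finally show ?thesis by (simp add: cscale_abs assms)
qed

lemma sq_integrable_sum:
  "(\<And>i. i \<in> I \<Longrightarrow> sq_integrable M (f i)) \<Longrightarrow> sq_integrable M (\<lambda>x. \<Sum>i\<in>I. f i x)"
  by (induction I rule: infinite_finite_induct) (auto intro: sq_integrable_add sq_integrable_zero)

lemma integral_operator_add:
  assumes k: "sq_integrable lborel_pos2 k" and l: "sq_integrable lborel_pos2 l"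
  shows "integral_operator (\<lambda>z. k z + l z) = integral_operator k + integral_operator l"
proof (rule blinfun_eqI)
  fix f
  have "AE x in lborel_pos. kernel_apply (\<lambda>z. k z + l z) (rep_l2 f) x =
     kernel_apply k (rep_l2 f) x + kernel_apply l (rep_l2 f) x"
    using AE_sq_integrable_section[OF k] AE_sq_integrable_section[OF l]
    by eventually_elim
      (auto simp: kernel_apply_def distrib_right intro!: Bochner_Integration.integral_add
         sq_integrable_prod sq_integrable_rep_l2)
  then have "abs_l2 (kernel_apply (\<lambda>z. k z + l z) (rep_l2 f)) =
     abs_l2 (\<lambda>x. kernel_apply k (rep_l2 f) x + kernel_apply l (rep_l2 f) x)"
    by (intro abs_l2_eqI kernel_apply_bound sq_integrable_add k l sq_integrable_rep_l2)
  also have "\<dots> = abs_l2 (kernel_apply k (rep_l2 f)) + abs_l2 (kernel_apply l (rep_l2 f))"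
    by (rule plus_l2.abs_eq[symmetric]) (use kernel_apply_bound k l sq_integrable_rep_l2 in auto)
  finally show "integral_operator (\<lambda>z. k z + l z) f = (integral_operator k + integral_operator l) f"
    by (simp add: integral_operator_eq k l sq_integrable_add blinfun.add_left)
qed

lemma integral_operator_zero: "integral_operator (\<lambda>_. 0) = 0"
proof (rule blinfun_eqI)
  fix f :: l2
  show "integral_operator (\<lambda>_. 0) f = blinfun_apply 0 f"
    by (simp add: integral_operator_eq sq_integrable_zero kernel_apply_def[abs_def] zero_l2_def)
qed

lemma integral_operator_sum:
  "(\<And>i. i \<in> I \<Longrightarrow> sq_integrable lborel_pos2 (k i)) \<Longrightarrow>
    integral_operator (\<lambda>z. \<Sum>i\<in>I. k i z) = (\<Sum>i\<in>I. integral_operator (k i))"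
  by (induction I rule: infinite_finite_induct)
    (auto simp: integral_operator_zero integral_operator_add sq_integrable_sum)

section \<open>Powers as changes of variable\<close>

lemma sets_lborel_pos: "A \<in> sets lborel_pos \<longleftrightarrow> A \<in> sets borel \<and> A \<subseteq> {0<..}"
  by (auto simp: sets_restrict_space_iff)

lemma emeasure_lborel_pos: "A \<subseteq> {0<..} \<Longrightarrow> emeasure lborel_pos A = emeasure lborel A"
  by (rule emeasure_restrict_space) auto

lemma space_lborel_pos: "space lborel_pos = {0<..}"
  by (simp add: space_restrict_space)

lemma measurable_lborel_pos_borel [measurable]: "(\<lambda>x. x) \<in> lborel_pos \<rightarrow>\<^sub>M borel"
  by (rule measurable_restrict_space1) simp

lemma measurable_fst_pos2: "fst \<in> borel_measurable lborel_pos2"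
  using measurable_compose[OF measurable_fst measurable_lborel_pos_borel] by simp

lemma measurable_snd_pos2: "snd \<in> borel_measurable lborel_pos2"
  using measurable_compose[OF measurable_snd measurable_lborel_pos_borel] by simp

definition powr_vimage :: "real \<Rightarrow> real set \<Rightarrow> real set" where
  "powr_vimage \<beta> S = {y. 0 < y \<and> y powr \<beta> \<in> S}"

lemma powr_vimage_sets [measurable (raw)]:
  assumes "S \<in> sets borel"
  shows "powr_vimage \<beta> S \<in> sets lborel_pos"
proof -
  have "{y \<in> space lborel_pos. y powr \<beta> \<in> S} \<in> sets lborel_pos"
    using assms by measurable
  then show ?thesis by (simp add: powr_vimage_def space_restrict_space)
qed

text \<open>Substitution \<open>y = v\<^bsup>1/\<beta>\<^esup>\<close>. Staying in a compact interval away from \<open>0\<close> keeps the density continuous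
when \<open>1/\<beta> < 1\<close>.\<close>

lemma emeasure_powr_vimage:
  assumes \<beta>: "0 < \<beta>" and S: "S \<in> sets borel" "S \<subseteq> {p..q}" and p: "0 < p"
  shows "emeasure lborel_pos (powr_vimage \<beta> S) =
    (\<integral>\<^sup>+v. indicator S v * ennreal (1/\<beta> * v powr (1/\<beta> - 1)) \<partial>lborel)"
proof (cases "p \<le> q")
  case False
  then have "S = {}" using S by auto
  then show ?thesis by (simp add: powr_vimage_def)
next
  case True
  define b where "b = 1/\<beta>"
  have b: "0 < b" "b * \<beta> = 1" using \<beta> by (auto simp: b_def)
  note [measurable] = S(1)
  define f :: "real \<Rightarrow> real" where "f y = indicator (powr_vimage \<beta> S) y" for y
  have m: "powr_vimage \<beta> S \<in> sets borel" using powr_vimage_sets[OF S(1), of \<beta>] by (simp add: sets_lborel_pos)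
  have f_eq: "f (v powr b) = indicator S v" if "0 < v" for v
    using that b by (simp add: f_def powr_vimage_def powr_powr indicator_def)
  have sub: "powr_vimage \<beta> S \<subseteq> {p powr b..q powr b}"
  proof
    fix y assume "y \<in> powr_vimage \<beta> S"
    then have y: "0 < y" "p \<le> y powr \<beta>" "y powr \<beta> \<le> q" using S by (auto simp: powr_vimage_def)
    have "y = (y powr \<beta>) powr b" using y b by (simp add: powr_powr mult.commute)
    then show "y \<in> {p powr b..q powr b}"
      using powr_mono2[of b p "y powr \<beta>"] powr_mono2[of b "y powr \<beta>" q] y b p by auto
  qed
  have "emeasure lborel_pos (powr_vimage \<beta> S) = emeasure lborel (powr_vimage \<beta> S)"
    by (rule emeasure_lborel_pos) (auto simp: powr_vimage_def)
  also have "\<dots> = (\<integral>\<^sup>+y. indicator (powr_vimage \<beta> S) y \<partial>lborel)"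
    using m by simp
  also have "\<dots> = (\<integral>\<^sup>+y. ennreal (f y * indicator {p powr b..q powr b} y) \<partial>lborel)"
    by (intro nn_integral_cong) (use sub in \<open>auto simp: f_def indicator_def\<close>)
  also have "\<dots> = (\<integral>\<^sup>+v. ennreal (f (v powr b) * (b * v powr (b - 1)) * indicator {p..q} v) \<partial>lborel)"
  proof (rule nn_integral_substitution)
    show "set_borel_measurable borel {p powr b..q powr b} f"
      unfolding f_def set_borel_measurable_def using m by measurable
    show "((\<lambda>v. v powr b) has_real_derivative b * v powr (b - 1)) (at v)" if "v \<in> {p..q}" for v
      using that p by (auto intro!: derivative_eq_intros)
    show "continuous_on {p..q} (\<lambda>v. b * v powr (b - 1))"
      using p by (intro continuous_intros) auto
  qed (use b True in auto)
  also have "\<dots> = (\<integral>\<^sup>+v. indicator S v * ennreal (1/\<beta> * v powr (1/\<beta> - 1)) \<partial>lborel)"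
  proof (rule nn_integral_cong)
    fix v
    show "ennreal (f (v powr b) * (b * v powr (b - 1)) * indicator {p..q} v) =
       indicator S v * ennreal (1/\<beta> * v powr (1/\<beta> - 1))"
      using S(2) p f_eq[of v] by (cases "v \<in> {p..q}") (auto simp: b_def indicator_def)
  qed
  finally show ?thesis .
qed

lemma powr_comparable:
  fixes c :: real
  obtains \<kappa> K where "0 < \<kappa>" "0 < K"
    "\<And>T v. 0 < T \<Longrightarrow> T/4 \<le> v \<Longrightarrow> v \<le> 2*T \<Longrightarrow> \<kappa> * T powr c \<le> v powr c \<and> v powr c \<le> K * T powr c"
proof (rule that[of "min ((1/4) powr c) (2 powr c)" "max ((1/4) powr c) (2 powr c)"])
  fix T v :: real assume *: "0 < T" "T/4 \<le> v" "v \<le> 2*T"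
  define r where "r = v / T"
  have r: "1/4 \<le> r" "r \<le> 2" "v = r * T" using * by (auto simp: r_def field_simps)
  have "min ((1/4) powr c) (2 powr c) \<le> r powr c \<and> r powr c \<le> max ((1/4) powr c) (2 powr c)"
  proof (cases "0 \<le> c")
    case True
    then show ?thesis using powr_mono2[of c "1/4" r] powr_mono2[of c r 2] r by auto
  next
    case False
    then show ?thesis using powr_mono2'[of c "1/4" r] powr_mono2'[of c r 2] r by auto
  qed
  moreover have "v powr c = r powr c * T powr c" using r * by (simp add: powr_mult)
  ultimately show "min ((1/4) powr c) (2 powr c) * T powr c \<le> v powr c \<and>
     v powr c \<le> max ((1/4) powr c) (2 powr c) * T powr c"
    by (auto intro!: mult_right_mono)
qed (auto simp: less_max_iff_disj)

text \<open>In a window of scale \<open>T\<close> the density of the substitution is comparable to \<open>T\<^bsup>1/\<beta> - 1\<^esup>\<close>, with constants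
depending on \<open>\<beta>\<close> only. This lemma and the next one give the two directions.\<close>

lemma emeasure_powr_vimage_ge:
  assumes \<beta>: "0 < \<beta>"
  obtains \<kappa> where "0 < \<kappa>"
    "\<And>T S. 0 < T \<Longrightarrow> S \<in> sets borel \<Longrightarrow> S \<subseteq> {T/4..2*T} \<Longrightarrow>
       ennreal (\<kappa> * T powr (1/\<beta> - 1)) * emeasure lborel S \<le> emeasure lborel_pos (powr_vimage \<beta> S)"
proof -
  obtain \<kappa> K where k: "0 < \<kappa>" "0 < K"
    "\<And>T v. 0 < T \<Longrightarrow> T/4 \<le> v \<Longrightarrow> v \<le> 2*T \<Longrightarrow>
       \<kappa> * T powr (1/\<beta> - 1) \<le> v powr (1/\<beta> - 1) \<and> v powr (1/\<beta> - 1) \<le> K * T powr (1/\<beta> - 1)"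
    by (rule powr_comparable) (rule that)
  show ?thesis
  proof (rule that[of "\<kappa>/\<beta>"])
    fix T :: real and S :: "real set" assume S: "0 < T" "S \<in> sets borel" "S \<subseteq> {T/4..2*T}"
    note eq = emeasure_powr_vimage[OF \<beta> S(2,3)]
    have "ennreal (\<kappa>/\<beta> * T powr (1/\<beta> - 1)) * emeasure lborel S =
        (\<integral>\<^sup>+v. ennreal (\<kappa>/\<beta> * T powr (1/\<beta> - 1)) * indicator S v \<partial>lborel)"
      using S(2) by (simp add: nn_integral_cmult_indicator)
    also have "\<dots> \<le> emeasure lborel_pos (powr_vimage \<beta> S)"
      using S \<beta> k(3)[of T]
      by (subst eq, simp, intro nn_integral_mono)
        (auto simp: indicator_def subset_iff divide_right_mono intro!: ennreal_leI)
    finally show "ennreal (\<kappa>/\<beta> * T powr (1/\<beta> - 1)) * emeasure lborel S \<le> emeasure lborel_pos (powr_vimage \<beta> S)" .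
  qed (use k \<beta> in auto)
qed

lemma emeasure_powr_vimage_le:
  assumes \<beta>: "0 < \<beta>"
  obtains K where "0 < K"
    "\<And>T S. 0 < T \<Longrightarrow> S \<in> sets borel \<Longrightarrow> S \<subseteq> {T/4..2*T} \<Longrightarrow>
       emeasure lborel_pos (powr_vimage \<beta> S) \<le> ennreal (K * T powr (1/\<beta> - 1)) * emeasure lborel S"
proof -
  obtain \<kappa> K where k: "0 < \<kappa>" "0 < K"
    "\<And>T v. 0 < T \<Longrightarrow> T/4 \<le> v \<Longrightarrow> v \<le> 2*T \<Longrightarrow>
       \<kappa> * T powr (1/\<beta> - 1) \<le> v powr (1/\<beta> - 1) \<and> v powr (1/\<beta> - 1) \<le> K * T powr (1/\<beta> - 1)"
    by (rule powr_comparable) (rule that)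
  show ?thesis
  proof (rule that[of "K/\<beta>"])
    fix T :: real and S :: "real set" assume S: "0 < T" "S \<in> sets borel" "S \<subseteq> {T/4..2*T}"
    note eq = emeasure_powr_vimage[OF \<beta> S(2,3)]
    have "emeasure lborel_pos (powr_vimage \<beta> S) \<le>
        (\<integral>\<^sup>+v. ennreal (K/\<beta> * T powr (1/\<beta> - 1)) * indicator S v \<partial>lborel)"
      using S \<beta> k(3)[of T]
      by (subst eq, simp, intro nn_integral_mono)
        (auto simp: indicator_def subset_iff divide_right_mono intro!: ennreal_leI)
    also have "\<dots> = ennreal (K/\<beta> * T powr (1/\<beta> - 1)) * emeasure lborel S"
      using S(2) by (simp add: nn_integral_cmult_indicator)
    finally show "emeasure lborel_pos (powr_vimage \<beta> S) \<le> ennreal (K/\<beta> * T powr (1/\<beta> - 1)) * emeasure lborel S" .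
  qed (use k \<beta> in auto)
qed

section \<open>Measures of level sets\<close>

definition level :: "real \<Rightarrow> real \<Rightarrow> real \<times> real \<Rightarrow> real" where
  "level \<alpha> \<beta> z = fst z powr \<alpha> + snd z powr \<beta>"

lemma hankel_kernel_level: "hankel_kernel \<alpha> \<beta> \<phi> z = \<phi> (level \<alpha> \<beta> z)"
  by (simp add: hankel_kernel_def level_def case_prod_beta)

lemma measurable_level [measurable]: "level \<alpha> \<beta> \<in> borel_measurable lborel_pos2"
proof -
  note [measurable] = measurable_fst_pos2 measurable_snd_pos2
  show ?thesis unfolding level_def by measurable
qed

lemma space_pos2: "space lborel_pos2 = {0<..} \<times> {0<..}"
  by (simp add: space_pair_measure space_lborel_pos)

lemma emeasure_lborel_translate:
  fixes E :: "real set"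
  assumes "E \<in> sets borel"
  shows "emeasure lborel ((\<lambda>v. u + v) -` E) = emeasure lborel E"
proof -
  have "emeasure lborel E = emeasure (distr lborel borel ((+) u)) E"
    by (simp add: lborel_distr_plus)
  also have "\<dots> = emeasure lborel ((\<lambda>v. u + v) -` E)"
    using assms by (subst emeasure_distr) auto
  finally show ?thesis by simp
qed

text \<open>The cutoff \<open>v \<ge> T/2\<close> avoids the singularity of the density \<open>v\<^bsup>1/\<beta> - 1\<^esup>\<close> at the origin. Sections with
\<open>u > 2 T\<close> are empty because \<open>E\<close> lies in \<open>[T, T + 1]\<close>.\<close>

lemma level_section_le:
  assumes \<beta>: "0 < \<beta>"
  obtains K where "0 < K"
    "\<And>T u E. 1 \<le> T \<Longrightarrow> 0 \<le> u \<Longrightarrow> E \<in> sets borel \<Longrightarrow> E \<subseteq> {T..T+1} \<Longrightarrow>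
       emeasure lborel_pos {y. 0 < y \<and> u + y powr \<beta> \<in> E \<and> T/2 \<le> y powr \<beta>}
         \<le> ennreal (K * T powr (1/\<beta> - 1)) * emeasure lborel E * indicator {..2*T} u"
proof -
  obtain K where K: "0 < K"
    "\<And>T S. 0 < T \<Longrightarrow> S \<in> sets borel \<Longrightarrow> S \<subseteq> {T/4..2*T} \<Longrightarrow>
       emeasure lborel_pos (powr_vimage \<beta> S) \<le> ennreal (K * T powr (1/\<beta> - 1)) * emeasure lborel S"
    by (rule emeasure_powr_vimage_le[OF \<beta>]) (rule that)
  show ?thesis
  proof (rule that[OF K(1)])
    fix T u :: real and E assume *: "1 \<le> T" "0 \<le> u" "E \<in> sets borel" "E \<subseteq> {T..T+1}"
    note [measurable] = *(3)
    define S where "S = (\<lambda>v. u + v) -` E \<inter> {T/2..}"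
    have S: "S \<in> sets borel" unfolding S_def
      using measurable_sets_borel[of "\<lambda>v. u + v" borel E] * by (intro sets.Int) auto
    have eq: "{y. 0 < y \<and> u + y powr \<beta> \<in> E \<and> T/2 \<le> y powr \<beta>} = powr_vimage \<beta> S"
      by (auto simp: powr_vimage_def S_def)
    show "emeasure lborel_pos {y. 0 < y \<and> u + y powr \<beta> \<in> E \<and> T/2 \<le> y powr \<beta>}
         \<le> ennreal (K * T powr (1/\<beta> - 1)) * emeasure lborel E * indicator {..2*T} u"
    proof (cases "u \<le> 2*T")
      case True
      have "emeasure lborel_pos (powr_vimage \<beta> S) \<le> ennreal (K * T powr (1/\<beta> - 1)) * emeasure lborel S"
        using * by (intro K S) (auto simp: S_def)
      also have "emeasure lborel S \<le> emeasure lborel ((\<lambda>v. u + v) -` E)"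
        using measurable_sets_borel[of "\<lambda>v. u + v" borel E] *
        by (intro emeasure_mono) (auto simp: S_def)
      also have "\<dots> = emeasure lborel E" using * by (intro emeasure_lborel_translate)
      finally show ?thesis using True unfolding eq by (auto simp: mult_left_mono)
    next
      case False
      then have "powr_vimage \<beta> S = {}" using * by (auto simp: powr_vimage_def S_def subset_iff)
      then show ?thesis unfolding eq by simp
    qed
  qed
qed

lemma emeasure_powr_le:
  assumes "0 < \<alpha>" "0 < T"
  shows "emeasure lborel_pos {x \<in> space lborel_pos. x powr \<alpha> \<le> T} \<le> ennreal (T powr (1/\<alpha>))"
proof -
  have "x \<le> T powr (1/\<alpha>)" if "0 < x" "x powr \<alpha> \<le> T" for x
    using powr_mono2[of "1/\<alpha>" "x powr \<alpha>" T] that assms by (simp add: powr_powr)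
  then have "emeasure lborel {x. 0 < x \<and> x powr \<alpha> \<le> T} \<le> emeasure lborel {0..T powr (1/\<alpha>)}"
    by (intro emeasure_mono) auto
  then show ?thesis
    by (subst emeasure_lborel_pos) (auto simp: space_restrict_space)
qed

text \<open>On levels \<open>t \<ge> T\<close> one of \<open>u\<close>, \<open>v\<close> is at least \<open>T/2\<close>. Slicing each of the two parts in the direction
of its large variable meets only values at which the density is under control. The factors are
\<open>T\<^bsup>1/\<beta> - 1\<^esup>\<close> for a slice and \<open>T\<^bsup>1/\<alpha>\<^esup>\<close> for the range of the other variable, or the same with \<open>\<alpha>\<close> and
\<open>\<beta>\<close> exchanged.\<close>

lemma emeasure_level_vimage_le:
  assumes \<alpha>: "0 < \<alpha>" and \<beta>: "0 < \<beta>"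
  obtains C where "0 < C"
    "\<And>T E. 1 \<le> T \<Longrightarrow> E \<in> sets borel \<Longrightarrow> E \<subseteq> {T..T+1} \<Longrightarrow>
       emeasure lborel_pos2 {z \<in> space lborel_pos2. level \<alpha> \<beta> z \<in> E}
         \<le> ennreal (C * T powr (1/\<alpha> + 1/\<beta> - 1)) * emeasure lborel E"
proof -
  obtain K1 where K1: "0 < K1" "\<And>T u E. 1 \<le> T \<Longrightarrow> 0 \<le> u \<Longrightarrow> E \<in> sets borel \<Longrightarrow> E \<subseteq> {T..T+1} \<Longrightarrow>
       emeasure lborel_pos {y. 0 < y \<and> u + y powr \<beta> \<in> E \<and> T/2 \<le> y powr \<beta>}
         \<le> ennreal (K1 * T powr (1/\<beta> - 1)) * emeasure lborel E * indicator {..2*T} u"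
    by (rule level_section_le[OF \<beta>]) (rule that)
  obtain K2 where K2: "0 < K2" "\<And>T u E. 1 \<le> T \<Longrightarrow> 0 \<le> u \<Longrightarrow> E \<in> sets borel \<Longrightarrow> E \<subseteq> {T..T+1} \<Longrightarrow>
       emeasure lborel_pos {y. 0 < y \<and> u + y powr \<alpha> \<in> E \<and> T/2 \<le> y powr \<alpha>}
         \<le> ennreal (K2 * T powr (1/\<alpha> - 1)) * emeasure lborel E * indicator {..2*T} u"
    by (rule level_section_le[OF \<alpha>]) (rule that)
  show ?thesis
  proof (rule that[of "K1 * 2 powr (1/\<alpha>) + K2 * 2 powr (1/\<beta>)"])
    fix T :: real and E :: "real set" assume *: "1 \<le> T" "E \<in> sets borel" "E \<subseteq> {T..T+1}"
    note [measurable] = *(2)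
    define D1 where "D1 = {z \<in> space lborel_pos2. level \<alpha> \<beta> z \<in> E \<and> T/2 \<le> snd z powr \<beta>}"
    define D2 where "D2 = {z \<in> space lborel_pos2. level \<alpha> \<beta> z \<in> E \<and> T/2 \<le> fst z powr \<alpha>}"
    have D [measurable]: "D1 \<in> sets lborel_pos2" "D2 \<in> sets lborel_pos2"
      unfolding D1_def D2_def by measurable
    have "emeasure lborel_pos2 D1 = (\<integral>\<^sup>+x. emeasure lborel_pos (Pair x -` D1) \<partial>lborel_pos)"
      by (rule lborel_pos.emeasure_pair_measure_alt) measurable
    also have "\<dots> \<le> (\<integral>\<^sup>+x. ennreal (K1 * T powr (1/\<beta> - 1)) * emeasure lborel E *
        indicator {x \<in> space lborel_pos. x powr \<alpha> \<le> 2*T} x \<partial>lborel_pos)"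
    proof (rule nn_integral_mono)
      fix x assume "x \<in> space lborel_pos"
      then have x: "0 < x" by (simp add: space_lborel_pos)
      have "Pair x -` D1 = {y. 0 < y \<and> x powr \<alpha> + y powr \<beta> \<in> E \<and> T/2 \<le> y powr \<beta>}"
        using x by (auto simp: D1_def space_pos2 level_def)
      then show "emeasure lborel_pos (Pair x -` D1) \<le> ennreal (K1 * T powr (1/\<beta> - 1)) * emeasure lborel E *
        indicator {x \<in> space lborel_pos. x powr \<alpha> \<le> 2*T} x"
        using K1(2)[of T "x powr \<alpha>" E] * x by (simp add: indicator_def space_lborel_pos)
    qed
    also have "\<dots> = ennreal (K1 * T powr (1/\<beta> - 1)) * emeasure lborel E *
        emeasure lborel_pos {x \<in> space lborel_pos. x powr \<alpha> \<le> 2*T}"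
      by (rule nn_integral_cmult_indicator) measurable
    also have "\<dots> \<le> ennreal (K1 * T powr (1/\<beta> - 1)) * emeasure lborel E * ennreal ((2*T) powr (1/\<alpha>))"
      using * by (intro mult_left_mono emeasure_powr_le \<alpha>) auto
    also have "\<dots> = ennreal (K1 * 2 powr (1/\<alpha>) * T powr (1/\<alpha> + 1/\<beta> - 1)) * emeasure lborel E"
    proof -
      have "K1 * T powr (1/\<beta> - 1) * (2*T) powr (1/\<alpha>) = K1 * 2 powr (1/\<alpha>) * T powr (1/\<alpha> + 1/\<beta> - 1)"
        using * powr_add[of T "1/\<alpha>" "1/\<beta> - 1"] by (simp add: powr_mult add_diff_eq)
      then show ?thesis
        using K1(1) by (simp add: ennreal_mult[symmetric] mult_ac)
    qed
    finally have 1: "emeasure lborel_pos2 D1 \<le> ennreal (K1 * 2 powr (1/\<alpha>) * T powr (1/\<alpha> + 1/\<beta> - 1)) * emeasure lborel E" .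
    have "emeasure lborel_pos2 D2 = (\<integral>\<^sup>+y. emeasure lborel_pos ((\<lambda>x. (x, y)) -` D2) \<partial>lborel_pos)"
      by (rule lborel_pos2.emeasure_pair_measure_alt2) measurable
    also have "\<dots> \<le> (\<integral>\<^sup>+y. ennreal (K2 * T powr (1/\<alpha> - 1)) * emeasure lborel E *
        indicator {x \<in> space lborel_pos. x powr \<beta> \<le> 2*T} y \<partial>lborel_pos)"
    proof (rule nn_integral_mono)
      fix x assume "x \<in> space lborel_pos"
      then have x: "0 < x" by (simp add: space_lborel_pos)
      have "(\<lambda>y. (y, x)) -` D2 = {y. 0 < y \<and> x powr \<beta> + y powr \<alpha> \<in> E \<and> T/2 \<le> y powr \<alpha>}"
        using x by (auto simp: D2_def space_pos2 level_def add.commute)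
      then show "emeasure lborel_pos ((\<lambda>y. (y, x)) -` D2) \<le> ennreal (K2 * T powr (1/\<alpha> - 1)) * emeasure lborel E *
        indicator {x \<in> space lborel_pos. x powr \<beta> \<le> 2*T} x"
        using K2(2)[of T "x powr \<beta>" E] * x by (simp add: indicator_def space_lborel_pos)
    qed
    also have "\<dots> = ennreal (K2 * T powr (1/\<alpha> - 1)) * emeasure lborel E *
        emeasure lborel_pos {x \<in> space lborel_pos. x powr \<beta> \<le> 2*T}"
      by (rule nn_integral_cmult_indicator) measurable
    also have "\<dots> \<le> ennreal (K2 * T powr (1/\<alpha> - 1)) * emeasure lborel E * ennreal ((2*T) powr (1/\<beta>))"
      using * by (intro mult_left_mono emeasure_powr_le \<beta>) auto
    also have "\<dots> = ennreal (K2 * 2 powr (1/\<beta>) * T powr (1/\<alpha> + 1/\<beta> - 1)) * emeasure lborel E"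
    proof -
      have "K2 * T powr (1/\<alpha> - 1) * (2*T) powr (1/\<beta>) = K2 * 2 powr (1/\<beta>) * T powr (1/\<alpha> + 1/\<beta> - 1)"
        using * powr_add[of T "1/\<beta>" "1/\<alpha> - 1"] by (simp add: powr_mult add_diff_eq add.commute)
      then show ?thesis
        using K2(1) by (simp add: ennreal_mult[symmetric] mult_ac)
    qed
    finally have 2: "emeasure lborel_pos2 D2 \<le> ennreal (K2 * 2 powr (1/\<beta>) * T powr (1/\<alpha> + 1/\<beta> - 1)) * emeasure lborel E" .
    have "{z \<in> space lborel_pos2. level \<alpha> \<beta> z \<in> E} \<subseteq> D1 \<union> D2"
      using * by (auto simp: D1_def D2_def level_def)
    then have "emeasure lborel_pos2 {z \<in> space lborel_pos2. level \<alpha> \<beta> z \<in> E} \<le> emeasure lborel_pos2 (D1 \<union> D2)"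
      by (rule emeasure_mono) measurable
    also have "\<dots> \<le> emeasure lborel_pos2 D1 + emeasure lborel_pos2 D2"
      by (rule emeasure_subadditive) measurable
    also have "\<dots> \<le> ennreal (K1 * 2 powr (1/\<alpha>) * T powr (1/\<alpha> + 1/\<beta> - 1)) * emeasure lborel E +
       ennreal (K2 * 2 powr (1/\<beta>) * T powr (1/\<alpha> + 1/\<beta> - 1)) * emeasure lborel E"
      by (intro add_mono 1 2)
    also have "\<dots> = ennreal ((K1 * 2 powr (1/\<alpha>) + K2 * 2 powr (1/\<beta>)) * T powr (1/\<alpha> + 1/\<beta> - 1)) * emeasure lborel E"
      using K1(1) K2(1) by (subst distrib_right, subst ennreal_plus) (auto simp: distrib_right)
    finally show "emeasure lborel_pos2 {z \<in> space lborel_pos2. level \<alpha> \<beta> z \<in> E}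
         \<le> ennreal ((K1 * 2 powr (1/\<alpha>) + K2 * 2 powr (1/\<beta>)) * T powr (1/\<alpha> + 1/\<beta> - 1)) * emeasure lborel E" .
  qed (use K1(1) K2(1) in \<open>auto intro!: add_pos_pos\<close>)
qed

text \<open>If \<open>u\<close> lies within \<open>1/4\<close> to the right of \<open>T - R\<close> and \<open>t\<close> in \<open>E \<subseteq> (T + 1/4, T + 1)\<close>, then
\<open>v = t - u\<close> lies in \<open>(R, R + 1)\<close>, where \<open>g\<close> is bounded below. So every such section contains a full
translate of \<open>E\<close>.\<close>

lemma level_integral_tensor_ge:
  assumes \<beta>: "0 < \<beta>"
  obtains \<kappa> where "0 < \<kappa>"
    "\<And>\<alpha> T R E f g \<phi>0 \<gamma>. 1 \<le> T \<Longrightarrow> T/2 \<le> R \<Longrightarrow> R \<le> T \<Longrightarrow> E \<in> sets borel \<Longrightarrow> E \<subseteq> {T + 1/4<..<T + 1} \<Longrightarrow>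
       f \<in> borel_measurable lborel_pos \<Longrightarrow> g \<in> borel_measurable lborel_pos \<Longrightarrow>
       0 \<le> \<phi>0 \<Longrightarrow> 0 \<le> \<gamma> \<Longrightarrow>
       (\<forall>x\<in>powr_vimage \<alpha> {T - R<..<T - R + 1/4}. \<phi>0 \<le> f x) \<Longrightarrow>
       (\<forall>y\<in>powr_vimage \<beta> {R<..<R + 1}. \<gamma> \<le> g y) \<Longrightarrow>
       ennreal (\<kappa> * \<phi>0 * \<gamma> * T powr (1/\<beta> - 1)) * emeasure lborel_pos (powr_vimage \<alpha> {T - R<..<T - R + 1/4}) * emeasure lborel E
       \<le> (\<integral>\<^sup>+z. ennreal (f (fst z)) * ennreal (g (snd z)) * indicator E (level \<alpha> \<beta> z) \<partial>lborel_pos2)"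
proof -
  obtain \<kappa> where k: "0 < \<kappa>"
    "\<And>T S. 0 < T \<Longrightarrow> S \<in> sets borel \<Longrightarrow> S \<subseteq> {T/4..2*T} \<Longrightarrow>
       ennreal (\<kappa> * T powr (1/\<beta> - 1)) * emeasure lborel S \<le> emeasure lborel_pos (powr_vimage \<beta> S)"
    by (rule emeasure_powr_vimage_ge[OF \<beta>]) (rule that)
  show ?thesis
  proof (rule that[OF k(1)])
    fix \<alpha> T R :: real and E :: "real set" and f g :: "real \<Rightarrow> real" and \<phi>0 \<gamma> :: real
    assume T: "1 \<le> T" "T/2 \<le> R" "R \<le> T" and E [measurable]: "E \<in> sets borel" and ET: "E \<subseteq> {T + 1/4<..<T + 1}"
      and [measurable]: "f \<in> borel_measurable lborel_pos" "g \<in> borel_measurable lborel_pos"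
      and nn: "0 \<le> \<phi>0" "0 \<le> \<gamma>"
      and f: "\<forall>x\<in>powr_vimage \<alpha> {T - R<..<T - R + 1/4}. \<phi>0 \<le> f x"
      and g: "\<forall>y\<in>powr_vimage \<beta> {R<..<R + 1}. \<gamma> \<le> g y"
    let ?F = "powr_vimage \<alpha> {T - R<..<T - R + 1/4}"
    have F [measurable]: "?F \<in> sets lborel_pos" by measurable
    have "ennreal (\<kappa> * \<phi>0 * \<gamma> * T powr (1/\<beta> - 1)) * emeasure lborel_pos ?F * emeasure lborel E =
      (\<integral>\<^sup>+x. (ennreal \<phi>0 * (ennreal \<gamma> * (ennreal (\<kappa> * T powr (1/\<beta> - 1)) * emeasure lborel E))) * indicator ?F x \<partial>lborel_pos)"
      using nn k(1) by (subst nn_integral_cmult_indicator[OF F]) (simp add: ennreal_mult mult_ac)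
    also have "\<dots> \<le> (\<integral>\<^sup>+x. \<integral>\<^sup>+y. ennreal (f x) * ennreal (g y) * indicator E (level \<alpha> \<beta> (x, y)) \<partial>lborel_pos \<partial>lborel_pos)"
    proof (rule nn_integral_mono)
      fix x assume x: "x \<in> space lborel_pos"
      show "(ennreal \<phi>0 * (ennreal \<gamma> * (ennreal (\<kappa> * T powr (1/\<beta> - 1)) * emeasure lborel E))) * indicator ?F x \<le>
        (\<integral>\<^sup>+y. ennreal (f x) * ennreal (g y) * indicator E (level \<alpha> \<beta> (x, y)) \<partial>lborel_pos)"
      proof (cases "x \<in> ?F")
        case True
        define S where "S = (\<lambda>v. x powr \<alpha> + v) -` E"
        have S: "S \<in> sets borel" unfolding S_def
          using measurable_sets_borel[of "\<lambda>v. x powr \<alpha> + v" borel E] by auto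
        have SR: "S \<subseteq> {R<..<R+1}" using True ET unfolding S_def powr_vimage_def by fastforce
        note [measurable] = powr_vimage_sets[OF S, of \<beta>]
        have "ennreal (\<kappa> * T powr (1/\<beta> - 1)) * emeasure lborel E \<le> emeasure lborel_pos (powr_vimage \<beta> S)"
        proof -
          have "S \<subseteq> {T/4..2*T}" using SR T by (auto simp: subset_iff)
          then show ?thesis using k(2)[of T S] S T emeasure_lborel_translate[OF E, of "x powr \<alpha>"]
            by (simp add: S_def)
        qed
        then have "ennreal \<phi>0 * (ennreal \<gamma> * (ennreal (\<kappa> * T powr (1/\<beta> - 1)) * emeasure lborel E)) * indicator ?F x
          \<le> ennreal (f x) * (ennreal \<gamma> * emeasure lborel_pos (powr_vimage \<beta> S))"
          using True f by (auto intro!: mult_mono ennreal_leI)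
        also have "\<dots> = ennreal (f x) * (\<integral>\<^sup>+y. ennreal \<gamma> * indicator (powr_vimage \<beta> S) y \<partial>lborel_pos)"
          by (simp add: nn_integral_cmult_indicator)
        also have "\<dots> \<le> ennreal (f x) * (\<integral>\<^sup>+y. ennreal (g y) * indicator E (level \<alpha> \<beta> (x, y)) \<partial>lborel_pos)"
        proof (intro mult_left_mono nn_integral_mono)
          fix y
          show "ennreal \<gamma> * indicator (powr_vimage \<beta> S) y \<le> ennreal (g y) * indicator E (level \<alpha> \<beta> (x, y))"
          proof (cases "y \<in> powr_vimage \<beta> S")
            case True
            then have "y \<in> powr_vimage \<beta> {R<..<R+1}" using SR by (auto simp: powr_vimage_def)
            then show ?thesis using g True
              by (auto simp: powr_vimage_def S_def level_def intro!: ennreal_leI)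
          qed simp
        qed simp
        also have "\<dots> = (\<integral>\<^sup>+y. ennreal (f x) * (ennreal (g y) * indicator E (level \<alpha> \<beta> (x, y))) \<partial>lborel_pos)"
          using x by (intro nn_integral_cmult[symmetric]) measurable
        finally show ?thesis by (simp add: mult.assoc)
      qed simp
    qed
    also have "\<dots> = (\<integral>\<^sup>+z. ennreal (f (fst z)) * ennreal (g (snd z)) * indicator E (level \<alpha> \<beta> z) \<partial>lborel_pos2)"
    proof -
      have "(\<lambda>z. ennreal (f (fst z)) * ennreal (g (snd z)) * indicator E (level \<alpha> \<beta> z)) \<in> borel_measurable lborel_pos2"
        by measurable
      from lborel_pos.nn_integral_fst[OF this] show ?thesis by simp
    qed
    finally show "ennreal (\<kappa> * \<phi>0 * \<gamma> * T powr (1/\<beta> - 1)) * emeasure lborel_pos ?F * emeasure lborel E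
       \<le> (\<integral>\<^sup>+z. ennreal (f (fst z)) * ennreal (g (snd z)) * indicator E (level \<alpha> \<beta> z) \<partial>lborel_pos2)" .
  qed
qed

section \<open>The symbol of an averaged kernel\<close>

text \<open>The symbol \<open>\<phi>\<close> of the orthogonal projection of the kernel \<open>k\<close>. All that the proof uses of the
average is this orthogonality.\<close>

definition hankel_projection :: "real \<Rightarrow> real \<Rightarrow> (real \<times> real \<Rightarrow> complex) \<Rightarrow> (real \<Rightarrow> complex) \<Rightarrow> bool" where
  "hankel_projection \<alpha> \<beta> k \<phi> \<longleftrightarrow>
     sq_integrable lborel_pos2 (hankel_kernel \<alpha> \<beta> \<phi>) \<and>
     (\<forall>\<psi>. sq_integrable lborel_pos2 (hankel_kernel \<alpha> \<beta> \<psi>) \<longrightarrow>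
        (LINT z|lborel_pos2. (k z - hankel_kernel \<alpha> \<beta> \<phi> z) * cnj (hankel_kernel \<alpha> \<beta> \<psi> z)) = 0)"

lemma sq_integrable_indicator_mult:
  assumes "sq_integrable M f" "A \<in> sets M"
  shows "sq_integrable M (\<lambda>z. f z * indicator A z)"
proof -
  have [measurable]: "f \<in> borel_measurable M" and [measurable]: "A \<in> sets M"
    using assms by (auto simp: sq_integrable_def)
  have "integrable M (\<lambda>z. (cmod (f z * indicator A z))\<^sup>2)"
    by (rule Bochner_Integration.integrable_bound[OF sq_integrable_integrable[OF assms(1)]])
      (measurable, auto simp: indicator_def)
  then show ?thesis by (simp add: sq_integrable_def)
qed

lemma sq_integrable_diff: "sq_integrable M f \<Longrightarrow> sq_integrable M g \<Longrightarrow> sq_integrable M (\<lambda>x. f x - g x)"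
  using sq_integrable_add[of M f "\<lambda>x. -1 * g x"] sq_integrable_mult[of M g "-1"] by simp

text \<open>Orthogonality is tested with the symbol \<open>\<phi>\<close> cut off to \<open>S\<close>: since \<open>k\<close> vanishes there, what remains is
the square of the norm of the average on these levels.\<close>

lemma hankel_projection_vanishes:
  assumes k: "sq_integrable lborel_pos2 k" and P: "hankel_projection \<alpha> \<beta> k \<phi>"
    and S: "S \<in> sets borel"
    and k0: "\<And>z. z \<in> space lborel_pos2 \<Longrightarrow> level \<alpha> \<beta> z \<in> S \<Longrightarrow> k z = 0"
  shows "AE z in lborel_pos2. level \<alpha> \<beta> z \<in> S \<longrightarrow> hankel_kernel \<alpha> \<beta> \<phi> z = 0"
proof -
  let ?h = "hankel_kernel \<alpha> \<beta> \<phi>"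
  define D where "D = {z \<in> space lborel_pos2. level \<alpha> \<beta> z \<in> S}"
  have D [measurable]: "D \<in> sets lborel_pos2" unfolding D_def using S by measurable
  have h: "sq_integrable lborel_pos2 ?h" using P by (simp add: hankel_projection_def)
  then have [measurable]: "?h \<in> borel_measurable lborel_pos2" by (simp add: sq_integrable_def)
  define \<psi> where "\<psi> t = \<phi> t * indicator S t" for t
  have psi: "hankel_kernel \<alpha> \<beta> \<psi> z = ?h z * indicator D z" if "z \<in> space lborel_pos2" for z
    using that by (auto simp: hankel_kernel_level \<psi>_def D_def indicator_def)
  have hD: "sq_integrable lborel_pos2 (\<lambda>z. ?h z * indicator D z)"
    by (rule sq_integrable_indicator_mult[OF h D])
  have "sq_integrable lborel_pos2 (hankel_kernel \<alpha> \<beta> \<psi>)"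
    using hD psi unfolding sq_integrable_def
    by (auto cong: measurable_cong Bochner_Integration.integrable_cong)
  then have "(LINT z|lborel_pos2. (k z - ?h z) * cnj (hankel_kernel \<alpha> \<beta> \<psi> z)) = 0"
    using P by (simp add: hankel_projection_def)
  also have "(LINT z|lborel_pos2. (k z - ?h z) * cnj (hankel_kernel \<alpha> \<beta> \<psi> z)) =
      (LINT z|lborel_pos2. - of_real ((cmod (?h z * indicator D z))\<^sup>2))"
  proof (rule Bochner_Integration.integral_cong[OF refl])
    fix z assume z: "z \<in> space lborel_pos2"
    show "(k z - ?h z) * cnj (hankel_kernel \<alpha> \<beta> \<psi> z) = - of_real ((cmod (?h z * indicator D z))\<^sup>2)"
      using z k0[OF z] unfolding psi[OF z]
      by (simp add: D_def indicator_def complex_norm_square del: of_real_power)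
  qed
  finally have "(LINT z|lborel_pos2. (cmod (?h z * indicator D z))\<^sup>2) = 0"
    by (simp del: of_real_power)
  then have "AE z in lborel_pos2. (cmod (?h z * indicator D z))\<^sup>2 = 0"
    by (subst (asm) integral_nonneg_eq_0_iff_AE) (use hD in \<open>auto simp: sq_integrable_def\<close>)
  then show ?thesis using AE_space
    by eventually_elim (auto simp: D_def)
qed

text \<open>Only the kernel is known to be measurable. Its restriction to the line \<open>x = 1\<close> takes the value
\<open>\<phi> t\<close> at the point with \<open>v = t - 1\<close>, and this line meets all levels above \<open>1\<close>.\<close>

lemma symbol_set_borel:
  assumes h: "hankel_kernel \<alpha> \<beta> \<phi> \<in> borel_measurable lborel_pos2" and \<beta>: "0 < \<beta>" and T: "1 \<le> T"
  shows "{t. T < t \<and> t < T' \<and> Re (\<phi> t) < c} \<in> sets borel"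
proof -
  note [measurable] = h
  let ?M = "restrict_space borel {T<..<T'}"
  have "(\<lambda>t. (t - 1) powr (1/\<beta>)) \<in> ?M \<rightarrow>\<^sub>M lborel_pos"
  proof (rule measurable_restrict_space2)
    show "(\<lambda>t. (t - 1) powr (1/\<beta>)) \<in> space ?M \<rightarrow> {0<..}"
      using T by (auto simp: space_restrict_space)
    have "(\<lambda>t::real. (t - 1) powr (1/\<beta>)) \<in> borel_measurable borel" by measurable
    then show "(\<lambda>t. (t - 1) powr (1/\<beta>)) \<in> ?M \<rightarrow>\<^sub>M lborel"
      by (simp add: measurable_restrict_space1)
  qed
  moreover have "(\<lambda>t::real. 1::real) \<in> ?M \<rightarrow>\<^sub>M lborel_pos"
    by (simp add: space_lborel_pos)
  ultimately have [measurable]: "(\<lambda>t. (1, (t - 1) powr (1/\<beta>))) \<in> ?M \<rightarrow>\<^sub>M lborel_pos2"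
    by measurable
  have "{t \<in> space ?M. Re (hankel_kernel \<alpha> \<beta> \<phi> (1, (t - 1) powr (1/\<beta>))) < c} \<in> sets ?M"
    by measurable
  also have "{t \<in> space ?M. Re (hankel_kernel \<alpha> \<beta> \<phi> (1, (t - 1) powr (1/\<beta>))) < c} =
      {t. T < t \<and> t < T' \<and> Re (\<phi> t) < c}"
    using T \<beta> by (auto simp: space_restrict_space hankel_kernel_def powr_powr)
  finally show ?thesis by (simp add: sets_restrict_space_iff)
qed

text \<open>Orthogonality is tested with the indicator of the set of levels where the real part of \<open>\<phi>\<close> is
below \<open>c\<close>. Together with the hypothesis on \<open>k\<close> it bounds the integral of \<open>c - Re \<phi>\<close> over these levels
by zero from above, although the integrand is positive on them; so they form a null set.\<close>

lemma hankel_projection_ge: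
  fixes k :: "real \<times> real \<Rightarrow> real"
  assumes k: "sq_integrable lborel_pos2 (\<lambda>z. complex_of_real (k z))" and P: "hankel_projection \<alpha> \<beta> (\<lambda>z. complex_of_real (k z)) \<phi>"
    and k0: "\<And>z. 0 \<le> k z" and \<beta>: "0 < \<beta>" and T: "1 \<le> T" and c: "0 \<le> c"
    and fin: "emeasure lborel_pos2 {z \<in> space lborel_pos2. level \<alpha> \<beta> z \<in> {T<..<T'}} < \<infinity>"
    and le: "\<And>E. E \<in> sets borel \<Longrightarrow> E \<subseteq> {T<..<T'} \<Longrightarrow>
      ennreal c * emeasure lborel_pos2 {z \<in> space lborel_pos2. level \<alpha> \<beta> z \<in> E} \<le>
        (\<integral>\<^sup>+z. ennreal (k z) * indicator E (level \<alpha> \<beta> z) \<partial>lborel_pos2)"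
  shows "AE z in lborel_pos2. T < level \<alpha> \<beta> z \<and> level \<alpha> \<beta> z < T' \<longrightarrow> c \<le> Re (hankel_kernel \<alpha> \<beta> \<phi> z)"
proof -
  let ?h = "hankel_kernel \<alpha> \<beta> \<phi>"
  have h: "sq_integrable lborel_pos2 ?h" using P by (simp add: hankel_projection_def)
  then have hm [measurable]: "?h \<in> borel_measurable lborel_pos2" by (simp add: sq_integrable_def)
  have km: "(\<lambda>z. complex_of_real (k z)) \<in> borel_measurable lborel_pos2" using k by (simp add: sq_integrable_def)
  have [measurable]: "k \<in> borel_measurable lborel_pos2"
    using measurable_compose[OF km, of Re borel] by simp
  define E where "E = {t. T < t \<and> t < T' \<and> Re (\<phi> t) < c}"
  have E [measurable]: "E \<in> sets borel" unfolding E_def by (rule symbol_set_borel[OF hm \<beta> T])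
  have ET: "E \<subseteq> {T<..<T'}" by (auto simp: E_def)
  define D where "D = {z \<in> space lborel_pos2. level \<alpha> \<beta> z \<in> E}"
  have D [measurable]: "D \<in> sets lborel_pos2" unfolding D_def by measurable
  have Dfin: "emeasure lborel_pos2 D < \<infinity>"
    by (rule le_less_trans[OF _ fin], rule emeasure_mono) (use ET in \<open>auto simp: D_def\<close>)
  define \<psi> :: "real \<Rightarrow> complex" where "\<psi> t = indicator E t" for t
  have psi: "hankel_kernel \<alpha> \<beta> \<psi> z = indicator D z" if "z \<in> space lborel_pos2" for z
    using that by (auto simp: hankel_kernel_level \<psi>_def D_def indicator_def)
  have iD: "integrable lborel_pos2 (\<lambda>z. indicator D z :: real)"
    using Dfin by (simp add: integrable_indicator_iff)
  have sD: "sq_integrable lborel_pos2 (indicator D)"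
  proof -
    have "(\<lambda>z. (cmod (indicator D z))\<^sup>2) = indicator D" by (auto simp: indicator_def)
    then show ?thesis using iD by (simp add: sq_integrable_def)
  qed
  have ik: "integrable lborel_pos2 (\<lambda>z. k z * indicator D z)"
  proof -
    have "integrable lborel_pos2 (\<lambda>z. Re (of_real (k z) * indicator D z))"
      by (intro integrable_Re sq_integrable_prod k sD)
    moreover have "(\<lambda>z. Re (of_real (k z) * indicator D z)) = (\<lambda>z. k z * indicator D z)"
      by (auto simp: indicator_def)
    ultimately show ?thesis by simp
  qed
  have ih: "integrable lborel_pos2 (\<lambda>z. Re (?h z) * indicator D z)"
  proof -
    have "integrable lborel_pos2 (\<lambda>z. Re (?h z * indicator D z))"
      by (intro integrable_Re sq_integrable_prod h sD)
    moreover have "(\<lambda>z. Re (?h z * indicator D z)) = (\<lambda>z. Re (?h z) * indicator D z)"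
      by (auto simp: indicator_def)
    ultimately show ?thesis by simp
  qed
  have "sq_integrable lborel_pos2 (hankel_kernel \<alpha> \<beta> \<psi>)"
    using sD psi unfolding sq_integrable_def
    by (auto cong: measurable_cong Bochner_Integration.integrable_cong)
  then have "0 = (LINT z|lborel_pos2. (of_real (k z) - ?h z) * cnj (hankel_kernel \<alpha> \<beta> \<psi> z))"
    using P by (simp add: hankel_projection_def)
  also have "\<dots> = (LINT z|lborel_pos2. (of_real (k z) - ?h z) * indicator D z)"
    by (intro Bochner_Integration.integral_cong refl) (simp add: psi, simp add: indicator_def)
  finally have "0 = Re (LINT z|lborel_pos2. (of_real (k z) - ?h z) * indicator D z)" by simp
  also have "\<dots> = (LINT z|lborel_pos2. Re ((of_real (k z) - ?h z) * indicator D z))"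
    by (intro integral_Re[symmetric] sq_integrable_prod sq_integrable_diff k h sD)
  also have "\<dots> = (LINT z|lborel_pos2. k z * indicator D z - Re (?h z) * indicator D z)"
    by (intro Bochner_Integration.integral_cong refl) (auto simp: indicator_def)
  also have "\<dots> = (LINT z|lborel_pos2. k z * indicator D z) - (LINT z|lborel_pos2. Re (?h z) * indicator D z)"
    by (rule Bochner_Integration.integral_diff[OF ik ih])
  finally have eq: "(LINT z|lborel_pos2. k z * indicator D z) = (LINT z|lborel_pos2. Re (?h z) * indicator D z)" by simp
  have "ennreal (c * measure lborel_pos2 D) = ennreal c * emeasure lborel_pos2 D"
    using c Dfin by (simp add: ennreal_mult emeasure_eq_ennreal_measure top.not_eq_extremum)
  also have "\<dots> \<le> (\<integral>\<^sup>+z. ennreal (k z) * indicator E (level \<alpha> \<beta> z) \<partial>lborel_pos2)"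
    unfolding D_def by (rule le[OF E ET])
  also have "\<dots> = (\<integral>\<^sup>+z. ennreal (k z * indicator D z) \<partial>lborel_pos2)"
    by (intro nn_integral_cong) (auto simp: D_def indicator_def)
  also have "\<dots> = ennreal (LINT z|lborel_pos2. k z * indicator D z)"
    by (rule nn_integral_eq_integral[OF ik]) (use k0 in auto)
  finally have "c * measure lborel_pos2 D \<le> (LINT z|lborel_pos2. k z * indicator D z)"
    by (subst (asm) ennreal_le_iff) (use k0 in \<open>auto intro!: integral_nonneg_AE\<close>)
  then have le0: "(LINT z|lborel_pos2. c * indicator D z - Re (?h z) * indicator D z) \<le> 0"
    using eq iD ih by (subst Bochner_Integration.integral_diff) auto
  have nonneg: "0 \<le> c * indicator D z - Re (?h z) * indicator D z" for z
    by (auto simp: D_def E_def indicator_def hankel_kernel_level)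
  have "(LINT z|lborel_pos2. c * indicator D z - Re (?h z) * indicator D z) = 0"
    by (rule antisym[OF le0 integral_nonneg_AE]) (use nonneg in auto)
  then have "AE z in lborel_pos2. c * indicator D z - Re (?h z) * indicator D z = 0"
    by (subst (asm) integral_nonneg_eq_0_iff_AE) (use nonneg iD ih in auto)
  then show ?thesis
    using AE_space
  proof eventually_elim
    case (elim z)
    show ?case
    proof (intro impI, rule ccontr)
      assume *: "T < level \<alpha> \<beta> z \<and> level \<alpha> \<beta> z < T'" "\<not> c \<le> Re (?h z)"
      then have "z \<in> D" using elim by (auto simp: D_def E_def hankel_kernel_level)
      then show False using elim * by simp
    qed
  qed
qed

text \<open>A rank one kernel that is large near \<open>u = T - R\<close>, \<open>v = R\<close>. The numbers \<open>\<phi>0\<close> and \<open>\<gamma>\<close> bound its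
factors from below, and \<open>m\<close> bounds the length of the set of \<open>x\<close> that is used.\<close>

definition rank_one_data ::
    "real \<Rightarrow> real \<Rightarrow> real \<Rightarrow> real \<Rightarrow> (real \<Rightarrow> real) \<Rightarrow> (real \<Rightarrow> real) \<Rightarrow> real \<Rightarrow> real \<Rightarrow> real \<Rightarrow> bool" where
  "rank_one_data \<alpha> \<beta> T R f g \<phi>0 \<gamma> m \<longleftrightarrow>
     T/2 \<le> R \<and> R \<le> T \<and>
     sq_integrable lborel_pos (\<lambda>x. complex_of_real (f x)) \<and>
     sq_integrable lborel_pos (\<lambda>y. complex_of_real (g y)) \<and>
     (\<forall>x. 0 \<le> f x) \<and> (\<forall>y. 0 \<le> g y) \<and> 0 \<le> \<phi>0 \<and> 0 \<le> \<gamma> \<and> 0 \<le> m \<and>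
     (\<forall>x\<in>powr_vimage \<alpha> {T - R<..<T - R + 1/4}. \<phi>0 \<le> f x) \<and>
     (\<forall>y\<in>powr_vimage \<beta> {R<..<R + 1}. \<gamma> \<le> g y) \<and>
     ennreal m \<le> emeasure lborel_pos (powr_vimage \<alpha> {T - R<..<T - R + 1/4})"

text \<open>The integral of the kernel over the levels in \<open>E\<close> is at least of order \<open>\<phi>0 \<gamma> m T\<^bsup>1/\<beta> - 1\<^esup>\<close> times the length of
\<open>E\<close>, and the area of these levels is at most of order \<open>T\<^bsup>1/\<alpha> + 1/\<beta> - 1\<^esup>\<close> times that length. The quotient
bounds the symbol from below.\<close>

lemma symbol_lower_bound:
  assumes \<alpha>: "0 < \<alpha>" and \<beta>: "0 < \<beta>"
  obtains c where "0 < c"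
    "\<And>T R f g \<phi>0 \<gamma> m \<phi>. 1 \<le> T \<Longrightarrow> rank_one_data \<alpha> \<beta> T R f g \<phi>0 \<gamma> m \<Longrightarrow>
       hankel_projection \<alpha> \<beta> (tensor (\<lambda>x. complex_of_real (f x)) (\<lambda>y. complex_of_real (g y))) \<phi> \<Longrightarrow>
       AE z in lborel_pos2. T + 1/4 < level \<alpha> \<beta> z \<and> level \<alpha> \<beta> z < T + 1 \<longrightarrow>
         c * \<phi>0 * \<gamma> * m * T powr (- 1/\<alpha>) \<le> Re (hankel_kernel \<alpha> \<beta> \<phi> z)"
proof -
  obtain C where C: "0 < C"
    "\<And>T E. 1 \<le> T \<Longrightarrow> E \<in> sets borel \<Longrightarrow> E \<subseteq> {T..T+1} \<Longrightarrow>
       emeasure lborel_pos2 {z \<in> space lborel_pos2. level \<alpha> \<beta> z \<in> E}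
         \<le> ennreal (C * T powr (1/\<alpha> + 1/\<beta> - 1)) * emeasure lborel E"
    by (rule emeasure_level_vimage_le[OF \<alpha> \<beta>]) (rule that)
  obtain \<kappa> where \<kappa>: "0 < \<kappa>"
    "\<And>\<alpha> T R E f g \<phi>0 \<gamma>. 1 \<le> T \<Longrightarrow> T/2 \<le> R \<Longrightarrow> R \<le> T \<Longrightarrow> E \<in> sets borel \<Longrightarrow> E \<subseteq> {T + 1/4<..<T + 1} \<Longrightarrow>
       f \<in> borel_measurable lborel_pos \<Longrightarrow> g \<in> borel_measurable lborel_pos \<Longrightarrow>
       0 \<le> \<phi>0 \<Longrightarrow> 0 \<le> \<gamma> \<Longrightarrow>
       (\<forall>x\<in>powr_vimage \<alpha> {T - R<..<T - R + 1/4}. \<phi>0 \<le> f x) \<Longrightarrow>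
       (\<forall>y\<in>powr_vimage \<beta> {R<..<R + 1}. \<gamma> \<le> g y) \<Longrightarrow>
       ennreal (\<kappa> * \<phi>0 * \<gamma> * T powr (1/\<beta> - 1)) * emeasure lborel_pos (powr_vimage \<alpha> {T - R<..<T - R + 1/4}) * emeasure lborel E
       \<le> (\<integral>\<^sup>+z. ennreal (f (fst z)) * ennreal (g (snd z)) * indicator E (level \<alpha> \<beta> z) \<partial>lborel_pos2)"
    by (rule level_integral_tensor_ge[OF \<beta>]) (rule that)
  show ?thesis
  proof (rule that[of "\<kappa> / C"])
    show "0 < \<kappa> / C" using C \<kappa> by simp
    fix T R :: real and f g :: "real \<Rightarrow> real" and \<phi>0 \<gamma> m :: real and \<phi>
    assume T1: "1 \<le> T" and D: "rank_one_data \<alpha> \<beta> T R f g \<phi>0 \<gamma> m"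
      and P: "hankel_projection \<alpha> \<beta> (tensor (\<lambda>x. complex_of_real (f x)) (\<lambda>y. complex_of_real (g y))) \<phi>"
    have T: "1 \<le> T" "T/2 \<le> R" "R \<le> T"
      and f: "sq_integrable lborel_pos (\<lambda>x. complex_of_real (f x))" "\<forall>x. 0 \<le> f x"
      and g: "sq_integrable lborel_pos (\<lambda>y. complex_of_real (g y))" "\<forall>y. 0 \<le> g y"
      and nn: "0 \<le> \<phi>0" "0 \<le> \<gamma>" "0 \<le> m"
      and fl: "\<forall>x\<in>powr_vimage \<alpha> {T - R<..<T - R + 1/4}. \<phi>0 \<le> f x"
      and gl: "\<forall>y\<in>powr_vimage \<beta> {R<..<R + 1}. \<gamma> \<le> g y"
      and m: "ennreal m \<le> emeasure lborel_pos (powr_vimage \<alpha> {T - R<..<T - R + 1/4})"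
      using T1 D unfolding rank_one_data_def by blast+
    have fm: "f \<in> borel_measurable lborel_pos"
      using measurable_compose[OF sq_integrable_measurable[OF f(1)], of Re borel] by simp
    have gm: "g \<in> borel_measurable lborel_pos"
      using measurable_compose[OF sq_integrable_measurable[OF g(1)], of Re borel] by simp
    have k: "tensor (\<lambda>x. complex_of_real (f x)) (\<lambda>y. complex_of_real (g y)) =
        (\<lambda>z. complex_of_real (f (fst z) * g (snd z)))"
      by (auto simp: tensor_def)
    show "AE z in lborel_pos2. T + 1/4 < level \<alpha> \<beta> z \<and> level \<alpha> \<beta> z < T + 1 \<longrightarrow>
         \<kappa> / C * \<phi>0 * \<gamma> * m * T powr (- 1/\<alpha>) \<le> Re (hankel_kernel \<alpha> \<beta> \<phi> z)"
    proof (rule hankel_projection_ge[where k = "\<lambda>z. f (fst z) * g (snd z)"])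
      show "sq_integrable lborel_pos2 (\<lambda>z. complex_of_real (f (fst z) * g (snd z)))"
        using sq_integrable_tensor[OF f(1) g(1)] unfolding k .
      show "hankel_projection \<alpha> \<beta> (\<lambda>z. complex_of_real (f (fst z) * g (snd z))) \<phi>"
        using P unfolding k .
      show "0 \<le> \<kappa> / C * \<phi>0 * \<gamma> * m * T powr (- 1/\<alpha>)" using \<kappa> C nn by simp
      have "emeasure lborel_pos2 {z \<in> space lborel_pos2. level \<alpha> \<beta> z \<in> {T + 1/4<..<T + 1}}
         \<le> ennreal (C * T powr (1/\<alpha> + 1/\<beta> - 1)) * emeasure lborel {T + 1/4<..<T + 1}"
        using T by (intro C(2)) auto
      also have "\<dots> < \<infinity>" by (simp add: ennreal_mult_less_top)
      finally show "emeasure lborel_pos2 {z \<in> space lborel_pos2. level \<alpha> \<beta> z \<in> {T + 1/4<..<T + 1}} < \<infinity>" .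
      fix E assume E: "E \<in> sets borel" "E \<subseteq> {T + 1/4<..<T + 1}"
      have "ennreal (\<kappa> / C * \<phi>0 * \<gamma> * m * T powr (- 1/\<alpha>)) * emeasure lborel_pos2 {z \<in> space lborel_pos2. level \<alpha> \<beta> z \<in> E}
        \<le> ennreal (\<kappa> / C * \<phi>0 * \<gamma> * m * T powr (- 1/\<alpha>)) * (ennreal (C * T powr (1/\<alpha> + 1/\<beta> - 1)) * emeasure lborel E)"
        using T E by (intro mult_left_mono C(2)) auto
      also have "\<dots> = ennreal (\<kappa> * \<phi>0 * \<gamma> * T powr (1/\<beta> - 1)) * ennreal m * emeasure lborel E"
      proof -
        have "T powr (- 1/\<alpha>) * T powr (1/\<alpha> + 1/\<beta> - 1) = T powr (1/\<beta> - 1)"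
          by (simp add: powr_add[symmetric])
        then have eq: "\<kappa> / C * \<phi>0 * \<gamma> * m * T powr (- 1/\<alpha>) * (C * T powr (1/\<alpha> + 1/\<beta> - 1)) =
            \<kappa> * \<phi>0 * \<gamma> * T powr (1/\<beta> - 1) * m"
          using C(1) by (simp add: field_simps)
        have "ennreal (\<kappa> / C * \<phi>0 * \<gamma> * m * T powr (- 1/\<alpha>)) * (ennreal (C * T powr (1/\<alpha> + 1/\<beta> - 1)) * emeasure lborel E) =
            ennreal (\<kappa> / C * \<phi>0 * \<gamma> * m * T powr (- 1/\<alpha>) * (C * T powr (1/\<alpha> + 1/\<beta> - 1))) * emeasure lborel E"
          using nn \<kappa>(1) C(1) by (subst ennreal_mult) (auto simp: mult.assoc)
        also have "\<dots> = ennreal (\<kappa> * \<phi>0 * \<gamma> * T powr (1/\<beta> - 1)) * ennreal m * emeasure lborel E"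
          unfolding eq using nn \<kappa>(1) by (subst ennreal_mult) auto
        finally show ?thesis .
      qed
      also have "\<dots> \<le> ennreal (\<kappa> * \<phi>0 * \<gamma> * T powr (1/\<beta> - 1)) * emeasure lborel_pos (powr_vimage \<alpha> {T - R<..<T - R + 1/4}) * emeasure lborel E"
        by (intro mult_right_mono mult_left_mono m) auto
      also have "\<dots> \<le> (\<integral>\<^sup>+z. ennreal (f (fst z)) * ennreal (g (snd z)) * indicator E (level \<alpha> \<beta> z) \<partial>lborel_pos2)"
        by (rule \<kappa>(2)) (use T E fm gm nn fl gl in auto)
      finally show "ennreal (\<kappa> / C * \<phi>0 * \<gamma> * m * T powr (- 1/\<alpha>)) * emeasure lborel_pos2 {z \<in> space lborel_pos2. level \<alpha> \<beta> z \<in> E}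
        \<le> (\<integral>\<^sup>+z. ennreal (f (fst z) * g (snd z)) * indicator E (level \<alpha> \<beta> z) \<partial>lborel_pos2)"
        using f g by (simp add: ennreal_mult)
    qed (use f g \<beta> T in auto)
  qed
qed

section \<open>Integrals over boxes\<close>

text \<open>Up to normalisation, a matrix entry of the operator with kernel \<open>h\<close> between the indicators of \<open>K\<close>
and \<open>J\<close>.\<close>

definition block :: "(real \<times> real \<Rightarrow> complex) \<Rightarrow> real set \<Rightarrow> real set \<Rightarrow> complex" where
  "block h J K = (LINT z|lborel_pos2. h z * tensor (indicator J) (indicator K) z)"

lemma tensor_indicator: "tensor (indicator J) (indicator K) z = indicator (J \<times> K) z"
  by (auto simp: tensor_def indicator_def split: prod.splits)

lemma sq_integrable_indicator:
  assumes "J \<in> sets M" "emeasure M J < \<infinity>"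
  shows "sq_integrable M (indicator J)"
proof -
  have "(\<lambda>x. (cmod (indicator J x))\<^sup>2) = indicator J" by (auto simp: indicator_def)
  then show ?thesis using assms by (simp add: sq_integrable_def integrable_indicator_iff)
qed

lemma block_eq_0:
  assumes "AE z in lborel_pos2. z \<in> J \<times> K \<longrightarrow> h z = 0"
  shows "block h J K = 0"
proof -
  have "AE z in lborel_pos2. h z * tensor (indicator J) (indicator K) z = 0"
    using assms by eventually_elim (auto simp: tensor_indicator indicator_def)
  then show ?thesis unfolding block_def by (rule integral_eq_zero_AE)
qed

lemma block_ge:
  assumes h: "sq_integrable lborel_pos2 h"
    and J: "J \<in> sets lborel_pos" "emeasure lborel_pos J < \<infinity>"
    and K: "K \<in> sets lborel_pos" "emeasure lborel_pos K < \<infinity>"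
    and ge: "AE z in lborel_pos2. z \<in> J \<times> K \<longrightarrow> c \<le> Re (h z)"
  shows "c * (measure lborel_pos J * measure lborel_pos K) \<le> Re (block h J K)"
proof -
  have eJK: "emeasure lborel_pos2 (J \<times> K) = emeasure lborel_pos J * emeasure lborel_pos K"
    by (rule lborel_pos.emeasure_pair_measure_Times[OF J(1) K(1)])
  have JK: "J \<times> K \<in> sets lborel_pos2" using J K by simp
  have i: "integrable lborel_pos2 (\<lambda>z. h z * tensor (indicator J) (indicator K) z)"
    by (intro sq_integrable_prod h sq_integrable_tensor sq_integrable_indicator J K)
  have i1: "integrable lborel_pos2 (\<lambda>z. c * indicator (J \<times> K) z)"
    using JK eJK J K by (auto simp: integrable_indicator_iff ennreal_mult_less_top)
  have "c * (measure lborel_pos J * measure lborel_pos K) = (LINT z|lborel_pos2. c * indicator (J \<times> K) z)"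
    using JK eJK by (simp add: measure_def enn2real_mult)
  also have "\<dots> \<le> (LINT z|lborel_pos2. Re (h z * tensor (indicator J) (indicator K) z))"
    using i1 integrable_Re[OF i]
    by (rule integral_mono_AE)
      (use ge in eventually_elim, auto simp: tensor_indicator indicator_def)
  also have "\<dots> = Re (block h J K)"
    unfolding block_def by (rule integral_Re[OF i])
  finally show ?thesis .
qed

section \<open>Schatten norms of diagonal operators\<close>

lemma norm_abs_l2: "sq_integrable lborel_pos f \<Longrightarrow> (norm (abs_l2 f))\<^sup>2 = (LINT x|lborel_pos. (cmod (f x))\<^sup>2)"
proof -
  assume f: "sq_integrable lborel_pos f"
  have "complex_of_real ((norm (abs_l2 f))\<^sup>2) = (LINT x|lborel_pos. f x * cnj (f x))"
    using cip_self[of "abs_l2 f"] cip_abs[OF f f] by simp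
  also have "\<dots> = complex_of_real (LINT x|lborel_pos. (cmod (f x))\<^sup>2)"
    unfolding complex_norm_square[symmetric] by (rule integral_complex_of_real)
  finally show ?thesis using of_real_eq_iff by blast
qed

lemma norm_abs_l2_cnj:
  assumes "sq_integrable lborel_pos f"
  shows "norm (abs_l2 (\<lambda>x. cnj (f x))) = norm (abs_l2 f)"
proof -
  have "(norm (abs_l2 (\<lambda>x. cnj (f x))))\<^sup>2 = (norm (abs_l2 f))\<^sup>2"
    using assms by (simp add: norm_abs_l2 sq_integrable_cnj)
  then show ?thesis by simp
qed

lemma cmod_cip_le: "cmod (cip f g) \<le> norm f * norm g"
proof (cases "cip f g = 0")
  case False
  \<comment> \<open>Rotating \<open>f\<close> makes the form real and reduces the claim to the real inner product.\<close>
  define u where "u = cnj (sgn (cip f g))"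
  have "inner (cscale u f) (cscale 1 g) = Re (u * cip f g)"
    by (simp only: inner_eq_Re_cip cip_cscale) simp
  also have "u * cip f g = of_real (cmod (cip f g))"
    using complex_norm_square[of "cip f g"] False
    by (simp add: u_def sgn_eq power2_eq_square mult.commute divide_eq_eq)
  finally have "cmod (cip f g) = inner (cscale u f) (cscale 1 g)" by simp
  also have "\<dots> \<le> norm (cscale u f) * norm (cscale 1 g)" by (rule norm_cauchy_schwarz)
  also have "\<dots> = norm f * norm g"
    using False by (simp add: norm_cscale u_def norm_sgn)
  finally show ?thesis .
qed simp

lemma schatten_suminf_le:
  assumes T: "T \<in> l2_ops" and q: "0 < q"
    and s: "\<And>j. singular_value T j \<le> (if j < M then c j else 0)"
  shows "T \<in> schatten q" "schatten_norm q T \<le> (\<Sum>j<M. c j powr q) powr (1/q)"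
proof -
  have z: "singular_value T j powr q = 0" if "j \<notin> {..<M}" for j
    using s[of j] singular_value_nonneg[of T j] that by simp
  have eq: "(\<Sum>j. singular_value T j powr q) = (\<Sum>j<M. singular_value T j powr q)"
    by (rule suminf_finite) (use z in auto)
  have "summable (\<lambda>j. singular_value T j powr q)"
    by (rule summable_finite[of "{..<M}"]) (simp, erule z)
  then show "T \<in> schatten q"
    using T by (simp add: schatten_def)
  have "(\<Sum>j<M. singular_value T j powr q) \<le> (\<Sum>j<M. c j powr q)"
  proof (rule sum_mono)
    fix j assume "j \<in> {..<M}"
    then show "singular_value T j powr q \<le> c j powr q"
      using s[of j] q by (intro powr_mono2 singular_value_nonneg) auto
  qed
  then show "schatten_norm q T \<le> (\<Sum>j<M. c j powr q) powr (1/q)"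
    unfolding schatten_norm_def eq using q by (intro powr_mono2 sum_nonneg) auto
qed

lemma rank_leI:
  assumes "finite I" "card I \<le> j" "\<And>u. blinfun_apply R u = (\<Sum>i\<in>I. cscale (a u i) (e i))"
  shows "rank_le j R"
  unfolding rank_le_def
proof (intro exI conjI)
  show "finite (e ` I)" using assms by simp
  show "card (e ` I) \<le> j" using card_image_le[OF assms(1), of e] assms(2) by simp
  show "range (blinfun_apply R) \<subseteq> l2.span (e ` I)"
    by (auto simp: assms(3) intro!: l2.span_sum l2.span_scale intro: l2.span_base)
qed

lemma schatten_tensor:
  assumes f: "sq_integrable lborel_pos f" and g: "sq_integrable lborel_pos g" and q: "0 < q"
  shows "integral_operator (tensor f g) \<in> schatten q"
    "schatten_norm q (integral_operator (tensor f g)) \<le> norm (abs_l2 f) * norm (abs_l2 g)"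
proof -
  let ?T = "integral_operator (tensor f g)" and ?h = "abs_l2 (\<lambda>y. cnj (g y))"
  have op: "?T \<in> l2_ops" by (intro integral_operator_in_l2_ops sq_integrable_tensor f g)
  have T: "blinfun_apply ?T u = cscale (cip u ?h) (abs_l2 f)" for u
    using integral_operator_tensor[OF f sq_integrable_cnj[OF g]] by simp
  have "norm ?T \<le> norm (abs_l2 f) * norm (abs_l2 g)"
  proof (rule norm_blinfun_bound)
    fix u
    have "norm (blinfun_apply ?T u) \<le> (norm u * norm ?h) * norm (abs_l2 f)"
      unfolding T norm_cscale by (intro mult_right_mono cmod_cip_le) auto
    then show "norm (blinfun_apply ?T u) \<le> norm (abs_l2 f) * norm (abs_l2 g) * norm u"
      by (simp add: norm_abs_l2_cnj g mult_ac)
  qed auto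
  then have s0: "singular_value ?T 0 \<le> norm (abs_l2 f) * norm (abs_l2 g)"
    using singular_value_le[OF l2_ops_zero rank_le_zero, of ?T 0] by simp
  have "singular_value ?T j \<le> 0" if "j > 0" for j
  proof -
    have "rank_le j ?T"
      by (rule rank_leI[of "{()}" _ _ "\<lambda>u _. cip u ?h" "\<lambda>_. abs_l2 f"]) (use that T in auto)
    then show ?thesis using singular_value_le[OF op, of j ?T] by simp
  qed
  then have s: "singular_value ?T j \<le> (if j < 1 then norm (abs_l2 f) * norm (abs_l2 g) else 0)" for j
    using s0 by (cases "j = 0") auto
  show "?T \<in> schatten q" by (rule schatten_suminf_le(1)[OF op q s])
  show "schatten_norm q ?T \<le> norm (abs_l2 f) * norm (abs_l2 g)"
    using schatten_suminf_le(2)[OF op q s] q by (simp add: powr_powr)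
qed

definition diagonal_kernel ::
    "(nat \<Rightarrow> real) \<Rightarrow> (nat \<Rightarrow> real \<Rightarrow> complex) \<Rightarrow> (nat \<Rightarrow> real \<Rightarrow> complex) \<Rightarrow> nat set \<Rightarrow> real \<times> real \<Rightarrow> complex" where
  "diagonal_kernel c f g I z = (\<Sum>m\<in>I. complex_of_real (c m) * tensor (f m) (\<lambda>y. cnj (g m y)) z)"

lemma sq_integrable_diagonal_kernel:
  assumes "\<And>m. m \<in> I \<Longrightarrow> sq_integrable lborel_pos (f m)" "\<And>m. m \<in> I \<Longrightarrow> sq_integrable lborel_pos (g m)"
  shows "sq_integrable lborel_pos2 (diagonal_kernel c f g I)"
  unfolding diagonal_kernel_def[abs_def]
  by (intro sq_integrable_sum sq_integrable_mult sq_integrable_tensor sq_integrable_cnj assms)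

lemma integral_operator_diagonal_kernel:
  assumes f: "\<And>m. m \<in> I \<Longrightarrow> sq_integrable lborel_pos (f m)" and g: "\<And>m. m \<in> I \<Longrightarrow> sq_integrable lborel_pos (g m)"
  shows "integral_operator (diagonal_kernel c f g I) u =
    (\<Sum>m\<in>I. cscale (complex_of_real (c m) * cip u (abs_l2 (g m))) (abs_l2 (f m)))"
proof -
  have "integral_operator (diagonal_kernel c f g I) u =
     (\<Sum>m\<in>I. integral_operator (\<lambda>z. complex_of_real (c m) * tensor (f m) (\<lambda>y. cnj (g m y)) z) u)"
    unfolding diagonal_kernel_def[abs_def]
    by (subst integral_operator_sum, intro sq_integrable_mult sq_integrable_tensor sq_integrable_cnj f g)
      (simp_all add: blinfun.sum_left)
  also have "\<dots> = (\<Sum>m\<in>I. cscale (complex_of_real (c m) * cip u (abs_l2 (g m))) (abs_l2 (f m)))"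
  proof (rule sum.cong[OF refl])
    fix m assume m: "m \<in> I"
    have "(\<lambda>z. complex_of_real (c m) * tensor (f m) (\<lambda>y. cnj (g m y)) z) =
        tensor (\<lambda>x. complex_of_real (c m) * f m x) (\<lambda>y. cnj (g m y))"
      by (auto simp: tensor_def)
    then show "integral_operator (\<lambda>z. complex_of_real (c m) * tensor (f m) (\<lambda>y. cnj (g m y)) z) u =
       cscale (complex_of_real (c m) * cip u (abs_l2 (g m))) (abs_l2 (f m))"
      using integral_operator_tensor[of "\<lambda>x. complex_of_real (c m) * f m x" "g m" u] f[OF m] g[OF m]
      by (simp add: sq_integrable_mult mult.commute flip: cscale_abs)
  qed
  finally show ?thesis .
qed

lemma norm_diagonal_kernel_le:
  assumes I: "finite I" and f: "\<And>m. m \<in> I \<Longrightarrow> sq_integrable lborel_pos (f m)" and g: "\<And>m. m \<in> I \<Longrightarrow> sq_integrable lborel_pos (g m)"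
    and e: "orthonormal_on I (\<lambda>m. abs_l2 (f m))" and h: "orthonormal_on I (\<lambda>m. abs_l2 (g m))"
    and c: "\<And>m. m \<in> I \<Longrightarrow> \<bar>c m\<bar> \<le> B" and B: "0 \<le> B"
  shows "norm (integral_operator (diagonal_kernel c f g I)) \<le> B"
proof (rule norm_blinfun_bound[OF B])
  fix u
  let ?T = "integral_operator (diagonal_kernel c f g I)"
  have "?T u = (\<Sum>m\<in>I. cscale (complex_of_real (c m) * cip u (abs_l2 (g m))) (abs_l2 (f m)))"
    by (rule integral_operator_diagonal_kernel) (fact f, fact g)
  then have "(norm (?T u))\<^sup>2 = (\<Sum>m\<in>I. (cmod (complex_of_real (c m) * cip u (abs_l2 (g m))))\<^sup>2)"
    by (simp only: norm_orthonormal_sum[OF I e])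
  also have "\<dots> \<le> (\<Sum>m\<in>I. B\<^sup>2 * (cmod (cip u (abs_l2 (g m))))\<^sup>2)"
    unfolding norm_mult power_mult_distrib
    by (intro sum_mono mult_right_mono power_mono) (use c in auto)
  also have "\<dots> \<le> B\<^sup>2 * (norm u)\<^sup>2"
    unfolding sum_distrib_left[symmetric] by (intro mult_left_mono Bessel[OF I h]) auto
  finally show "norm (?T u) \<le> B * norm u"
    unfolding power_mult_distrib[symmetric] by (rule power2_le_imp_le) (use B in auto)
qed

text \<open>Dropping the first \<open>j\<close> terms, which have rank at most \<open>j\<close>, leaves a diagonal operator of norm at most
\<open>c j\<close>, because \<open>c\<close> decreases.\<close>

lemma schatten_diagonal_kernel:
  assumes f: "\<And>m. m \<in> {..<M} \<Longrightarrow> sq_integrable lborel_pos (f m)" and g: "\<And>m. m \<in> {..<M} \<Longrightarrow> sq_integrable lborel_pos (g m)"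
    and e: "orthonormal_on {..<M} (\<lambda>m. abs_l2 (f m))" and h: "orthonormal_on {..<M} (\<lambda>m. abs_l2 (g m))"
    and c: "\<And>m. 0 \<le> c m" "\<And>i j. i \<le> j \<Longrightarrow> c j \<le> c i" and q: "0 < q"
  shows "integral_operator (diagonal_kernel c f g {..<M}) \<in> schatten q"
    "schatten_norm q (integral_operator (diagonal_kernel c f g {..<M})) \<le> (\<Sum>m<M. c m powr q) powr (1/q)"
proof -
  let ?T = "\<lambda>I. integral_operator (diagonal_kernel c f g I)"
  have sq: "sq_integrable lborel_pos2 (diagonal_kernel c f g I)" if "I \<subseteq> {..<M}" for I
    by (rule sq_integrable_diagonal_kernel) (use f g that in auto)
  have op: "?T I \<in> l2_ops" if "I \<subseteq> {..<M}" for I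
    by (intro integral_operator_in_l2_ops sq that)
  have s: "singular_value (?T {..<M}) j \<le> (if j < M then c j else 0)" for j
  proof -
    define L where "L = {..<M} \<inter> {..<j}"
    define U where "U = {..<M} \<inter> {j..}"
    have LU: "L \<subseteq> {..<M}" "U \<subseteq> {..<M}" "{..<M} = L \<union> U" "L \<inter> U = {}" by (auto simp: L_def U_def)
    have fin: "finite L" "finite U" by (auto simp: L_def U_def)
    have "diagonal_kernel c f g {..<M} = (\<lambda>z. diagonal_kernel c f g L z + diagonal_kernel c f g U z)"
      unfolding diagonal_kernel_def[abs_def] LU(3) using fin LU(4) by (simp add: sum.union_disjoint)
    then have "?T {..<M} = ?T L + ?T U"
      using integral_operator_add[OF sq[OF LU(1)] sq[OF LU(2)]] by simp
    then have eq: "?T {..<M} - ?T L = ?T U" by simp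
    have r: "rank_le j (?T L)"
    proof (rule rank_leI[OF fin(1)])
      show "card L \<le> j" using card_mono[of "{..<j}" L] by (auto simp: L_def)
      show "blinfun_apply (?T L) u = (\<Sum>m\<in>L. cscale (complex_of_real (c m) * cip u (abs_l2 (g m))) (abs_l2 (f m)))" for u
        by (rule integral_operator_diagonal_kernel) (use f g LU in auto)
    qed
    have "singular_value (?T {..<M}) j \<le> norm (?T {..<M} - ?T L)"
      by (rule singular_value_le[OF op[OF LU(1)] r])
    also have "\<dots> \<le> (if j < M then c j else 0)"
      unfolding eq
    proof (rule norm_diagonal_kernel_le[OF fin(2)])
      show "orthonormal_on U (\<lambda>m. abs_l2 (f m))" "orthonormal_on U (\<lambda>m. abs_l2 (g m))"
        using e h LU(2) orthonormal_on_subset by blast+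
      show "\<bar>c m\<bar> \<le> (if j < M then c j else 0)" if "m \<in> U" for m
        using that c(1)[of m] c(2)[of j m] by (auto simp: U_def)
    qed (use f g LU c in auto)
    finally show ?thesis .
  qed
  show "?T {..<M} \<in> schatten q" by (rule schatten_suminf_le(1)[OF op q s]) simp
  show "schatten_norm q (?T {..<M}) \<le> (\<Sum>m<M. c m powr q) powr (1/q)"
    by (rule schatten_suminf_le(2)[OF op q s]) simp
qed

section \<open>Diagonal matrices inside an operator\<close>

text \<open>Index \<open>0\<close> is left out because the dyadic blocks of indices \<open>{2^n..<2^Suc n}\<close> start at \<open>1\<close>.\<close>

definition test_sets :: "(nat \<Rightarrow> real set) \<Rightarrow> bool" where
  "test_sets J \<longleftrightarrow> (\<forall>m\<ge>1. J m \<in> sets lborel_pos \<and> emeasure lborel_pos (J m) < \<infinity> \<and> 0 < measure lborel_pos (J m)) \<and>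
     disjoint_family_on J {1..}"

definition unit_indicator :: "real set \<Rightarrow> real \<Rightarrow> complex" where
  "unit_indicator A x = complex_of_real (1 / sqrt (measure lborel_pos A)) * indicator A x"

lemma cnj_unit_indicator [simp]: "cnj (unit_indicator A x) = unit_indicator A x"
  by (simp add: unit_indicator_def indicator_def)

lemma sq_integrable_unit_indicator:
  "A \<in> sets lborel_pos \<Longrightarrow> emeasure lborel_pos A < \<infinity> \<Longrightarrow> sq_integrable lborel_pos (unit_indicator A)"
  unfolding unit_indicator_def[abs_def] by (intro sq_integrable_mult sq_integrable_indicator)

lemma sq_integrable_test:
  "test_sets J \<Longrightarrow> 1 \<le> m \<Longrightarrow> sq_integrable lborel_pos (unit_indicator (J m))"
  by (intro sq_integrable_unit_indicator) (auto simp: test_sets_def)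

lemma orthonormal_test_sets:
  assumes J: "test_sets J" and I: "I \<subseteq> {1..}"
  shows "orthonormal_on I (\<lambda>m. abs_l2 (unit_indicator (J m)))"
  unfolding orthonormal_on_def
proof (intro ballI)
  fix i j assume ij: "i \<in> I" "j \<in> I"
  then have 1: "1 \<le> i" "1 \<le> j" using I by auto
  have Ji: "J i \<in> sets lborel_pos" "emeasure lborel_pos (J i) < \<infinity>" "0 < measure lborel_pos (J i)"
    using J 1 by (auto simp: test_sets_def)
  have eq: "cip (abs_l2 (unit_indicator (J i))) (abs_l2 (unit_indicator (J j))) =
     (LINT x|lborel_pos. unit_indicator (J i) x * unit_indicator (J j) x)"
    using cip_abs[OF sq_integrable_test[OF J 1(1)] sq_integrable_test[OF J 1(2)]] by simp
  show "cip (abs_l2 (unit_indicator (J i))) (abs_l2 (unit_indicator (J j))) = of_bool (i = j)"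
  proof (cases "i = j")
    case False
    then have "J i \<inter> J j = {}" using J 1 by (auto simp: test_sets_def disjoint_family_on_def)
    then have "(\<lambda>x. unit_indicator (J i) x * unit_indicator (J j) x) = (\<lambda>_. 0)"
      by (auto simp: unit_indicator_def indicator_def fun_eq_iff)
    then show ?thesis using False unfolding eq by simp
  next
    case True
    have "(\<lambda>x. unit_indicator (J i) x * unit_indicator (J i) x) =
        (\<lambda>x. complex_of_real (1 / measure lborel_pos (J i) * indicator (J i) x))"
    proof
      fix x
      have "complex_of_real (sqrt (measure lborel_pos (J i))) * complex_of_real (sqrt (measure lborel_pos (J i))) =
         complex_of_real (measure lborel_pos (J i))"
        using Ji(3) by (simp flip: of_real_mult)
      then show "unit_indicator (J i) x * unit_indicator (J i) x =
        complex_of_real (1 / measure lborel_pos (J i) * indicator (J i) x)"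
        by (simp add: unit_indicator_def indicator_def)
    qed
    moreover have "J i \<inter> space lborel_pos = J i"
      using Ji(1) sets.sets_into_space by blast
    ultimately show ?thesis using True Ji(2,3) unfolding eq
      by (simp only: integral_complex_of_real) simp
  qed
qed

lemma cip_integral_operator_unit_indicator:
  assumes h: "sq_integrable lborel_pos2 h" and J: "test_sets J" "1 \<le> i" and K: "test_sets K" "1 \<le> l"
  shows "cip (integral_operator h (abs_l2 (unit_indicator (K l)))) (abs_l2 (unit_indicator (J i))) =
    block h (J i) (K l) / complex_of_real (sqrt (measure lborel_pos (J i) * measure lborel_pos (K l)))"
proof -
  have "cip (integral_operator h (abs_l2 (unit_indicator (K l)))) (abs_l2 (unit_indicator (J i))) =
      (LINT z|lborel_pos2. h z * tensor (unit_indicator (J i)) (unit_indicator (K l)) z)"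
    using cip_integral_operator[OF h sq_integrable_test[OF K] sq_integrable_test[OF J]] by simp
  also have "\<dots> = (LINT z|lborel_pos2. (h z * tensor (indicator (J i)) (indicator (K l)) z) /
      complex_of_real (sqrt (measure lborel_pos (J i) * measure lborel_pos (K l))))"
    by (intro Bochner_Integration.integral_cong refl)
      (auto simp: tensor_def unit_indicator_def real_sqrt_mult)
  finally show ?thesis by (simp add: block_def)
qed

text \<open>In the orthonormal systems of normalised indicators of the sets \<open>J m\<close> and \<open>K m\<close>, with \<open>m\<close> in the
\<open>n\<close>-th dyadic block, \<open>h\<close> has a diagonal matrix whose entries have real part at least \<open>d\<close>. Nothing is
said about entries between different blocks.\<close>

definition scale_diagonal ::
    "(real \<times> real \<Rightarrow> complex) \<Rightarrow> (nat \<Rightarrow> real set) \<Rightarrow> (nat \<Rightarrow> real set) \<Rightarrow> nat \<Rightarrow> real \<Rightarrow> bool" where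
  "scale_diagonal h J K n d \<longleftrightarrow>
     (\<forall>m\<in>{2^n..<2^Suc n}. d * sqrt (measure lborel_pos (J m) * measure lborel_pos (K m)) \<le> Re (block h (J m) (K m)) \<and>
        (\<forall>m'\<in>{2^n..<2^Suc n}. m \<noteq> m' \<longrightarrow> block h (J m) (K m') = 0))"

lemma singular_value_ge_scale_diagonal:
  assumes h: "sq_integrable lborel_pos2 h" and J: "test_sets J" and K: "test_sets K"
    and d: "scale_diagonal h J K n d" and j: "j < 2^n"
  shows "d \<le> singular_value (integral_operator h) j"
proof (rule singular_value_ge[where I = "{2^n..<2^Suc n}" and e = "\<lambda>m. abs_l2 (unit_indicator (K m))"
      and h = "\<lambda>m. abs_l2 (unit_indicator (J m))"])
  have pos: "1 \<le> m" if "m \<in> {2^n..<2^Suc n}" for m :: nat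
    using that one_le_power[of "2::nat" n] by (simp only: atLeastLessThan_iff) linarith
  then have sub: "{2^n..<2^Suc n} \<subseteq> {1::nat..}" by auto
  show "orthonormal_on {2^n..<2^Suc n} (\<lambda>m. abs_l2 (unit_indicator (K m)))"
    "orthonormal_on {2^n..<2^Suc n} (\<lambda>m. abs_l2 (unit_indicator (J m)))"
    by (rule orthonormal_test_sets[OF _ sub], fact)+
  show "integral_operator h \<in> l2_ops" by (rule integral_operator_in_l2_ops[OF h])
  show "j < card {2^n..<(2::nat)^Suc n}" using j by simp
  show "cip (integral_operator h (abs_l2 (unit_indicator (K i)))) (abs_l2 (unit_indicator (J l))) = 0"
    if "i \<in> {2^n..<2^Suc n}" "l \<in> {2^n..<2^Suc n}" "i \<noteq> l" for i l
    using that d pos by (simp add: cip_integral_operator_unit_indicator[OF h J _ K] scale_diagonal_def del: power_Suc)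
  show "d \<le> Re (cip (integral_operator h (abs_l2 (unit_indicator (K i)))) (abs_l2 (unit_indicator (J i))))"
    if i: "i \<in> {2^n..<2^Suc n}" for i
  proof -
    have "0 < measure lborel_pos (J i) * measure lborel_pos (K i)"
      using J K pos[OF i] by (auto simp: test_sets_def)
    then show ?thesis
      using i d pos[OF i]
      by (simp add: cip_integral_operator_unit_indicator[OF h J _ K] scale_diagonal_def pos_le_divide_eq
          Re_divide_of_real del: power_Suc)
  qed
qed simp

section \<open>Boxes on dyadic scales\<close>

text \<open>The levels used at scale \<open>n\<close> start at \<open>T = peak n\<close>. The factor \<open>8\<close> leaves room for the \<open>u\<close>-sides of the
\<open>2^n\<close> boxes of that scale between \<open>T/4\<close> and \<open>T/2\<close>, with spacing \<open>2\<close>.\<close>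

definition peak :: "nat \<Rightarrow> real" where "peak n = 8 * 2^n"

text \<open>The boxes \<open>left_test \<alpha> m \<times> right_test \<beta> m\<close> lie across the line \<open>u + v = T + 1/2\<close>. The spacing \<open>2\<close> in
\<open>u\<close> and in \<open>v\<close> is the width of the bumps of the symbol, which decouples different boxes of a
scale; and all \<open>u\<close>-sides, as well as all \<open>v\<close>-sides, are disjoint even across scales.\<close>

definition left_test :: "real \<Rightarrow> nat \<Rightarrow> real set" where
  "left_test \<alpha> m = powr_vimage \<alpha> {2 * real m<..<2 * real m + 1/8}"

definition right_test :: "real \<Rightarrow> nat \<Rightarrow> real set" where
  "right_test \<beta> m = powr_vimage \<beta>
     {peak (floor_log m) - 2 * real m + 3/8<..<peak (floor_log m) - 2 * real m + 1/2}"

lemma dyadic_bounds: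
  assumes "m \<in> {2^n..<2^Suc n}"
  shows "2^n \<le> real m" "real m + 1 \<le> 2 * 2^n" "floor_log m = n" "1 \<le> m"
proof -
  have m: "2^n \<le> m" "m + 1 \<le> 2 * 2^n" using assms by auto
  have "real (2^n) \<le> real m" using m(1) by (rule of_nat_mono)
  then show "2^n \<le> real m" by simp
  have "real (m + 1) \<le> real (2 * 2^n)" using m(2) by (rule of_nat_mono)
  then show "real m + 1 \<le> 2 * 2^n" by simp
  show "floor_log m = n" using m by (intro floor_log_eqI) auto
  show "1 \<le> m" using m(1) one_le_power[of "2::nat" n] by linarith
qed

lemma dyadic_floor_log: "1 \<le> m \<Longrightarrow> m \<in> {2^floor_log m..<2^Suc (floor_log m)}"
  using floor_log_exp2_le[of m] floor_log_exp2_gt[of m] by simp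

lemma measure_powr_vimage_interval:
  assumes \<beta>: "0 < \<beta>"
  obtains \<kappa> K where "0 < \<kappa>" "0 < K"
    "\<And>T p l. 0 < T \<Longrightarrow> T/4 \<le> p \<Longrightarrow> 0 \<le> l \<Longrightarrow> p + l \<le> 2*T \<Longrightarrow>
       emeasure lborel_pos (powr_vimage \<beta> {p<..<p+l}) < \<infinity> \<and>
       \<kappa> * T powr (1/\<beta> - 1) * l \<le> measure lborel_pos (powr_vimage \<beta> {p<..<p+l}) \<and>
       measure lborel_pos (powr_vimage \<beta> {p<..<p+l}) \<le> K * T powr (1/\<beta> - 1) * l"
proof -
  obtain \<kappa> where \<kappa>: "0 < \<kappa>" "\<And>T S. 0 < T \<Longrightarrow> S \<in> sets borel \<Longrightarrow> S \<subseteq> {T/4..2*T} \<Longrightarrow>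
       ennreal (\<kappa> * T powr (1/\<beta> - 1)) * emeasure lborel S \<le> emeasure lborel_pos (powr_vimage \<beta> S)"
    by (rule emeasure_powr_vimage_ge[OF \<beta>]) (rule that)
  obtain K where K: "0 < K" "\<And>T S. 0 < T \<Longrightarrow> S \<in> sets borel \<Longrightarrow> S \<subseteq> {T/4..2*T} \<Longrightarrow>
       emeasure lborel_pos (powr_vimage \<beta> S) \<le> ennreal (K * T powr (1/\<beta> - 1)) * emeasure lborel S"
    by (rule emeasure_powr_vimage_le[OF \<beta>]) (rule that)
  show ?thesis
  proof (rule that[OF \<kappa>(1) K(1)])
    fix T p l :: real assume *: "0 < T" "T/4 \<le> p" "0 \<le> l" "p + l \<le> 2*T"
    let ?A = "powr_vimage \<beta> {p<..<p+l}"
    have sub: "{p<..<p+l} \<subseteq> {T/4..2*T}" using * by auto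
    have le: "emeasure lborel_pos ?A \<le> ennreal (K * T powr (1/\<beta> - 1) * l)"
      using K(2)[OF *(1) _ sub] * K(1) by (simp add: ennreal_mult)
    then have fin: "emeasure lborel_pos ?A < \<infinity>" using le_less_trans ennreal_less_top by fastforce
    then have e: "emeasure lborel_pos ?A = ennreal (measure lborel_pos ?A)"
      by (intro emeasure_eq_ennreal_measure) auto
    have ge: "ennreal (\<kappa> * T powr (1/\<beta> - 1) * l) \<le> emeasure lborel_pos ?A"
      using \<kappa>(2)[OF *(1) _ sub] * \<kappa>(1) by (simp add: ennreal_mult)
    show "emeasure lborel_pos ?A < \<infinity> \<and> \<kappa> * T powr (1/\<beta> - 1) * l \<le> measure lborel_pos ?A \<and>
       measure lborel_pos ?A \<le> K * T powr (1/\<beta> - 1) * l"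
      using fin le ge K(1) * unfolding e by (simp add: ennreal_le_iff)
  qed
qed

lemma test_sets_powr_vimage:
  assumes \<beta>: "0 < \<beta>" and l: "0 < l" and T: "\<And>m. 1 \<le> m \<Longrightarrow> 0 < T m \<and> T m / 4 \<le> p m \<and> p m + l \<le> 2 * T m"
    and disj: "\<And>i j. 1 \<le> i \<Longrightarrow> i < j \<Longrightarrow> {p i<..<p i + l} \<inter> {p j<..<p j + l} = {}"
  shows "test_sets (\<lambda>m. powr_vimage \<beta> {p m<..<p m + l})"
proof -
  obtain \<kappa> K where k: "0 < \<kappa>" "0 < K"
    "\<And>T p l. 0 < T \<Longrightarrow> T/4 \<le> p \<Longrightarrow> 0 \<le> l \<Longrightarrow> p + l \<le> 2*T \<Longrightarrow>
       emeasure lborel_pos (powr_vimage \<beta> {p<..<p+l}) < \<infinity> \<and>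
       \<kappa> * T powr (1/\<beta> - 1) * l \<le> measure lborel_pos (powr_vimage \<beta> {p<..<p+l}) \<and>
       measure lborel_pos (powr_vimage \<beta> {p<..<p+l}) \<le> K * T powr (1/\<beta> - 1) * l"
    by (rule measure_powr_vimage_interval[OF \<beta>]) (rule that)
  show ?thesis unfolding test_sets_def
  proof (intro conjI allI impI)
    fix m :: nat assume m: "1 \<le> m"
    show "powr_vimage \<beta> {p m<..<p m + l} \<in> sets lborel_pos" by (rule powr_vimage_sets) simp
    show "emeasure lborel_pos (powr_vimage \<beta> {p m<..<p m + l}) < \<infinity>"
      using k(3)[of "T m" "p m" l] T[OF m] l by simp
    have "0 < \<kappa> * T m powr (1/\<beta> - 1) * l" using k T[OF m] l by simp
    then show "0 < measure lborel_pos (powr_vimage \<beta> {p m<..<p m + l})"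
      using k(3)[of "T m" "p m" l] T[OF m] l by linarith
  next
    show "disjoint_family_on (\<lambda>m. powr_vimage \<beta> {p m<..<p m + l}) {1..}"
      unfolding disjoint_family_on_def
    proof (intro ballI impI)
      fix i j :: nat assume ij: "i \<in> {1..}" "j \<in> {1..}" "i \<noteq> j"
      have "{p i<..<p i + l} \<inter> {p j<..<p j + l} = {}"
        using disj[of i j] disj[of j i] ij by (cases "i < j") auto
      then show "powr_vimage \<beta> {p i<..<p i + l} \<inter> powr_vimage \<beta> {p j<..<p j + l} = {}"
        unfolding powr_vimage_def by blast
    qed
  qed
qed

lemma test_sets_left: "0 < \<alpha> \<Longrightarrow> test_sets (left_test \<alpha>)"
  unfolding left_test_def[abs_def]
  by (rule test_sets_powr_vimage[where T = "\<lambda>m. 2 * real m"]) auto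

lemma test_sets_right:
  assumes "0 < \<beta>"
  shows "test_sets (right_test \<beta>)"
proof -
  have "test_sets (\<lambda>m. powr_vimage \<beta> {(peak (floor_log m) - 2 * real m + 3/8)<..<(peak (floor_log m) - 2 * real m + 3/8) + 1/8})"
  proof (rule test_sets_powr_vimage[where T = "\<lambda>m. peak (floor_log m)"])
    fix m :: nat assume m: "1 \<le> m"
    note b = dyadic_bounds[OF dyadic_floor_log[OF m]]
    have "1 \<le> (2::real) ^ floor_log m" by simp
    then show "0 < peak (floor_log m) \<and> peak (floor_log m) / 4 \<le> peak (floor_log m) - 2 * real m + 3/8 \<and>
        peak (floor_log m) - 2 * real m + 3/8 + 1/8 \<le> 2 * peak (floor_log m)"
      using b(1,2) by (simp add: peak_def)
  next
    fix i j :: nat assume ij: "1 \<le> i" "i < j"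
    note bi = dyadic_bounds[OF dyadic_floor_log[OF ij(1)]]
    have "1 \<le> j" using ij by simp
    note bj = dyadic_bounds[OF dyadic_floor_log[OF this]]
    have "floor_log i \<le> floor_log j" using ij by (intro floor_log_le_iff) simp
    then consider "floor_log i = floor_log j" | "Suc (floor_log i) \<le> floor_log j" by linarith
    then show "{(peak (floor_log i) - 2 * real i + 3/8)<..<(peak (floor_log i) - 2 * real i + 3/8) + 1/8} \<inter>
        {(peak (floor_log j) - 2 * real j + 3/8)<..<(peak (floor_log j) - 2 * real j + 3/8) + 1/8} = {}"
    proof cases
      case 1
      have "real i + 1 \<le> real j" using ij by linarith
      then show ?thesis using 1 by auto
    next
      case 2
      have "(2::real) ^ Suc (floor_log i) \<le> 2 ^ floor_log j" by (rule power_increasing[OF 2]) simp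
      then have "peak (floor_log i) - 2 * real i + 3/8 + 1/8 < peak (floor_log j) - 2 * real j + 3/8"
        using bi(1,2) bj(1,2) by (simp add: peak_def)
      then show ?thesis by auto
    qed
  qed (use assms in auto)
  then show ?thesis by (simp add: right_test_def[abs_def] add.assoc)
qed

lemma level_test_bounds:
  assumes m: "m \<in> {2^n..<2^Suc n}" "m' \<in> {2^n..<2^Suc n}" and z: "z \<in> left_test \<alpha> m \<times> right_test \<beta> m'"
  shows "peak n + 2 * (real m - real m') + 3/8 < level \<alpha> \<beta> z" "level \<alpha> \<beta> z < peak n + 2 * (real m - real m') + 5/8"
  using z dyadic_bounds(3)[OF m(2)]
  by (auto simp: left_test_def right_test_def powr_vimage_def level_def)

text \<open>Within one scale, mixing the sides of two boxes shifts the level by a nonzero multiple of \<open>2\<close> of size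
less than \<open>2\<cdot>2^n\<close>. This leaves the interval \<open>(T, T + 2)\<close> without reaching the bumps at \<open>T/2\<close> and \<open>2 T\<close>.\<close>

lemma level_off_peaks:
  assumes m: "m \<in> {2^n..<2^Suc n}" "m' \<in> {2^n..<2^Suc n}" "m \<noteq> m'"
    and z: "z \<in> left_test \<alpha> m \<times> right_test \<beta> m'"
  shows "\<not> (peak l < level \<alpha> \<beta> z \<and> level \<alpha> \<beta> z < peak l + 2)"
proof
  assume l: "peak l < level \<alpha> \<beta> z \<and> level \<alpha> \<beta> z < peak l + 2"
  note b = level_test_bounds[OF m(1,2) z]
  note d = dyadic_bounds(1,2)[OF m(1)] dyadic_bounds(1,2)[OF m(2)]
  consider "l < n" | "l = n" | "n < l" by linarith
  then show False
  proof cases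
    case 1
    have "(2::real) ^ Suc l \<le> 2 ^ n" by (rule power_increasing) (use 1 in auto)
    then show False using l b d by (simp add: peak_def)
  next
    case 2
    have "real m + 1 \<le> real m' \<or> real m' + 1 \<le> real m" using m(3) by linarith
    then show False using l b 2 by auto
  next
    case 3
    have "(2::real) ^ Suc n \<le> 2 ^ l" by (rule power_increasing) (use 3 in auto)
    then show False using l b d by (simp add: peak_def)
  qed
qed

text \<open>The sides of a box have lengths of order \<open>T\<^bsup>1/\<alpha> - 1\<^esup>\<close> and \<open>T\<^bsup>1/\<beta> - 1\<^esup>\<close>. The diagonal entry is the bound
for the symbol times the square root of their product, and off the diagonal the symbol vanishes on the
boxes.\<close>

lemma scale_diagonal_hankel:
  assumes \<alpha>: "0 < \<alpha>" and \<beta>: "0 < \<beta>"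
  obtains c where "0 < c"
    "\<And>n R f g \<phi>0 \<gamma> m \<phi>. rank_one_data \<alpha> \<beta> (peak n) R f g \<phi>0 \<gamma> m \<Longrightarrow>
       (\<forall>z\<in>space lborel_pos2. f (fst z) * g (snd z) \<noteq> 0 \<longrightarrow> (\<exists>l. peak l < level \<alpha> \<beta> z \<and> level \<alpha> \<beta> z < peak l + 2)) \<Longrightarrow>
       hankel_projection \<alpha> \<beta> (tensor (\<lambda>x. complex_of_real (f x)) (\<lambda>y. complex_of_real (g y))) \<phi> \<Longrightarrow>
       scale_diagonal (hankel_kernel \<alpha> \<beta> \<phi>) (left_test \<alpha>) (right_test \<beta>) n
         (c * (\<phi>0 * \<gamma> * m * peak n powr ((1/\<beta> - 1/\<alpha>)/2 - 1)))"
proof -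
  obtain c where c: "0 < c"
    "\<And>T R f g \<phi>0 \<gamma> m \<phi>. 1 \<le> T \<Longrightarrow> rank_one_data \<alpha> \<beta> T R f g \<phi>0 \<gamma> m \<Longrightarrow>
       hankel_projection \<alpha> \<beta> (tensor (\<lambda>x. complex_of_real (f x)) (\<lambda>y. complex_of_real (g y))) \<phi> \<Longrightarrow>
       AE z in lborel_pos2. T + 1/4 < level \<alpha> \<beta> z \<and> level \<alpha> \<beta> z < T + 1 \<longrightarrow>
         c * \<phi>0 * \<gamma> * m * T powr (- 1/\<alpha>) \<le> Re (hankel_kernel \<alpha> \<beta> \<phi> z)"
    by (rule symbol_lower_bound[OF \<alpha> \<beta>]) (rule that)
  obtain ka Ka where ka: "0 < ka" "0 < Ka"
    "\<And>T p l. 0 < T \<Longrightarrow> T/4 \<le> p \<Longrightarrow> 0 \<le> l \<Longrightarrow> p + l \<le> 2*T \<Longrightarrow>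
       emeasure lborel_pos (powr_vimage \<alpha> {p<..<p+l}) < \<infinity> \<and>
       ka * T powr (1/\<alpha> - 1) * l \<le> measure lborel_pos (powr_vimage \<alpha> {p<..<p+l}) \<and>
       measure lborel_pos (powr_vimage \<alpha> {p<..<p+l}) \<le> Ka * T powr (1/\<alpha> - 1) * l"
    by (rule measure_powr_vimage_interval[OF \<alpha>]) (rule that)
  obtain kb Kb where kb: "0 < kb" "0 < Kb"
    "\<And>T p l. 0 < T \<Longrightarrow> T/4 \<le> p \<Longrightarrow> 0 \<le> l \<Longrightarrow> p + l \<le> 2*T \<Longrightarrow>
       emeasure lborel_pos (powr_vimage \<beta> {p<..<p+l}) < \<infinity> \<and>
       kb * T powr (1/\<beta> - 1) * l \<le> measure lborel_pos (powr_vimage \<beta> {p<..<p+l}) \<and>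
       measure lborel_pos (powr_vimage \<beta> {p<..<p+l}) \<le> Kb * T powr (1/\<beta> - 1) * l"
    by (rule measure_powr_vimage_interval[OF \<beta>]) (rule that)
  show ?thesis
  proof (rule that[of "c * (sqrt (ka * kb) / 8)"])
    show "0 < c * (sqrt (ka * kb) / 8)" using c ka kb by simp
    fix n R and f g :: "real \<Rightarrow> real" and \<phi>0 \<gamma> m \<phi>
    assume D: "rank_one_data \<alpha> \<beta> (peak n) R f g \<phi>0 \<gamma> m"
      and supp: "\<forall>z\<in>space lborel_pos2. f (fst z) * g (snd z) \<noteq> 0 \<longrightarrow> (\<exists>l. peak l < level \<alpha> \<beta> z \<and> level \<alpha> \<beta> z < peak l + 2)"
      and P: "hankel_projection \<alpha> \<beta> (tensor (\<lambda>x. complex_of_real (f x)) (\<lambda>y. complex_of_real (g y))) \<phi>"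
    let ?h = "hankel_kernel \<alpha> \<beta> \<phi>" and ?T = "peak n"
    have f: "sq_integrable lborel_pos (\<lambda>x. complex_of_real (f x))"
      and g: "sq_integrable lborel_pos (\<lambda>y. complex_of_real (g y))"
      and nn: "0 \<le> \<phi>0" "0 \<le> \<gamma>" "0 \<le> m"
      using D unfolding rank_one_data_def by blast+
    have h: "sq_integrable lborel_pos2 ?h" using P by (simp add: hankel_projection_def)
    have T: "8 \<le> ?T" by (simp add: peak_def)
    define d where "d = c * \<phi>0 * \<gamma> * m * ?T powr (- 1/\<alpha>)"
    have d0: "0 \<le> d" using c nn by (simp add: d_def)
    have low: "AE z in lborel_pos2. ?T + 1/4 < level \<alpha> \<beta> z \<and> level \<alpha> \<beta> z < ?T + 1 \<longrightarrow> d \<le> Re (?h z)"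
      unfolding d_def by (rule c(2)[OF _ D P]) (use T in simp)
    \<comment> \<open>Outside these intervals no level line meets the support of the kernel, so the symbol vanishes.\<close>
    define S where "S = - (\<Union>l. {peak l<..<peak l + 2})"
    have van: "AE z in lborel_pos2. level \<alpha> \<beta> z \<in> S \<longrightarrow> ?h z = 0"
    proof (rule hankel_projection_vanishes[OF sq_integrable_tensor[OF f g] P])
      show "S \<in> sets borel" unfolding S_def by simp
      fix z assume z: "z \<in> space lborel_pos2" "level \<alpha> \<beta> z \<in> S"
      then have "f (fst z) * g (snd z) = 0" using supp by (fastforce simp: S_def)
      then show "tensor (\<lambda>x. complex_of_real (f x)) (\<lambda>y. complex_of_real (g y)) z = 0"
        by (auto simp: tensor_def split: prod.splits)
    qed
    show "scale_diagonal ?h (left_test \<alpha>) (right_test \<beta>) n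
         (c * (sqrt (ka * kb) / 8) * (\<phi>0 * \<gamma> * m * ?T powr ((1/\<beta> - 1/\<alpha>)/2 - 1)))"
      unfolding scale_diagonal_def
    proof (intro ballI conjI impI)
      fix i :: nat assume i: "i \<in> {2^n..<2^Suc n}"
      note bi = dyadic_bounds[OF i]
      define a b where "a = measure lborel_pos (left_test \<alpha> i)" and "b = measure lborel_pos (right_test \<beta> i)"
      have J: "left_test \<alpha> i \<in> sets lborel_pos" "emeasure lborel_pos (left_test \<alpha> i) < \<infinity>" "0 < a"
        using test_sets_left[OF \<alpha>] bi(4) by (auto simp: test_sets_def a_def)
      have K: "right_test \<beta> i \<in> sets lborel_pos" "emeasure lborel_pos (right_test \<beta> i) < \<infinity>" "0 < b"
        using test_sets_right[OF \<beta>] bi(4) by (auto simp: test_sets_def b_def)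
      have e1: "d * (a * b) \<le> Re (block ?h (left_test \<alpha> i) (right_test \<beta> i))"
        unfolding a_def b_def
      proof (rule block_ge[OF h J(1,2) K(1,2)])
        show "AE z in lborel_pos2. z \<in> left_test \<alpha> i \<times> right_test \<beta> i \<longrightarrow> d \<le> Re (?h z)"
          using low by eventually_elim (use level_test_bounds[OF i i] in fastforce)
      qed
      have "(sqrt (ka * kb) / 8) * ?T powr ((1/\<alpha> + 1/\<beta>)/2 - 1) \<le> sqrt (a * b)"
      proof (rule real_le_rsqrt)
        have "?T / 4 \<le> 2 * real i" "2 * real i + 1/8 \<le> 2 * ?T" "0 < ?T" using bi T by (auto simp: peak_def)
        then have a: "ka * ?T powr (1/\<alpha> - 1) / 8 \<le> a"
          using ka(3)[of ?T "2 * real i" "1/8"] by (simp add: a_def left_test_def)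
        have "?T / 4 \<le> ?T - 2 * real i + 3/8" "?T - 2 * real i + 1/2 \<le> 2 * ?T" "0 < ?T" using bi T by (auto simp: peak_def)
        then have b: "kb * ?T powr (1/\<beta> - 1) / 8 \<le> b"
        proof -
          assume "?T / 4 \<le> ?T - 2 * real i + 3/8" "?T - 2 * real i + 1/2 \<le> 2 * ?T" "0 < ?T"
          then have "kb * ?T powr (1/\<beta> - 1) * (1/8) \<le>
              measure lborel_pos (powr_vimage \<beta> {?T - 2 * real i + 3/8<..<?T - 2 * real i + 3/8 + 1/8})"
            using kb(3)[of ?T "?T - 2 * real i + 3/8" "1/8"] by auto
          also have "{?T - 2 * real i + 3/8<..<?T - 2 * real i + 3/8 + 1/8} = {?T - 2 * real i + 3/8<..<?T - 2 * real i + 1/2}"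
            by (rule arg_cong2[where f = greaterThanLessThan]) auto
          finally show ?thesis by (simp add: b_def right_test_def bi(3))
        qed
        have "((1/\<alpha> + 1/\<beta>)/2 - 1) + ((1/\<alpha> + 1/\<beta>)/2 - 1) = (1/\<alpha> - 1) + (1/\<beta> - 1)"
        proof -
          have "((x + y)/2 - 1) + ((x + y)/2 - 1) = (x - 1) + (y - 1)" for x y :: real by (simp add: field_simps)
          then show ?thesis .
        qed
        then have "(?T powr ((1/\<alpha> + 1/\<beta>)/2 - 1))\<^sup>2 = ?T powr (1/\<alpha> - 1) * ?T powr (1/\<beta> - 1)"
          unfolding power2_eq_square powr_add[symmetric] by (simp only:)
        then have "(sqrt (ka * kb) / 8 * ?T powr ((1/\<alpha> + 1/\<beta>)/2 - 1))\<^sup>2 =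
            (ka * ?T powr (1/\<alpha> - 1) / 8) * (kb * ?T powr (1/\<beta> - 1) / 8)"
          using ka kb by (simp add: power_mult_distrib power_divide)
        also have "\<dots> \<le> a * b" using a b ka kb J(3) by (intro mult_mono) auto
        finally show "(sqrt (ka * kb) / 8 * ?T powr ((1/\<alpha> + 1/\<beta>)/2 - 1))\<^sup>2 \<le> a * b" .
      qed
      then have e2: "d * ((sqrt (ka * kb) / 8) * ?T powr ((1/\<alpha> + 1/\<beta>)/2 - 1)) * sqrt (a * b) \<le> d * sqrt (a * b) * sqrt (a * b)"
        using d0 J(3) K(3) by (intro mult_right_mono mult_left_mono) auto
      have e3: "d * sqrt (a * b) * sqrt (a * b) = d * (a * b)" using J(3) K(3) by simp
      have e4: "d * ((sqrt (ka * kb) / 8) * ?T powr ((1/\<alpha> + 1/\<beta>)/2 - 1)) =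
         c * (sqrt (ka * kb) / 8) * (\<phi>0 * \<gamma> * m * ?T powr ((1/\<beta> - 1/\<alpha>)/2 - 1))"
      proof -
        have "- 1/\<alpha> + ((1/\<alpha> + 1/\<beta>)/2 - 1) = (1/\<beta> - 1/\<alpha>)/2 - 1"
        proof -
          have "- x + ((x + y)/2 - 1) = (y - x)/2 - 1" for x y :: real by (simp add: field_simps)
          from this[of "1/\<alpha>" "1/\<beta>"] show ?thesis by simp
        qed
        then have "?T powr (- 1/\<alpha>) * ?T powr ((1/\<alpha> + 1/\<beta>)/2 - 1) = ?T powr ((1/\<beta> - 1/\<alpha>)/2 - 1)"
          unfolding powr_add[symmetric] by (simp only:)
        then show ?thesis by (simp add: d_def mult_ac)
      qed
      show "c * (sqrt (ka * kb) / 8) * (\<phi>0 * \<gamma> * m * ?T powr ((1/\<beta> - 1/\<alpha>)/2 - 1)) *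
          sqrt (measure lborel_pos (left_test \<alpha> i) * measure lborel_pos (right_test \<beta> i))
        \<le> Re (block ?h (left_test \<alpha> i) (right_test \<beta> i))"
        unfolding a_def[symmetric] b_def[symmetric]
        by (rule order_trans[OF _ e1]) (use e2 in \<open>simp only: e3 e4\<close>)
    next
      fix i i' :: nat assume i: "i \<in> {2^n..<2^Suc n}" "i' \<in> {2^n..<2^Suc n}" "i \<noteq> i'"
      show "block ?h (left_test \<alpha> i) (right_test \<beta> i') = 0"
      proof (rule block_eq_0)
        show "AE z in lborel_pos2. z \<in> left_test \<alpha> i \<times> right_test \<beta> i' \<longrightarrow> ?h z = 0"
          using van by eventually_elim (use level_off_peaks[OF i] in \<open>fastforce simp: S_def\<close>)
      qed
    qed
  qed
qed

section \<open>Rank one kernels with large averages\<close>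

text \<open>For every \<open>N\<close> there is one rank one kernel whose average is large on \<open>N\<close> scales at once while its
norm is at most of the order of the square root of \<open>N\<close>.\<close>

definition scale_test ::
    "real \<Rightarrow> real \<Rightarrow> (nat \<Rightarrow> real set) \<Rightarrow> (nat \<Rightarrow> real set) \<Rightarrow> real \<Rightarrow> bool" where
  "scale_test \<alpha> \<beta> J K \<tau> \<longleftrightarrow> (\<exists>c>0. \<exists>C. \<forall>N. \<exists>f g.
     sq_integrable lborel_pos f \<and> sq_integrable lborel_pos g \<and>
     (norm (abs_l2 f) * norm (abs_l2 g))\<^sup>2 \<le> C * real N \<and>
     (\<forall>\<phi>. hankel_projection \<alpha> \<beta> (tensor f g) \<phi> \<longrightarrow>
        (\<forall>n<N. scale_diagonal (hankel_kernel \<alpha> \<beta> \<phi>) J K n (c * 2 powr (- (real n * \<tau>))))))"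

lemma powr_vimage_zero:
  assumes "0 < \<alpha>" "0 < c"
  shows "powr_vimage \<alpha> {0<..<c} = {0<..<c powr (1/\<alpha>)}"
proof -
  have "y powr \<alpha> < c \<longleftrightarrow> y < c powr (1/\<alpha>)" if "0 < y" for y
  proof
    assume "y powr \<alpha> < c"
    then have "(y powr \<alpha>) powr (1/\<alpha>) < c powr (1/\<alpha>)"
      using assms by (intro powr_less_mono2) auto
    then show "y < c powr (1/\<alpha>)" using that assms by (simp add: powr_powr)
  next
    assume "y < c powr (1/\<alpha>)"
    then have "y powr \<alpha> < (c powr (1/\<alpha>)) powr \<alpha>"
      using assms that by (intro powr_less_mono2) auto
    then show "y powr \<alpha> < c" using assms by (simp add: powr_powr)
  qed
  then show ?thesis by (auto simp: powr_vimage_def)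
qed

lemma emeasure_powr_vimage_zero:
  assumes "0 < \<alpha>" "0 < c"
  shows "emeasure lborel_pos (powr_vimage \<alpha> {0<..<c}) = ennreal (c powr (1/\<alpha>))"
  unfolding powr_vimage_zero[OF assms] by (subst emeasure_lborel_pos) auto

lemma norm_indicator_multiple:
  assumes "A \<in> sets lborel_pos" "emeasure lborel_pos A < \<infinity>"
  shows "sq_integrable lborel_pos (\<lambda>x. complex_of_real (c * indicator A x))"
    "(norm (abs_l2 (\<lambda>x. complex_of_real (c * indicator A x))))\<^sup>2 = c\<^sup>2 * measure lborel_pos A"
proof -
  have eq: "(\<lambda>x. complex_of_real (c * indicator A x)) = (\<lambda>x. complex_of_real c * indicator A x)"
    by (auto simp: indicator_def)
  show sq: "sq_integrable lborel_pos (\<lambda>x. complex_of_real (c * indicator A x))"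
    unfolding eq by (intro sq_integrable_mult sq_integrable_indicator assms)
  have "(\<lambda>x. (cmod (complex_of_real (c * indicator A x)))\<^sup>2) = (\<lambda>x. c\<^sup>2 * indicator A x)"
    by (auto simp: indicator_def)
  moreover have "A \<inter> space lborel_pos = A" using assms(1) sets.sets_into_space by blast
  ultimately show "(norm (abs_l2 (\<lambda>x. complex_of_real (c * indicator A x))))\<^sup>2 = c\<^sup>2 * measure lborel_pos A"
    unfolding norm_abs_l2[OF sq] by simp
qed

lemma peak_Suc_le: "n < l \<Longrightarrow> 2 * peak n \<le> peak l"
proof -
  assume "n < l"
  then have "(2::real) ^ Suc n \<le> 2 ^ l" by (intro power_increasing) auto
  then show ?thesis by (simp add: peak_def)
qed

lemma peak_ge: "8 \<le> peak n" by (simp add: peak_def)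

lemma peak_powr: "peak n powr x = 8 powr x * 2 powr (real n * x)"
  by (simp add: peak_def powr_mult powr_powr flip: powr_realpow)

text \<open>All scales share the factor \<open>f\<close>, the indicator of \<open>u < 1\<close>. The factor \<open>g\<close> sums the indicators of
\<open>T < v < T + 1\<close> over the scales, with weights \<open>T\<^bsup>(1 - 1/\<beta>)/2\<^esup>\<close> that give each a norm of order \<open>1\<close>. Being
disjoint, their squared norms add up.\<close>

lemma scale_test_hankel:
  assumes \<alpha>: "0 < \<alpha>" and \<beta>: "0 < \<beta>"
  shows "scale_test \<alpha> \<beta> (left_test \<alpha>) (right_test \<beta>) ((1 + 1/\<alpha>) / 2)"
proof -
  obtain c where c: "0 < c"
    "\<And>n R f g \<phi>0 \<gamma> m \<phi>. rank_one_data \<alpha> \<beta> (peak n) R f g \<phi>0 \<gamma> m \<Longrightarrow>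
       (\<forall>z\<in>space lborel_pos2. f (fst z) * g (snd z) \<noteq> 0 \<longrightarrow> (\<exists>l. peak l < level \<alpha> \<beta> z \<and> level \<alpha> \<beta> z < peak l + 2)) \<Longrightarrow>
       hankel_projection \<alpha> \<beta> (tensor (\<lambda>x. complex_of_real (f x)) (\<lambda>y. complex_of_real (g y))) \<phi> \<Longrightarrow>
       scale_diagonal (hankel_kernel \<alpha> \<beta> \<phi>) (left_test \<alpha>) (right_test \<beta>) n
         (c * (\<phi>0 * \<gamma> * m * peak n powr ((1/\<beta> - 1/\<alpha>)/2 - 1)))"
    by (rule scale_diagonal_hankel[OF \<alpha> \<beta>]) (rule that)
  obtain \<kappa> K where K: "0 < \<kappa>" "0 < K"
    "\<And>T p l. 0 < T \<Longrightarrow> T/4 \<le> p \<Longrightarrow> 0 \<le> l \<Longrightarrow> p + l \<le> 2*T \<Longrightarrow>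
       emeasure lborel_pos (powr_vimage \<beta> {p<..<p+l}) < \<infinity> \<and>
       \<kappa> * T powr (1/\<beta> - 1) * l \<le> measure lborel_pos (powr_vimage \<beta> {p<..<p+l}) \<and>
       measure lborel_pos (powr_vimage \<beta> {p<..<p+l}) \<le> K * T powr (1/\<beta> - 1) * l"
    by (rule measure_powr_vimage_interval[OF \<beta>]) (rule that)
  define m where "m = (1/4::real) powr (1/\<alpha>)"
  define F where "F = powr_vimage \<alpha> {0<..<1}"
  define G where "G n = powr_vimage \<beta> {peak n<..<peak n + 1}" for n
  define \<gamma> where "\<gamma> n = peak n powr ((1 - 1/\<beta>)/2)" for n
  have F: "F \<in> sets lborel_pos" "emeasure lborel_pos F < \<infinity>" "measure lborel_pos F = 1"
    using emeasure_powr_vimage_zero[OF \<alpha>, of 1] powr_vimage_sets[of "{0<..<1}" \<alpha>]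
    by (auto simp: F_def measure_def)
  have G: "G n \<in> sets lborel_pos" "emeasure lborel_pos (G n) < \<infinity>"
      "measure lborel_pos (G n) \<le> K * peak n powr (1/\<beta> - 1)" for n
    using K(3)[of "peak n" "peak n" 1] peak_ge[of n] powr_vimage_sets[of "{peak n<..<peak n + 1}" \<beta>]
    by (auto simp: G_def)
  have G_pos: "G n \<inter> {0<..} = G n" for n by (auto simp: G_def powr_vimage_def)
  have \<gamma>2: "(\<gamma> n)\<^sup>2 * measure lborel_pos (G n) \<le> K" for n
  proof -
    have "(\<gamma> n)\<^sup>2 * peak n powr (1/\<beta> - 1) = 1"
      using peak_ge[of n] by (simp add: \<gamma>_def power2_eq_square flip: powr_add)
    then have "(\<gamma> n)\<^sup>2 * (K * peak n powr (1/\<beta> - 1)) = K" by (simp add: mult.left_commute)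
    then show ?thesis using mult_left_mono[OF G(3)[of n] zero_le_power2[of "\<gamma> n"]] by linarith
  qed
  have disj: "n = l" if "y \<in> G n" "y \<in> G l" for y n l
    using that peak_Suc_le[of n l] peak_Suc_le[of l n] peak_ge[of n] peak_ge[of l]
    by (cases n l rule: linorder_cases) (auto simp: G_def powr_vimage_def)
  define d where "d = c * (m * 8 powr (- ((1 + 1/\<alpha>) / 2)))"
  have d: "0 < d" using c(1) by (simp add: d_def m_def)
  show ?thesis unfolding scale_test_def
  proof (rule exI[of _ d], rule conjI[OF d], rule exI[of _ K], rule allI)
    fix N :: nat
    define f :: "real \<Rightarrow> real" where "f x = 1 * indicator F x" for x
    define g :: "real \<Rightarrow> real" where "g y = (\<Sum>n<N. \<gamma> n * indicator (G n) y)" for y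
    have sf: "sq_integrable lborel_pos (\<lambda>x. complex_of_real (f x))"
      and nf: "(norm (abs_l2 (\<lambda>x. complex_of_real (f x))))\<^sup>2 = 1"
      unfolding f_def using norm_indicator_multiple[OF F(1,2), of 1] F(3) by simp_all
    have sg: "sq_integrable lborel_pos (\<lambda>x. complex_of_real (g x))"
      unfolding g_def of_real_sum by (intro sq_integrable_sum norm_indicator_multiple G)
    have g_at: "g y = \<gamma> n" if "n < N" "y \<in> G n" for n y
    proof -
      have "g y = (\<Sum>l<N. if l = n then \<gamma> n else 0)"
        unfolding g_def using that disj by (intro sum.cong) (auto simp: indicator_def)
      then show ?thesis using that by simp
    qed
    have g_off: "g y = 0" if "\<And>n. n < N \<Longrightarrow> y \<notin> G n" for y
      unfolding g_def using that by (intro sum.neutral) auto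
    have "(cmod (complex_of_real (g y)))\<^sup>2 = (\<Sum>n<N. (\<gamma> n)\<^sup>2 * indicator (G n) y)" for y
    proof (cases "\<exists>n<N. y \<in> G n")
      case True
      then obtain n where n: "n < N" "y \<in> G n" by blast
      have "(\<Sum>l<N. (\<gamma> l)\<^sup>2 * indicator (G l) y) = (\<Sum>l<N. if l = n then (\<gamma> n)\<^sup>2 else 0)"
        using n disj by (intro sum.cong) (auto simp: indicator_def)
      then show ?thesis using n g_at[OF n] by simp
    next
      case False
      then show ?thesis using g_off[of y] by (simp add: sum.neutral)
    qed
    then have "(norm (abs_l2 (\<lambda>x. complex_of_real (g x))))\<^sup>2 =
        (LINT y|lborel_pos. (\<Sum>n<N. (\<gamma> n)\<^sup>2 * indicator (G n) y))"
      unfolding norm_abs_l2[OF sg] by simp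
    also have "\<dots> = (\<Sum>n<N. (LINT y|lborel_pos. (\<gamma> n)\<^sup>2 * indicator (G n) y))"
      by (rule Bochner_Integration.integral_sum) (use G G_pos in \<open>simp add: integrable_indicator_iff\<close>)
    also have "\<dots> = (\<Sum>n<N. (\<gamma> n)\<^sup>2 * measure lborel_pos (G n))"
      by (simp add: G_pos)
    also have "\<dots> \<le> (\<Sum>n<N. K)" by (intro sum_mono \<gamma>2)
    finally have ng: "(norm (abs_l2 (\<lambda>x. complex_of_real (g x))))\<^sup>2 \<le> K * real N"
      by (simp add: mult.commute)
    show "\<exists>f g. sq_integrable lborel_pos f \<and> sq_integrable lborel_pos g \<and>
         (norm (abs_l2 f) * norm (abs_l2 g))\<^sup>2 \<le> K * real N \<and>
         (\<forall>\<phi>. hankel_projection \<alpha> \<beta> (tensor f g) \<phi> \<longrightarrow>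
            (\<forall>n<N. scale_diagonal (hankel_kernel \<alpha> \<beta> \<phi>) (left_test \<alpha>) (right_test \<beta>) n
               (d * 2 powr (- (real n * ((1 + 1/\<alpha>) / 2))))))"
    proof (intro exI conjI allI impI)
      show "sq_integrable lborel_pos (\<lambda>x. complex_of_real (f x))" by (rule sf)
      show "sq_integrable lborel_pos (\<lambda>x. complex_of_real (g x))" by (rule sg)
      show "(norm (abs_l2 (\<lambda>x. complex_of_real (f x))) * norm (abs_l2 (\<lambda>x. complex_of_real (g x))))\<^sup>2 \<le> K * real N"
        using nf ng by (simp add: power_mult_distrib)
      fix \<phi> n
      assume P: "hankel_projection \<alpha> \<beta> (tensor (\<lambda>x. complex_of_real (f x)) (\<lambda>x. complex_of_real (g x))) \<phi>" and n: "n < N"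
      have "scale_diagonal (hankel_kernel \<alpha> \<beta> \<phi>) (left_test \<alpha>) (right_test \<beta>) n
          (c * (1 * \<gamma> n * m * peak n powr ((1/\<beta> - 1/\<alpha>)/2 - 1)))"
      proof (rule c(2)[OF _ _ P])
        show "rank_one_data \<alpha> \<beta> (peak n) (peak n) f g 1 (\<gamma> n) m"
          unfolding rank_one_data_def
        proof (intro conjI sf sg)
          show "peak n / 2 \<le> peak n" "peak n \<le> peak n" using peak_ge[of n] by auto
          show "\<forall>x. 0 \<le> f x" by (simp add: f_def)
          show "\<forall>y. 0 \<le> g y" by (auto simp: g_def \<gamma>_def intro!: sum_nonneg)
          show "0 \<le> \<gamma> n" "0 \<le> m" by (simp_all add: \<gamma>_def m_def)
          show "\<forall>x\<in>powr_vimage \<alpha> {peak n - peak n<..<peak n - peak n + 1/4}. 1 \<le> f x"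
            by (auto simp: f_def F_def powr_vimage_def)
          show "\<forall>y\<in>powr_vimage \<beta> {peak n<..<peak n + 1}. \<gamma> n \<le> g y"
            using g_at[OF n] by (auto simp: G_def)
          show "ennreal m \<le> emeasure lborel_pos (powr_vimage \<alpha> {peak n - peak n<..<peak n - peak n + 1/4})"
            using emeasure_powr_vimage_zero[OF \<alpha>, of "1/4"] by (simp add: m_def)
        qed auto
        show "\<forall>z\<in>space lborel_pos2. f (fst z) * g (snd z) \<noteq> 0 \<longrightarrow>
            (\<exists>l. peak l < level \<alpha> \<beta> z \<and> level \<alpha> \<beta> z < peak l + 2)"
        proof (intro ballI impI)
          fix z assume z: "f (fst z) * g (snd z) \<noteq> 0"
          then have "fst z \<in> F" by (auto simp: f_def indicator_def split: if_splits)
          moreover obtain l where "snd z \<in> G l" using g_off[of "snd z"] z by fastforce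
          ultimately have "fst z powr \<alpha> < 1" "peak l < snd z powr \<beta>" "snd z powr \<beta> < peak l + 1"
            by (auto simp: F_def G_def powr_vimage_def)
          moreover have "0 \<le> fst z powr \<alpha>" by simp
          ultimately have "peak l < level \<alpha> \<beta> z \<and> level \<alpha> \<beta> z < peak l + 2"
            unfolding level_def by linarith
          then show "\<exists>l. peak l < level \<alpha> \<beta> z \<and> level \<alpha> \<beta> z < peak l + 2" ..
        qed
      qed
      also have "c * (1 * \<gamma> n * m * peak n powr ((1/\<beta> - 1/\<alpha>)/2 - 1)) =
          d * 2 powr (- (real n * ((1 + 1/\<alpha>) / 2)))"
      proof -
        have "(1 - y)/2 + ((y - x)/2 - 1) = - ((1 + x)/2)" for x y :: real by (simp add: field_simps)
        from this[of "1/\<beta>" "1/\<alpha>"] have "\<gamma> n * peak n powr ((1/\<beta> - 1/\<alpha>)/2 - 1) = peak n powr (- ((1 + 1/\<alpha>)/2))"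
          unfolding \<gamma>_def powr_add[symmetric] by (simp only:)
        also have "\<dots> = 8 powr (- ((1 + 1/\<alpha>)/2)) * 2 powr (- (real n * ((1 + 1/\<alpha>)/2)))"
          unfolding peak_powr by (simp only: mult_minus_right)
        finally show ?thesis unfolding d_def by (simp only: mult_1_left mult_ac)
      qed
      finally show "scale_diagonal (hankel_kernel \<alpha> \<beta> \<phi>) (left_test \<alpha>) (right_test \<beta>) n
               (d * 2 powr (- (real n * ((1 + 1/\<alpha>) / 2))))" .
    qed
  qed
qed

text \<open>Both factors sit at \<open>u, v \<approx> T/2\<close> and are normalised. In the exponent of \<open>T\<close> the contributions of \<open>\<alpha>\<close>
and \<open>\<beta>\<close> cancel and only \<open>1/T\<close> remains.\<close>

lemma single_scale_test:
  assumes \<alpha>: "0 < \<alpha>" and \<beta>: "0 < \<beta>"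
  obtains d C where "0 < d"
    "\<And>n. \<exists>f g. sq_integrable lborel_pos f \<and> sq_integrable lborel_pos g \<and>
       (norm (abs_l2 f) * norm (abs_l2 g))\<^sup>2 \<le> C \<and>
       (\<forall>\<phi>. hankel_projection \<alpha> \<beta> (tensor f g) \<phi> \<longrightarrow>
          scale_diagonal (hankel_kernel \<alpha> \<beta> \<phi>) (left_test \<alpha>) (right_test \<beta>) n (d * 2 powr (- real n)))"
proof -
  obtain c where c: "0 < c"
    "\<And>n R f g \<phi>0 \<gamma> m \<phi>. rank_one_data \<alpha> \<beta> (peak n) R f g \<phi>0 \<gamma> m \<Longrightarrow>
       (\<forall>z\<in>space lborel_pos2. f (fst z) * g (snd z) \<noteq> 0 \<longrightarrow> (\<exists>l. peak l < level \<alpha> \<beta> z \<and> level \<alpha> \<beta> z < peak l + 2)) \<Longrightarrow>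
       hankel_projection \<alpha> \<beta> (tensor (\<lambda>x. complex_of_real (f x)) (\<lambda>y. complex_of_real (g y))) \<phi> \<Longrightarrow>
       scale_diagonal (hankel_kernel \<alpha> \<beta> \<phi>) (left_test \<alpha>) (right_test \<beta>) n
         (c * (\<phi>0 * \<gamma> * m * peak n powr ((1/\<beta> - 1/\<alpha>)/2 - 1)))"
    by (rule scale_diagonal_hankel[OF \<alpha> \<beta>]) (rule that)
  obtain ka Ka where ka: "0 < ka" "0 < Ka"
    "\<And>T p l. 0 < T \<Longrightarrow> T/4 \<le> p \<Longrightarrow> 0 \<le> l \<Longrightarrow> p + l \<le> 2*T \<Longrightarrow>
       emeasure lborel_pos (powr_vimage \<alpha> {p<..<p+l}) < \<infinity> \<and>
       ka * T powr (1/\<alpha> - 1) * l \<le> measure lborel_pos (powr_vimage \<alpha> {p<..<p+l}) \<and>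
       measure lborel_pos (powr_vimage \<alpha> {p<..<p+l}) \<le> Ka * T powr (1/\<alpha> - 1) * l"
    by (rule measure_powr_vimage_interval[OF \<alpha>]) (rule that)
  obtain kb Kb where kb: "0 < kb" "0 < Kb"
    "\<And>T p l. 0 < T \<Longrightarrow> T/4 \<le> p \<Longrightarrow> 0 \<le> l \<Longrightarrow> p + l \<le> 2*T \<Longrightarrow>
       emeasure lborel_pos (powr_vimage \<beta> {p<..<p+l}) < \<infinity> \<and>
       kb * T powr (1/\<beta> - 1) * l \<le> measure lborel_pos (powr_vimage \<beta> {p<..<p+l}) \<and>
       measure lborel_pos (powr_vimage \<beta> {p<..<p+l}) \<le> Kb * T powr (1/\<beta> - 1) * l"
    by (rule measure_powr_vimage_interval[OF \<beta>]) (rule that)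
  show ?thesis
  proof (rule that[of "c * (ka / 4) / 8" "Ka * Kb"])
    show "0 < c * (ka / 4) / 8" using c ka by simp
    fix n
    define R where "R = peak n / 2"
    have R: "peak n - R = R" "peak n / 2 \<le> R" "R \<le> peak n" "0 < peak n" "peak n / 4 \<le> R" "R + 1 \<le> 2 * peak n" "R + 1/4 \<le> 2 * peak n"
      using peak_ge[of n] by (auto simp: R_def)
    define F where "F = powr_vimage \<alpha> {R<..<R+1}"
    define G where "G = powr_vimage \<beta> {R<..<R+1}"
    define a where "a = peak n powr ((1 - 1/\<alpha>)/2)"
    define b where "b = peak n powr ((1 - 1/\<beta>)/2)"
    have F: "F \<in> sets lborel_pos" "emeasure lborel_pos F < \<infinity>" "measure lborel_pos F \<le> Ka * peak n powr (1/\<alpha> - 1)"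
      using ka(3)[of "peak n" R 1] R powr_vimage_sets[of "{R<..<R+1}" \<alpha>] by (auto simp: F_def)
    have G: "G \<in> sets lborel_pos" "emeasure lborel_pos G < \<infinity>" "measure lborel_pos G \<le> Kb * peak n powr (1/\<beta> - 1)"
      using kb(3)[of "peak n" R 1] R powr_vimage_sets[of "{R<..<R+1}" \<beta>] by (auto simp: G_def)
    define f :: "real \<Rightarrow> real" where "f x = a * indicator F x" for x
    define g :: "real \<Rightarrow> real" where "g x = b * indicator G x" for x
    have sf: "sq_integrable lborel_pos (\<lambda>x. complex_of_real (f x))"
      and nf: "(norm (abs_l2 (\<lambda>x. complex_of_real (f x))))\<^sup>2 = a\<^sup>2 * measure lborel_pos F"
      unfolding f_def by (rule norm_indicator_multiple[OF F(1,2)])+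
    have sg: "sq_integrable lborel_pos (\<lambda>x. complex_of_real (g x))"
      and ng: "(norm (abs_l2 (\<lambda>x. complex_of_real (g x))))\<^sup>2 = b\<^sup>2 * measure lborel_pos G"
      unfolding g_def by (rule norm_indicator_multiple[OF G(1,2)])+
    have a2: "a\<^sup>2 * peak n powr (1/\<alpha> - 1) = 1" and b2: "b\<^sup>2 * peak n powr (1/\<beta> - 1) = 1"
      using R(4) by (simp_all add: a_def b_def power2_eq_square flip: powr_add)
    have "a\<^sup>2 * measure lborel_pos F \<le> a\<^sup>2 * (Ka * peak n powr (1/\<alpha> - 1))"
      by (intro mult_left_mono F) simp
    also have "\<dots> = Ka" using a2 by (simp add: mult.left_commute)
    finally have nf': "a\<^sup>2 * measure lborel_pos F \<le> Ka" .
    have "b\<^sup>2 * measure lborel_pos G \<le> b\<^sup>2 * (Kb * peak n powr (1/\<beta> - 1))"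
      by (intro mult_left_mono G) simp
    also have "\<dots> = Kb" using b2 by (simp add: mult.left_commute)
    finally have ng': "b\<^sup>2 * measure lborel_pos G \<le> Kb" .
    define m where "m = ka * peak n powr (1/\<alpha> - 1) * (1/4)"
    show "\<exists>f g. sq_integrable lborel_pos f \<and> sq_integrable lborel_pos g \<and>
       (norm (abs_l2 f) * norm (abs_l2 g))\<^sup>2 \<le> Ka * Kb \<and>
       (\<forall>\<phi>. hankel_projection \<alpha> \<beta> (tensor f g) \<phi> \<longrightarrow>
          scale_diagonal (hankel_kernel \<alpha> \<beta> \<phi>) (left_test \<alpha>) (right_test \<beta>) n (c * (ka / 4) / 8 * 2 powr (- real n)))"
    proof (intro exI conjI allI impI)
      show "sq_integrable lborel_pos (\<lambda>x. complex_of_real (f x))" by (rule sf)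
      show "sq_integrable lborel_pos (\<lambda>x. complex_of_real (g x))" by (rule sg)
      show "(norm (abs_l2 (\<lambda>x. complex_of_real (f x))) * norm (abs_l2 (\<lambda>x. complex_of_real (g x))))\<^sup>2 \<le> Ka * Kb"
        unfolding power_mult_distrib nf ng using nf' ng' ka kb by (intro mult_mono) auto
      fix \<phi>
      assume P: "hankel_projection \<alpha> \<beta> (tensor (\<lambda>x. complex_of_real (f x)) (\<lambda>x. complex_of_real (g x))) \<phi>"
      have "scale_diagonal (hankel_kernel \<alpha> \<beta> \<phi>) (left_test \<alpha>) (right_test \<beta>) n
          (c * (a * b * m * peak n powr ((1/\<beta> - 1/\<alpha>)/2 - 1)))"
      proof (rule c(2)[OF _ _ P])
        show "rank_one_data \<alpha> \<beta> (peak n) R f g a b m"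
          unfolding rank_one_data_def
        proof (intro conjI sf sg R(2,3))
          show "\<forall>x. 0 \<le> f x" "\<forall>y. 0 \<le> g y" "0 \<le> a" "0 \<le> b" "0 \<le> m"
            using ka by (simp_all add: f_def g_def a_def b_def m_def)
          show "\<forall>x\<in>powr_vimage \<alpha> {peak n - R<..<peak n - R + 1/4}. a \<le> f x"
            unfolding R(1) by (auto simp: f_def F_def powr_vimage_def)
          show "\<forall>y\<in>powr_vimage \<beta> {R<..<R + 1}. b \<le> g y"
            by (auto simp: g_def G_def)
          have "emeasure lborel_pos (powr_vimage \<alpha> {R<..<R + 1/4}) < \<infinity> \<and>
              m \<le> measure lborel_pos (powr_vimage \<alpha> {R<..<R + 1/4})"
            using ka(3)[of "peak n" R "1/4"] R unfolding m_def by auto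
          then show "ennreal m \<le> emeasure lborel_pos (powr_vimage \<alpha> {peak n - R<..<peak n - R + 1/4})"
            unfolding R(1) by (subst emeasure_eq_ennreal_measure) (auto intro: ennreal_leI)
        qed
        show "\<forall>z\<in>space lborel_pos2. f (fst z) * g (snd z) \<noteq> 0 \<longrightarrow>
            (\<exists>l. peak l < level \<alpha> \<beta> z \<and> level \<alpha> \<beta> z < peak l + 2)"
        proof (intro ballI impI)
          fix z assume z: "f (fst z) * g (snd z) \<noteq> 0"
          then have "fst z \<in> F" "snd z \<in> G" by (auto simp: f_def g_def indicator_def split: if_splits)
          then show "\<exists>l. peak l < level \<alpha> \<beta> z \<and> level \<alpha> \<beta> z < peak l + 2"
            by (intro exI[of _ n]) (auto simp: F_def G_def powr_vimage_def level_def R_def)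
        qed
      qed
      also have "c * (a * b * m * peak n powr ((1/\<beta> - 1/\<alpha>)/2 - 1)) = c * (ka / 4) / 8 * 2 powr (- real n)"
      proof -
        have "(1 - x)/2 + ((1 - y)/2 + ((x - 1) + ((y - x)/2 - 1))) = - 1" for x y :: real by (simp add: field_simps)
        from this[of "1/\<alpha>" "1/\<beta>"]
        have "a * (b * (peak n powr (1/\<alpha> - 1) * peak n powr ((1/\<beta> - 1/\<alpha>)/2 - 1))) = peak n powr (-1)"
          unfolding a_def b_def powr_add[symmetric] by (simp only:)
        also have "\<dots> = 1/8 * 2 powr (- real n)"
          unfolding peak_powr by (simp add: powr_minus_divide)
        finally show ?thesis unfolding m_def by (simp add: mult_ac)
      qed
      finally show "scale_diagonal (hankel_kernel \<alpha> \<beta> \<phi>) (left_test \<alpha>) (right_test \<beta>) n (c * (ka / 4) / 8 * 2 powr (- real n))" .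
    qed
  qed
qed

section \<open>Exchanging the variables\<close>

lemma integral_swap:
  assumes "f \<in> borel_measurable lborel_pos2"
  shows "(LINT z|lborel_pos2. f (prod.swap z)) = (LINT z|lborel_pos2. (f z :: complex))"
proof -
  have "(\<lambda>(x, y). f (y, x)) = (\<lambda>z. f (prod.swap z))" by auto
  then show ?thesis using lborel_pos2.integral_product_swap[OF assms] by (simp only:)
qed

lemma sq_integrable_swap:
  assumes "sq_integrable lborel_pos2 f"
  shows "sq_integrable lborel_pos2 (\<lambda>z. f (prod.swap z))"
proof -
  have "(\<lambda>(x, y). (cmod (f (y, x)))\<^sup>2) = (\<lambda>z. (cmod (f (prod.swap z)))\<^sup>2)" by auto
  then have "integrable lborel_pos2 (\<lambda>z. (cmod (f (prod.swap z)))\<^sup>2)"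
    using lborel_pos2.integrable_product_swap[OF sq_integrable_integrable[OF assms]] by (simp only:)
  moreover have "(\<lambda>z. f (prod.swap z)) \<in> borel_measurable lborel_pos2"
    using measurable_compose[OF measurable_pair_swap' sq_integrable_measurable[OF assms]]
    by (simp add: case_prod_beta prod.swap_def)
  ultimately show ?thesis by (simp add: sq_integrable_def)
qed

lemma hankel_kernel_swap: "hankel_kernel \<beta> \<alpha> \<phi> = (\<lambda>z. hankel_kernel \<alpha> \<beta> \<phi> (prod.swap z))"
  by (auto simp: hankel_kernel_def add.commute)

text \<open>Reflection in the diagonal maps the levels for \<open>(\<alpha>, \<beta>)\<close> to those for \<open>(\<beta>, \<alpha>)\<close>. So what is
proved for the exponent of one variable holds for that of the other.\<close>

lemma hankel_projection_swap:
  assumes k: "sq_integrable lborel_pos2 (tensor f g)" and P: "hankel_projection \<alpha> \<beta> (tensor f g) \<phi>"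
  shows "hankel_projection \<beta> \<alpha> (tensor g f) \<phi>"
  unfolding hankel_projection_def
proof (intro conjI allI impI)
  have h: "sq_integrable lborel_pos2 (hankel_kernel \<alpha> \<beta> \<phi>)" using P by (simp add: hankel_projection_def)
  then show "sq_integrable lborel_pos2 (hankel_kernel \<beta> \<alpha> \<phi>)"
    unfolding hankel_kernel_swap[of \<beta> \<alpha>] by (rule sq_integrable_swap)
  fix \<psi> assume "sq_integrable lborel_pos2 (hankel_kernel \<beta> \<alpha> \<psi>)"
  then have p: "sq_integrable lborel_pos2 (hankel_kernel \<alpha> \<beta> \<psi>)"
    unfolding hankel_kernel_swap[of \<alpha> \<beta>] by (rule sq_integrable_swap)
  let ?F = "\<lambda>z. (tensor f g z - hankel_kernel \<alpha> \<beta> \<phi> z) * cnj (hankel_kernel \<alpha> \<beta> \<psi> z)"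
  have "integrable lborel_pos2 ?F"
    by (intro sq_integrable_prod sq_integrable_diff sq_integrable_cnj k h p)
  then have "?F \<in> borel_measurable lborel_pos2" by auto
  from integral_swap[OF this]
  have "(LINT z|lborel_pos2. (tensor g f z - hankel_kernel \<beta> \<alpha> \<phi> z) * cnj (hankel_kernel \<beta> \<alpha> \<psi> z)) =
      (LINT z|lborel_pos2. ?F z)"
    by (simp add: hankel_kernel_swap[of \<beta> \<alpha>] tensor_def case_prod_beta mult.commute)
  also have "\<dots> = 0" using P p by (simp add: hankel_projection_def)
  finally show "(LINT z|lborel_pos2. (tensor g f z - hankel_kernel \<beta> \<alpha> \<phi> z) * cnj (hankel_kernel \<beta> \<alpha> \<psi> z)) = 0" .
qed

lemma block_swap:
  assumes h: "sq_integrable lborel_pos2 h" and J: "J \<in> sets lborel_pos" "K \<in> sets lborel_pos"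
  shows "block (\<lambda>z. h (prod.swap z)) K J = block h J K"
proof -
  note [measurable] = J sq_integrable_measurable[OF h]
  have "(\<lambda>z. h z * tensor (indicator J) (indicator K) z) \<in> borel_measurable lborel_pos2"
    unfolding tensor_indicator by measurable
  from integral_swap[OF this] show ?thesis
    by (simp add: block_def tensor_def case_prod_beta mult.commute)
qed

lemma scale_diagonal_swap:
  assumes h: "sq_integrable lborel_pos2 h" and J: "test_sets J" and K: "test_sets K"
    and d: "scale_diagonal h J K n d"
  shows "scale_diagonal (\<lambda>z. h (prod.swap z)) K J n d"
proof -
  have s: "block (\<lambda>z. h (prod.swap z)) (K m) (J m') = block h (J m') (K m)"
    if "m \<in> {2^n..<2^Suc n}" "m' \<in> {2^n..<2^Suc n}" for m m'
    using J K dyadic_bounds(4)[OF that(1)] dyadic_bounds(4)[OF that(2)]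
    by (intro block_swap[OF h]) (auto simp: test_sets_def)
  show ?thesis
    using d unfolding scale_diagonal_def
    by (auto simp: s mult.commute[of "measure lborel_pos (K _)"] simp del: power_Suc)
qed

lemma scale_test_swap:
  assumes t: "scale_test \<alpha> \<beta> J K \<tau>" and J: "test_sets J" and K: "test_sets K"
  shows "scale_test \<beta> \<alpha> K J \<tau>"
proof -
  obtain c C where c: "0 < c" "\<And>N. \<exists>f g.
     sq_integrable lborel_pos f \<and> sq_integrable lborel_pos g \<and>
     (norm (abs_l2 f) * norm (abs_l2 g))\<^sup>2 \<le> C * real N \<and>
     (\<forall>\<phi>. hankel_projection \<alpha> \<beta> (tensor f g) \<phi> \<longrightarrow>
        (\<forall>n<N. scale_diagonal (hankel_kernel \<alpha> \<beta> \<phi>) J K n (c * 2 powr (- (real n * \<tau>)))))"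
    using t unfolding scale_test_def by blast
  show ?thesis unfolding scale_test_def
  proof (rule exI[of _ c], rule conjI[OF c(1)], rule exI[of _ C], rule allI)
    fix N
    obtain f g where fg: "sq_integrable lborel_pos f" "sq_integrable lborel_pos g"
      "(norm (abs_l2 f) * norm (abs_l2 g))\<^sup>2 \<le> C * real N"
      "\<And>\<phi> n. hankel_projection \<alpha> \<beta> (tensor f g) \<phi> \<Longrightarrow> n < N \<Longrightarrow>
         scale_diagonal (hankel_kernel \<alpha> \<beta> \<phi>) J K n (c * 2 powr (- (real n * \<tau>)))"
      using c(2)[of N] by blast
    show "\<exists>f g. sq_integrable lborel_pos f \<and> sq_integrable lborel_pos g \<and>
     (norm (abs_l2 f) * norm (abs_l2 g))\<^sup>2 \<le> C * real N \<and>
     (\<forall>\<phi>. hankel_projection \<beta> \<alpha> (tensor f g) \<phi> \<longrightarrow>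
        (\<forall>n<N. scale_diagonal (hankel_kernel \<beta> \<alpha> \<phi>) K J n (c * 2 powr (- (real n * \<tau>)))))"
    proof (rule exI[of _ g], rule exI[of _ f], intro conjI allI impI fg(1,2))
      show "(norm (abs_l2 g) * norm (abs_l2 f))\<^sup>2 \<le> C * real N" using fg(3) by (simp add: mult.commute)
      fix \<phi> n assume P: "hankel_projection \<beta> \<alpha> (tensor g f) \<phi>" and n: "n < N"
      have P': "hankel_projection \<alpha> \<beta> (tensor f g) \<phi>"
        by (rule hankel_projection_swap[OF sq_integrable_tensor[OF fg(2,1)] P])
      then have "sq_integrable lborel_pos2 (hankel_kernel \<alpha> \<beta> \<phi>)" by (simp add: hankel_projection_def)
      from scale_diagonal_swap[OF this J K fg(4)[OF P' n]]
      show "scale_diagonal (hankel_kernel \<beta> \<alpha> \<phi>) K J n (c * 2 powr (- (real n * \<tau>)))"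
        unfolding hankel_kernel_swap[of \<beta> \<alpha>] .
    qed
  qed
qed

section \<open>Growth of the averages and admissible exponents\<close>

lemma averaging_projection_symbol:
  assumes "is_averaging_projection \<alpha> \<beta> Q" "sq_integrable lborel_pos2 k"
  obtains \<phi> where "hankel_projection \<alpha> \<beta> k \<phi>" "Q (integral_operator k) = integral_operator (hankel_kernel \<alpha> \<beta> \<phi>)"
  using assms unfolding is_averaging_projection_def hankel_projection_def distorted_hankel_def by blast

lemma dyadic_sum_Suc:
  fixes F :: "nat \<Rightarrow> real"
  shows "(\<Sum>m\<in>{1..<2^Suc N}. F m) = (\<Sum>m\<in>{1..<2^N}. F m) + (\<Sum>m\<in>{2^N..<2^Suc N}. F m)"
  by (rule sum.atLeastLessThan_concat[symmetric]) auto

lemma dyadic_sum_ge: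
  fixes F :: "nat \<Rightarrow> real"
  assumes "\<And>n m. n < N \<Longrightarrow> m \<in> {2^n..<2^Suc n} \<Longrightarrow> A / 2^n \<le> F m"
  shows "A * real N \<le> (\<Sum>m\<in>{1..<2^N}. F m)"
  using assms
proof (induction N)
  case (Suc N)
  have "A = (\<Sum>m\<in>{2^N..<2^Suc N::nat}. A / 2^N)" by simp
  also have "\<dots> \<le> (\<Sum>m\<in>{2^N..<2^Suc N}. F m)" by (intro sum_mono Suc.prems) auto
  finally show ?case using Suc unfolding dyadic_sum_Suc by (simp add: algebra_simps)
qed simp

lemma dyadic_sum_le:
  fixes F :: "nat \<Rightarrow> real"
  assumes "\<And>n m. n < N \<Longrightarrow> m \<in> {2^n..<2^Suc n} \<Longrightarrow> F m \<le> A / 2^n"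
  shows "(\<Sum>m\<in>{1..<2^N}. F m) \<le> A * real N"
  using dyadic_sum_ge[of N "-A" "\<lambda>m. - F m"] assms by (simp add: sum_negf)

lemma linear_not_le_sublinear:
  fixes c D q :: real
  assumes c: "0 < c" and q: "q < 1"
    and le: "\<And>N::nat. c * real N \<le> D * (real N + 1) powr q"
  shows False
proof -
  define x where "x = (2 * \<bar>D\<bar> / c + 1) powr (1 / (1 - q))"
  obtain N :: nat where N: "max 1 x \<le> real N" using real_arch_simple by blast
  define y where "y = real N + 1"
  have y: "0 < y" "x < y" "y \<le> 2 * real N" using N by (auto simp: y_def)
  have D: "0 < 2 * \<bar>D\<bar> / c + 1" using c by (simp add: add_nonneg_pos)
  have "2 * \<bar>D\<bar> / c + 1 = x powr (1 - q)"
    using D q by (simp add: x_def powr_powr)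
  also have "\<dots> < y powr (1 - q)"
    using y q by (intro powr_less_mono2) (auto simp: x_def)
  finally have "2 * \<bar>D\<bar> < c * y powr (1 - q)" using c by (simp add: field_simps)
  then have "2 * \<bar>D\<bar> * y powr q < c * y powr (1 - q) * y powr q"
    using y by (intro mult_strict_right_mono) auto
  also have "\<dots> = c * y" using y by (simp add: mult.assoc flip: powr_add)
  also have "\<dots> \<le> c * (2 * real N)" using y c by (intro mult_left_mono) auto
  finally have "\<bar>D\<bar> * y powr q < c * real N" by simp
  moreover have "D * y powr q \<le> \<bar>D\<bar> * y powr q" by (intro mult_right_mono) auto
  ultimately show False using le[of N] unfolding y_def by linarith
qed

lemma le_sqrt_mult:
  assumes "X\<^sup>2 \<le> C * (n::real)" "0 \<le> n"
  shows "X \<le> sqrt (max C 0) * sqrt n"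
proof -
  have "X\<^sup>2 \<le> max C 0 * n" using assms mult_right_mono[of C "max C 0" n] by linarith
  then have "X \<le> sqrt (max C 0 * n)" by (rule real_le_rsqrt)
  then show ?thesis by (simp add: real_sqrt_mult)
qed

text \<open>A rank one operator has the same norm in all Schatten classes, so boundedness controls the singular
values of its average by \<open>\<parallel>f\<parallel> \<parallel>g\<parallel>\<close>.\<close>

lemma tensor_image:
  assumes Q: "is_averaging_projection \<alpha> \<beta> Q"
    and bd: "\<And>T. T \<in> schatten p \<Longrightarrow> Q T \<in> schatten p \<and> schatten_norm p (Q T) \<le> C * schatten_norm p T"
    and p: "0 < p" and f: "sq_integrable lborel_pos f" and g: "sq_integrable lborel_pos g"
  obtains \<phi> where "hankel_projection \<alpha> \<beta> (tensor f g) \<phi>"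
    "\<And>M. (\<Sum>j<M. singular_value (integral_operator (hankel_kernel \<alpha> \<beta> \<phi>)) j powr p) \<le>
        (max C 0 * (norm (abs_l2 f) * norm (abs_l2 g))) powr p"
proof -
  obtain \<phi> where \<phi>: "hankel_projection \<alpha> \<beta> (tensor f g) \<phi>"
      "Q (integral_operator (tensor f g)) = integral_operator (hankel_kernel \<alpha> \<beta> \<phi>)"
    by (rule averaging_projection_symbol[OF Q sq_integrable_tensor[OF f g]])
  let ?G = "integral_operator (hankel_kernel \<alpha> \<beta> \<phi>)"
  note T = schatten_tensor[OF f g p]
  have G: "?G \<in> schatten p" "schatten_norm p ?G \<le> C * schatten_norm p (integral_operator (tensor f g))"
    using bd[OF T(1)] \<phi>(2) by auto
  have n0: "0 \<le> schatten_norm p T" for T by (simp add: schatten_norm_def)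
  have "C * schatten_norm p (integral_operator (tensor f g)) \<le> max C 0 * (norm (abs_l2 f) * norm (abs_l2 g))"
    using T(2) n0 by (intro mult_mono) auto
  then have le: "schatten_norm p ?G powr p \<le> (max C 0 * (norm (abs_l2 f) * norm (abs_l2 g))) powr p"
    using G(2) n0 p by (intro powr_mono2) auto
  show ?thesis
    by (rule that[OF \<phi>(1)]) (rule order_trans[OF sum_singular_value_powr_le[OF G(1) p] le])
qed

text \<open>If \<open>p \<tau> \<le> 1\<close>, the block of the \<open>2^n\<close> singular values with indices from \<open>2^n\<close> on contributes at least
a fixed constant to the sum of the \<open>p\<close>-th powers. With \<open>N\<close> scales the sum is at least of order \<open>N\<close>,
but boundedness makes it at most of order \<open>N\<^bsup>p/2\<^esup>\<close>.\<close>

lemma scale_test_exponent_less_2: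
  assumes Q: "is_averaging_projection \<alpha> \<beta> Q"
    and bd: "\<And>T. T \<in> schatten p \<Longrightarrow> Q T \<in> schatten p \<and> schatten_norm p (Q T) \<le> C * schatten_norm p T"
    and p: "0 < p" "p < 2" and J: "test_sets J" and K: "test_sets K" and t: "scale_test \<alpha> \<beta> J K \<tau>"
  shows "1 < p * \<tau>"
proof (rule ccontr)
  assume "\<not> 1 < p * \<tau>"
  then have \<tau>: "p * \<tau> \<le> 1" by simp
  obtain c B where c: "0 < c" "\<And>N. \<exists>f g.
     sq_integrable lborel_pos f \<and> sq_integrable lborel_pos g \<and>
     (norm (abs_l2 f) * norm (abs_l2 g))\<^sup>2 \<le> B * real N \<and>
     (\<forall>\<phi>. hankel_projection \<alpha> \<beta> (tensor f g) \<phi> \<longrightarrow>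
        (\<forall>n<N. scale_diagonal (hankel_kernel \<alpha> \<beta> \<phi>) J K n (c * 2 powr (- (real n * \<tau>)))))"
    using t unfolding scale_test_def by blast
  define D where "D = (max C 0 * sqrt (max B 0)) powr p"
  have "c powr p / 2 * real N \<le> D * (real N + 1) powr (p / 2)" for N
  proof -
    obtain f g where fg: "sq_integrable lborel_pos f" "sq_integrable lborel_pos g"
      "(norm (abs_l2 f) * norm (abs_l2 g))\<^sup>2 \<le> B * real (Suc N)"
      "\<And>\<phi> n. hankel_projection \<alpha> \<beta> (tensor f g) \<phi> \<Longrightarrow> n < Suc N \<Longrightarrow>
         scale_diagonal (hankel_kernel \<alpha> \<beta> \<phi>) J K n (c * 2 powr (- (real n * \<tau>)))"
      using c(2)[of "Suc N"] by blast
    obtain \<phi> where \<phi>: "hankel_projection \<alpha> \<beta> (tensor f g) \<phi>"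
      "\<And>M. (\<Sum>j<M. singular_value (integral_operator (hankel_kernel \<alpha> \<beta> \<phi>)) j powr p) \<le>
        (max C 0 * (norm (abs_l2 f) * norm (abs_l2 g))) powr p"
      by (rule tensor_image[OF Q bd p(1) fg(1,2)]) (assumption, rule that)
    let ?s = "singular_value (integral_operator (hankel_kernel \<alpha> \<beta> \<phi>))"
    have h: "sq_integrable lborel_pos2 (hankel_kernel \<alpha> \<beta> \<phi>)" using \<phi>(1) by (simp add: hankel_projection_def)
    have "c powr p / 2 * real N \<le> (\<Sum>m\<in>{1..<2^N}. ?s m powr p)"
    proof (rule dyadic_sum_ge)
      fix n m :: nat assume n: "n < N" and m: "m \<in> {2^n..<2^Suc n}"
      \<comment> \<open>The indices below \<open>2^Suc n\<close> are governed by the next scale; hence \<open>Suc N\<close> scales for \<open>N\<close> blocks.\<close>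
      have "c * 2 powr (- (real (Suc n) * \<tau>)) \<le> ?s m"
        by (rule singular_value_ge_scale_diagonal[OF h J K fg(4)[OF \<phi>(1)]]) (use n m in auto)
      then have "(c * 2 powr (- (real (Suc n) * \<tau>))) powr p \<le> ?s m powr p"
        using c(1) p by (intro powr_mono2) auto
      moreover have "c powr p / 2 / 2^n = c powr p * 2 powr (- real (Suc n))"
        using powr_realpow[of 2 "Suc n"] by (simp add: powr_minus_divide del: of_nat_Suc)
      moreover have "2 powr (- real (Suc n)) \<le> 2 powr (- (real (Suc n) * (p * \<tau>)))"
        using mult_left_mono[OF \<tau> of_nat_0_le_iff, of "Suc n"] by (intro powr_mono) (simp_all only: mult_1_right neg_le_iff_le)
      then have "c powr p * 2 powr (- real (Suc n)) \<le> (c * 2 powr (- (real (Suc n) * \<tau>))) powr p"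
        using c(1) by (simp add: powr_mult powr_powr mult_ac)
      ultimately show "c powr p / 2 / 2^n \<le> ?s m powr p" by linarith
    qed
    also have "\<dots> \<le> (\<Sum>j<2^N. ?s j powr p)"
      by (rule sum_mono2) auto
    also have "\<dots> \<le> (max C 0 * (norm (abs_l2 f) * norm (abs_l2 g))) powr p" by (rule \<phi>(2))
    also have "\<dots> \<le> (max C 0 * (sqrt (max B 0) * sqrt (real (Suc N)))) powr p"
      using p le_sqrt_mult[OF fg(3)] by (intro powr_mono2 mult_left_mono mult_nonneg_nonneg) auto
    also have "\<dots> = D * (real N + 1) powr (p / 2)"
      by (simp add: D_def powr_mult powr_half_sqrt[symmetric] powr_powr mult_ac add.commute)
    finally show ?thesis .
  qed
  then show False
    by (intro linear_not_le_sublinear[of "c powr p / 2" "p / 2" D]) (use c(1) p in auto)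
qed

text \<open>One scale has \<open>2^n\<close> singular values of order at least \<open>2\<^bsup>-n\<^esup>\<close>, and the sum of their \<open>p\<close>-th powers is of
order at least \<open>2\<^bsup>n(1 - p)\<^esup>\<close>, which is unbounded if \<open>p < 1\<close>.\<close>

lemma bounded_exponent_ge_1:
  assumes \<alpha>: "0 < \<alpha>" and \<beta>: "0 < \<beta>" and Q: "is_averaging_projection \<alpha> \<beta> Q"
    and bd: "\<And>T. T \<in> schatten p \<Longrightarrow> Q T \<in> schatten p \<and> schatten_norm p (Q T) \<le> C * schatten_norm p T"
    and p: "0 < p"
  shows "1 \<le> p"
proof (rule ccontr)
  assume "\<not> 1 \<le> p"
  then have p1: "p < 1" by simp
  obtain d B where d: "0 < d"
    "\<And>n. \<exists>f g. sq_integrable lborel_pos f \<and> sq_integrable lborel_pos g \<and>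
       (norm (abs_l2 f) * norm (abs_l2 g))\<^sup>2 \<le> B \<and>
       (\<forall>\<phi>. hankel_projection \<alpha> \<beta> (tensor f g) \<phi> \<longrightarrow>
          scale_diagonal (hankel_kernel \<alpha> \<beta> \<phi>) (left_test \<alpha>) (right_test \<beta>) n (d * 2 powr (- real n)))"
    by (rule single_scale_test[OF \<alpha> \<beta>]) (rule that)
  define D where "D = (max C 0 * sqrt (max B 0)) powr p"
  have le: "d powr p * (2 powr (1 - p)) ^ n \<le> D" for n
  proof -
    obtain f g where fg: "sq_integrable lborel_pos f" "sq_integrable lborel_pos g"
      "(norm (abs_l2 f) * norm (abs_l2 g))\<^sup>2 \<le> B * 1"
      "\<And>\<phi>. hankel_projection \<alpha> \<beta> (tensor f g) \<phi> \<Longrightarrow>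
          scale_diagonal (hankel_kernel \<alpha> \<beta> \<phi>) (left_test \<alpha>) (right_test \<beta>) n (d * 2 powr (- real n))"
      using d(2)[of n] by auto
    obtain \<phi> where \<phi>: "hankel_projection \<alpha> \<beta> (tensor f g) \<phi>"
      "\<And>M. (\<Sum>j<M. singular_value (integral_operator (hankel_kernel \<alpha> \<beta> \<phi>)) j powr p) \<le>
        (max C 0 * (norm (abs_l2 f) * norm (abs_l2 g))) powr p"
      by (rule tensor_image[OF Q bd p(1) fg(1,2)]) (assumption, rule that)
    let ?s = "singular_value (integral_operator (hankel_kernel \<alpha> \<beta> \<phi>))"
    have h: "sq_integrable lborel_pos2 (hankel_kernel \<alpha> \<beta> \<phi>)" using \<phi>(1) by (simp add: hankel_projection_def)
    have "d powr p * (2 powr (1 - p)) ^ n = (\<Sum>j<(2::nat)^n. (d * 2 powr (- real n)) powr p)"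
    proof -
      have "(2 powr (1 - p)) ^ n = 2 powr real n * 2 powr (- (real n * p))"
        by (simp add: powr_powr flip: powr_realpow powr_add) (simp add: algebra_simps)
      then show ?thesis using d(1) by (simp add: powr_mult powr_powr powr_realpow)
    qed
    also have "\<dots> \<le> (\<Sum>j<2^n. ?s j powr p)"
    proof (rule sum_mono)
      fix j :: nat assume "j \<in> {..<2^n}"
      then have "d * 2 powr (- real n) \<le> ?s j"
        by (intro singular_value_ge_scale_diagonal[OF h test_sets_left[OF \<alpha>] test_sets_right[OF \<beta>] fg(4)[OF \<phi>(1)]]) auto
      then show "(d * 2 powr (- real n)) powr p \<le> ?s j powr p"
        using d(1) p by (intro powr_mono2) auto
    qed
    also have "\<dots> \<le> (max C 0 * (norm (abs_l2 f) * norm (abs_l2 g))) powr p" by (rule \<phi>(2))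
    also have "\<dots> \<le> D"
      unfolding D_def using p le_sqrt_mult[OF fg(3)] by (intro powr_mono2 mult_left_mono mult_nonneg_nonneg) auto
    finally show ?thesis .
  qed
  have "1 < 2 powr (1 - p)" using p1 by simp
  then obtain n where "D / d powr p < (2 powr (1 - p)) ^ n" using real_arch_pow by blast
  then have "D < d powr p * (2 powr (1 - p)) ^ n" using d(1) by (simp add: field_simps)
  then show False using le[of n] by simp
qed

text \<open>Self-adjointness of the projection: both sides pair the averages of \<open>k\<close> and \<open>l\<close>.\<close>

lemma hankel_projection_duality:
  assumes k: "sq_integrable lborel_pos2 k" and P: "hankel_projection \<alpha> \<beta> k \<phi>"
    and l: "sq_integrable lborel_pos2 l" and R: "hankel_projection \<alpha> \<beta> l \<psi>"
  shows "Re (LINT z|lborel_pos2. hankel_kernel \<alpha> \<beta> \<psi> z * cnj (k z)) =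
    Re (LINT z|lborel_pos2. hankel_kernel \<alpha> \<beta> \<phi> z * cnj (l z))"
proof -
  let ?p = "hankel_kernel \<alpha> \<beta> \<phi>" and ?c = "hankel_kernel \<alpha> \<beta> \<psi>"
  have p: "sq_integrable lborel_pos2 ?p" and c: "sq_integrable lborel_pos2 ?c"
    using P R by (simp_all add: hankel_projection_def)
  have i: "integrable lborel_pos2 (\<lambda>z. u z * cnj (v z))"
    if "sq_integrable lborel_pos2 u" "sq_integrable lborel_pos2 v" for u v
    by (intro sq_integrable_prod sq_integrable_cnj that)
  have sw: "(LINT z|lborel_pos2. u z * cnj (v z)) = cnj (LINT z|lborel_pos2. v z * cnj (u z))" for u v
    by (subst Bochner_Integration.integral_cnj[symmetric]) (simp add: mult.commute)
  have "(LINT z|lborel_pos2. (k z - ?p z) * cnj (?c z)) = 0" using P c by (simp add: hankel_projection_def)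
  then have 1: "(LINT z|lborel_pos2. k z * cnj (?c z)) = (LINT z|lborel_pos2. ?p z * cnj (?c z))"
    using i[OF k c] i[OF p c] by (simp add: left_diff_distrib)
  have "(LINT z|lborel_pos2. (l z - ?c z) * cnj (?p z)) = 0" using R p by (simp add: hankel_projection_def)
  then have 2: "(LINT z|lborel_pos2. l z * cnj (?p z)) = (LINT z|lborel_pos2. ?c z * cnj (?p z))"
    using i[OF l p] i[OF c p] by (simp add: left_diff_distrib)
  show ?thesis
    unfolding sw[of ?c k] sw[of ?p l] 1 2 sw[of ?p ?c] by simp
qed

text \<open>The diagonal operator \<open>k\<close> on the boxes with weights \<open>m\<^bsup>-1/p\<^esup>\<close> has Schatten norm at most \<open>N\<^bsup>1/p\<^esup>\<close>
when \<open>N\<close> scales are used. Its average, tested against the rank one kernel of norm of order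
\<open>N\<^bsup>1/2\<^esup>\<close>, equals by duality the weighted sum of the diagonal entries, which are at least of order
\<open>m\<^bsup>-\<tau>\<^esup>\<close>. If \<open>1/p + \<tau> \<le> 1\<close> this sum is at least of order \<open>N\<close>, but boundedness allows only
\<open>N\<^bsup>1/p + 1/2\<^esup>\<close>, a power of \<open>N\<close> below the first when \<open>p > 2\<close>.\<close>

lemma scale_test_exponent_greater_2:
  assumes Q: "is_averaging_projection \<alpha> \<beta> Q"
    and ext: "\<And>T. T \<in> schatten p \<Longrightarrow> T \<in> schatten 2 \<Longrightarrow> Q T \<in> schatten p \<and> schatten_norm p (Q T) \<le> C * schatten_norm p T"
    and p: "2 < p" and J: "test_sets J" and K: "test_sets K" and t: "scale_test \<alpha> \<beta> J K \<tau>"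
  shows "1 - 1/p < \<tau>"
proof (rule ccontr)
  assume "\<not> 1 - 1/p < \<tau>"
  then have \<tau>: "1/p + \<tau> \<le> 1" by simp
  obtain c B where c: "0 < c" "\<And>N. \<exists>f g.
     sq_integrable lborel_pos f \<and> sq_integrable lborel_pos g \<and>
     (norm (abs_l2 f) * norm (abs_l2 g))\<^sup>2 \<le> B * real N \<and>
     (\<forall>\<phi>. hankel_projection \<alpha> \<beta> (tensor f g) \<phi> \<longrightarrow>
        (\<forall>n<N. scale_diagonal (hankel_kernel \<alpha> \<beta> \<phi>) J K n (c * 2 powr (- (real n * \<tau>)))))"
    using t unfolding scale_test_def by blast
  define w where "w m = real m powr (- 1/p)" for m :: nat
  have bound: "c * 2 powr (- 1/p) * real N \<le> max C 0 * sqrt (max B 0) * (real N + 1) powr (1/p + 1/2)" for N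
  proof -
    obtain f g where fg: "sq_integrable lborel_pos f" "sq_integrable lborel_pos g"
      "(norm (abs_l2 f) * norm (abs_l2 g))\<^sup>2 \<le> B * real N"
      "\<And>\<phi> n. hankel_projection \<alpha> \<beta> (tensor f g) \<phi> \<Longrightarrow> n < N \<Longrightarrow>
         scale_diagonal (hankel_kernel \<alpha> \<beta> \<phi>) J K n (c * 2 powr (- (real n * \<tau>)))"
      using c(2)[of N] by blast
    \<comment> \<open>Boxes are numbered from \<open>1\<close> and terms of a diagonal kernel from \<open>0\<close>, whence the shifts by one.\<close>
    define M where "M = 2^N - (1::nat)"
    have M: "{1..<2^N} = {Suc 0..<Suc M}" by (auto simp: M_def)
    have shift: "(\<Sum>m\<in>{1..<2^N}. F m) = (\<Sum>m<M. F (Suc m))" for F :: "nat \<Rightarrow> real"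
      unfolding M lessThan_atLeast0 by (rule sum.shift_bounds_Suc_ivl)
    define e where "e m = unit_indicator (J (Suc m))" for m
    define e' where "e' m = unit_indicator (K (Suc m))" for m
    have se: "sq_integrable lborel_pos (e m)" "sq_integrable lborel_pos (e' m)" for m
      unfolding e_def e'_def by (rule sq_integrable_test, fact, simp)+
    have on: "orthonormal_on {..<M} (\<lambda>m. abs_l2 (e m))" "orthonormal_on {..<M} (\<lambda>m. abs_l2 (e' m))"
      using orthonormal_test_sets[OF J order_refl] orthonormal_test_sets[OF K order_refl]
      by (auto simp: orthonormal_on_def e_def e'_def)
    define k where "k = diagonal_kernel (\<lambda>m. w (Suc m)) e e' {..<M}"
    have sk: "sq_integrable lborel_pos2 k"
      unfolding k_def by (intro sq_integrable_diagonal_kernel se)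
    have w: "0 \<le> w (Suc m)" "i \<le> j \<Longrightarrow> w (Suc j) \<le> w (Suc i)" for m i j
      using p by (auto simp: w_def intro!: powr_mono2')
    have kq: "integral_operator k \<in> schatten q" if "0 < q" for q
      unfolding k_def by (rule schatten_diagonal_kernel(1)[OF se(1) se(2) on w that])
    have "schatten_norm p (integral_operator k) \<le> (\<Sum>m<M. w (Suc m) powr p) powr (1/p)"
      unfolding k_def by (rule schatten_diagonal_kernel(2)[OF se(1) se(2) on w]) (use p in auto)
    also have "\<dots> \<le> real N powr (1/p)"
    proof (rule powr_mono2)
      have "(\<Sum>m<M. w (Suc m) powr p) = (\<Sum>m\<in>{1..<2^N}. w m powr p)"
        by (rule shift[symmetric])
      also have "\<dots> \<le> 1 * real N"
      proof (rule dyadic_sum_le)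
        fix n m :: nat assume "m \<in> {2^n..<2^Suc n}"
        note b = dyadic_bounds[OF this]
        have "w m powr p = real m powr (-1)" using p by (simp add: w_def powr_powr)
        also have "\<dots> = 1 / real m" using b(4) by (simp add: powr_minus_divide)
        also have "\<dots> \<le> 1 / 2^n" using b(1,4) by (intro divide_left_mono) auto
        finally show "w m powr p \<le> 1 / 2^n" .
      qed
      finally show "(\<Sum>m<M. w (Suc m) powr p) \<le> real N" by simp
    qed (use p in \<open>auto intro: sum_nonneg\<close>)
    finally have nk: "schatten_norm p (integral_operator k) \<le> real N powr (1/p)" .
    obtain \<phi> where \<phi>: "hankel_projection \<alpha> \<beta> k \<phi>" "Q (integral_operator k) = integral_operator (hankel_kernel \<alpha> \<beta> \<phi>)"
      by (rule averaging_projection_symbol[OF Q sk])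
    have st: "sq_integrable lborel_pos2 (tensor f g)" by (rule sq_integrable_tensor[OF fg(1,2)])
    obtain \<psi> where \<psi>: "hankel_projection \<alpha> \<beta> (tensor f g) \<psi>"
      by (rule averaging_projection_symbol[OF Q st])
    have h\<phi>: "sq_integrable lborel_pos2 (hankel_kernel \<alpha> \<beta> \<phi>)" and h\<psi>: "sq_integrable lborel_pos2 (hankel_kernel \<alpha> \<beta> \<psi>)"
      using \<phi>(1) \<psi> by (simp_all add: hankel_projection_def)
    let ?G = "integral_operator (hankel_kernel \<alpha> \<beta> \<phi>)"
    have "c * 2 powr (- 1/p) * real N \<le> (\<Sum>m\<in>{1..<2^N}. w m *
        Re (cip (integral_operator (hankel_kernel \<alpha> \<beta> \<psi>) (abs_l2 (unit_indicator (K m)))) (abs_l2 (unit_indicator (J m)))))"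
    proof (rule dyadic_sum_ge)
      fix n m :: nat assume n: "n < N" and m: "m \<in> {2^n..<2^Suc n}"
      note b = dyadic_bounds[OF m]
      let ?x = "Re (cip (integral_operator (hankel_kernel \<alpha> \<beta> \<psi>) (abs_l2 (unit_indicator (K m)))) (abs_l2 (unit_indicator (J m))))"
      have pos: "0 < measure lborel_pos (J m) * measure lborel_pos (K m)"
        using J K b(4) by (auto simp: test_sets_def)
      have "c * 2 powr (- (real n * \<tau>)) * sqrt (measure lborel_pos (J m) * measure lborel_pos (K m)) \<le>
          Re (block (hankel_kernel \<alpha> \<beta> \<psi>) (J m) (K m))"
        using fg(4)[OF \<psi> n] m unfolding scale_diagonal_def by blast
      then have x: "c * 2 powr (- (real n * \<tau>)) \<le> ?x"
        using pos by (simp add: cip_integral_operator_unit_indicator[OF h\<psi> J b(4) K b(4)] pos_le_divide_eq Re_divide_of_real)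
      have wm: "2 powr (- (real (Suc n) / p)) \<le> w m"
      proof -
        have "(2 powr real (Suc n)) powr (- 1/p) \<le> real m powr (- 1/p)"
          using b p by (intro powr_mono2') (auto simp: powr_add powr_realpow)
        then show ?thesis by (simp add: w_def powr_powr)
      qed
      have "c * 2 powr (- 1/p) / 2^n = c * (2 powr (- 1/p) * 2 powr (- real n))"
        by (simp add: powr_minus_divide powr_realpow)
      also have "\<dots> \<le> c * (2 powr (- 1/p) * 2 powr (- (real n * (1/p + \<tau>))))"
        using c(1) mult_left_mono[OF \<tau> of_nat_0_le_iff, of n] by (intro mult_left_mono powr_mono) auto
      also have "\<dots> = 2 powr (- (real (Suc n) / p)) * (c * 2 powr (- (real n * \<tau>)))"
        proof -
          have "- 1/p + - (real n * (1/p + \<tau>)) = - (real (Suc n) / p) + - (real n * \<tau>)"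
            by (simp add: algebra_simps add_divide_distrib)
          then show ?thesis by (simp only: mult.left_commute[of _ c] powr_add[symmetric])
        qed
      also have "\<dots> \<le> w m * ?x" using wm x c(1) by (intro mult_mono) (auto simp: w_def)
      finally show "c * 2 powr (- 1/p) / 2^n \<le> w m * ?x" .
    qed
    also have "\<dots> = Re (LINT z|lborel_pos2. hankel_kernel \<alpha> \<beta> \<psi> z * cnj (k z))"
    proof -
      have kz: "hankel_kernel \<alpha> \<beta> \<psi> z * cnj (k z) =
          (\<Sum>m<M. complex_of_real (w (Suc m)) * (hankel_kernel \<alpha> \<beta> \<psi> z * tensor (\<lambda>x. cnj (e m x)) (e' m) z))" for z
        by (simp add: k_def diagonal_kernel_def sum_distrib_left tensor_def case_prod_beta e_def e'_def mult_ac)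
      have "(LINT z|lborel_pos2. hankel_kernel \<alpha> \<beta> \<psi> z * cnj (k z)) =
          (\<Sum>m<M. LINT z|lborel_pos2. complex_of_real (w (Suc m)) * (hankel_kernel \<alpha> \<beta> \<psi> z * tensor (\<lambda>x. cnj (e m x)) (e' m) z))"
        unfolding kz
        by (rule Bochner_Integration.integral_sum)
          (intro integrable_mult_right sq_integrable_prod h\<psi> sq_integrable_tensor sq_integrable_cnj se)
      also have "\<dots> = (\<Sum>m<M. complex_of_real (w (Suc m)) *
          cip (integral_operator (hankel_kernel \<alpha> \<beta> \<psi>) (abs_l2 (e' m))) (abs_l2 (e m)))"
        by (simp add: cip_integral_operator[OF h\<psi> se(2) se(1)])
      finally show ?thesis
        unfolding shift by (simp add: e_def e'_def)
    qed
    also have "\<dots> = Re (LINT z|lborel_pos2. hankel_kernel \<alpha> \<beta> \<phi> z * cnj (tensor f g z))"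
      by (rule hankel_projection_duality[OF sk \<phi>(1) st \<psi>])
    also have "\<dots> = Re (cip (?G (abs_l2 (\<lambda>y. cnj (g y)))) (abs_l2 f))"
      unfolding cip_integral_operator[OF h\<phi> sq_integrable_cnj[OF fg(2)] fg(1)]
      by (simp add: tensor_def case_prod_beta)
    also have "\<dots> \<le> norm (?G (abs_l2 (\<lambda>y. cnj (g y)))) * norm (abs_l2 f)"
      using complex_Re_le_cmod cmod_cip_le order_trans by blast
    also have "\<dots> \<le> (norm ?G * norm (abs_l2 g)) * norm (abs_l2 f)"
      using norm_blinfun[of ?G "abs_l2 (\<lambda>y. cnj (g y))"]
      by (intro mult_right_mono) (auto simp: norm_abs_l2_cnj[OF fg(2)])
    also have "\<dots> = norm ?G * (norm (abs_l2 f) * norm (abs_l2 g))" by simp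
    also have "\<dots> \<le> (max C 0 * (real N + 1) powr (1/p)) * (sqrt (max B 0) * (real N + 1) powr (1/2))"
    proof (rule mult_mono)
      have G: "?G \<in> schatten p" "schatten_norm p ?G \<le> C * schatten_norm p (integral_operator k)"
        using ext[OF kq kq] \<phi>(2) p by auto
      have "norm ?G \<le> schatten_norm p ?G" by (rule schatten_norm_ge_norm[OF G(1)]) (use p in simp)
      also have "\<dots> \<le> max C 0 * schatten_norm p (integral_operator k)"
        by (rule order_trans[OF G(2)], rule mult_right_mono) (auto simp: schatten_norm_def)
      also have "\<dots> \<le> max C 0 * (real N + 1) powr (1/p)"
        using p by (intro mult_left_mono order_trans[OF nk] powr_mono2) auto
      finally show "norm ?G \<le> max C 0 * (real N + 1) powr (1/p)" .
      have "norm (abs_l2 f) * norm (abs_l2 g) \<le> sqrt (max B 0) * sqrt (real N)"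
        by (rule le_sqrt_mult[OF fg(3)]) simp
      also have "\<dots> \<le> sqrt (max B 0) * (real N + 1) powr (1/2)"
        by (intro mult_left_mono) (auto simp: powr_half_sqrt)
      finally show "norm (abs_l2 f) * norm (abs_l2 g) \<le> sqrt (max B 0) * (real N + 1) powr (1/2)" .
    qed auto
    also have "\<dots> = max C 0 * sqrt (max B 0) * (real N + 1) powr (1/p + 1/2)"
      by (simp add: powr_add mult_ac)
    finally show ?thesis .
  qed
  have q: "1/p + 1/2 < 1" using p by (simp add: field_simps)
  have c_pos: "0 < c * 2 powr (- 1/p)" using c(1) by simp
  show False by (rule linear_not_le_sublinear[OF c_pos q bound])
qed

theorem theorem5p4:
  fixes p \<alpha> \<beta> :: real and Q :: "(l2 \<Rightarrow>\<^sub>L l2) \<Rightarrow> (l2 \<Rightarrow>\<^sub>L l2)"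
  assumes "0 < p" and "0 < \<alpha>" and "0 < \<beta>"
    and "is_averaging_projection \<alpha> \<beta> Q"
    and "bounded_on_schatten p Q"
  shows "1 \<le> p \<and> - p < max \<alpha> \<beta> * (p - 2) \<and> max \<alpha> \<beta> * (p - 2) < p"
proof -
  note p = assms(1) and \<alpha> = assms(2) and \<beta> = assms(3) and Q = assms(4)
  have max_pos: "0 < max \<alpha> \<beta>" using \<alpha> by simp
  have ts: "test_sets (left_test x)" "test_sets (right_test y)" if "0 < x" "0 < y" for x y
    using that by (auto intro: test_sets_left test_sets_right)
  have t\<alpha>: "scale_test \<alpha> \<beta> (left_test \<alpha>) (right_test \<beta>) ((1 + 1/\<alpha>) / 2)"
    by (rule scale_test_hankel[OF \<alpha> \<beta>])
  have t\<beta>: "scale_test \<alpha> \<beta> (right_test \<alpha>) (left_test \<beta>) ((1 + 1/\<beta>) / 2)"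
    by (rule scale_test_swap[OF scale_test_hankel[OF \<beta> \<alpha>] ts[OF \<beta> \<alpha>]])
  consider "p < 2" | "p = 2" | "2 < p" by linarith
  then show ?thesis
  proof cases
    case 1
    then obtain C where bd: "\<And>T. T \<in> schatten p \<Longrightarrow> Q T \<in> schatten p \<and> schatten_norm p (Q T) \<le> C * schatten_norm p T"
      using assms(5) by (auto simp: bounded_on_schatten_def)
    have "1 \<le> p" by (rule bounded_exponent_ge_1[OF \<alpha> \<beta> Q bd p])
    have less: "x * (2 - p) < p" if "0 < x" "1 < p * ((1 + 1/x) / 2)" for x
      using that by (simp add: field_simps)
    have "\<alpha> * (2 - p) < p" "\<beta> * (2 - p) < p"
      using scale_test_exponent_less_2[OF Q bd p 1 ts[OF \<alpha> \<beta>] t\<alpha>]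
        scale_test_exponent_less_2[OF Q bd p 1 ts(2)[OF \<beta> \<alpha>] ts(1)[OF \<beta> \<alpha>] t\<beta>] less \<alpha> \<beta> by auto
    then have "max \<alpha> \<beta> * (2 - p) < p" by (simp add: max_def)
    moreover have "max \<alpha> \<beta> * (p - 2) < 0" using max_pos 1 by (simp add: mult_pos_neg)
    ultimately show ?thesis using \<open>1 \<le> p\<close> p by (simp add: algebra_simps)
  next
    case 2
    then show ?thesis by simp
  next
    case 3
    then obtain \<Phi> where \<Phi>: "schatten_bounded_linear p \<Phi>" "\<And>T. T \<in> schatten p \<Longrightarrow> T \<in> schatten 2 \<Longrightarrow> \<Phi> T = Q T"
      using assms(5) by (auto simp: bounded_on_schatten_def)
    then obtain C where C: "\<And>T. T \<in> schatten p \<Longrightarrow> \<Phi> T \<in> schatten p \<and> schatten_norm p (\<Phi> T) \<le> C * schatten_norm p T"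
      unfolding schatten_bounded_linear_def by blast
    have ext: "Q T \<in> schatten p \<and> schatten_norm p (Q T) \<le> C * schatten_norm p T"
      if "T \<in> schatten p" "T \<in> schatten 2" for T
      using C[OF that(1)] \<Phi>(2)[OF that] by simp
    have less: "x * (p - 2) < p" if "0 < x" "1 - 1/p < (1 + 1/x) / 2" for x
      using that 3 by (simp add: field_simps)
    have "\<alpha> * (p - 2) < p" "\<beta> * (p - 2) < p"
      using scale_test_exponent_greater_2[OF Q ext 3 ts[OF \<alpha> \<beta>] t\<alpha>]
        scale_test_exponent_greater_2[OF Q ext 3 ts(2)[OF \<beta> \<alpha>] ts(1)[OF \<beta> \<alpha>] t\<beta>] less \<alpha> \<beta> by auto
    then have "max \<alpha> \<beta> * (p - 2) < p" by (simp add: max_def)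
    moreover have "0 < max \<alpha> \<beta> * (p - 2)" using max_pos 3 by simp
    ultimately show ?thesis using 3 by linarith
  qed
qed

end
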